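(* Let $A$ be a maximal indecomposable cyclotomic $\mathbb{Z}[i]$-matrix that has at least one nonzero entry on the diagonal. Then $A$ is equivalent to an adjacency matrix of one of the graphs $C_{2k}^{++}$ ($k\geqslant 2$), $C_{2k}^{+-}$ ($k\geqslant 2$), $C_{2k+1}$ ($k\geqslant 1$), $S_1$, $S_4$, $S_4^\dagger$, $S_7$, $S_8$, $S_8'$.
   Context: **Matrices.** Let $R=\mathbb{Z}[i]$. A cyclotomic matrix over $R$ is a (finite, square) Hermitian matrix with entries in $R$ all of whose eigenvalues lie in $[-2,2]$. A Hermitian $R$-matrix is the adjacency matrix $(w(u,v))_{u,v}$ of a weighted directed graph ($R$-graph) with weight function $w$ satisfying $w(v,u)=\overline{w(u,v)}$; $w(v,v)$ is the charge of $v$. A matrix is indecomposable if its underlying graph (distinct $u,v$ adjacent iff $w(u,v)\neq 0$) is connected. An indecomposable cyclotomic $R$-matrix is maximal if it is not a (proper) principal submatrix of any other indecomposable cyclotomic $R$-matrix. Two $n\times n$ matrices $A,B$ over $R$ are equivalent if $A=\pm\sigma(QBQ^* )$ for some unitary matrix $Q$ with entries in $R$ ($QQ^*=Q^*Q=I$), some choice of sign, and $\sigma$ either the identity or complex conjugation applied entrywise. **Graphs.** Weights not determined by the listed ones via $w(v,u)=\overline{w(u,v)}$ are $0$; in particular vertices are uncharged unless a charge is listed. "Ladder on $t_1,b_1,\dots,t_k,b_k$" means: for $1\le j\le k-1$, $w(t_j,t_{j+1})=w(t_j,b_{j+1})=1$ and $w(b_j,t_{j+1})=w(b_j,b_{j+1})=-1$.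 $C_{2k}^{++}$ ($k\ge2$): ladder on $t_1,b_1,\dots,t_k,b_k$, with $t_1,b_1,t_k,b_k$ of charge $1$, $w(t_1,b_1)=1$, $w(t_k,b_k)=-1$. $C_{2k}^{+-}$ ($k\ge2$): ladder on $t_1,b_1,\dots,t_k,b_k$, with $t_1,b_1$ of charge $1$, $t_k,b_k$ of charge $-1$, $w(t_1,b_1)=1$, $w(t_k,b_k)=1$. $C_{2k+1}$ ($k\ge1$): ladder on $t_1,b_1,\dots,t_k,b_k$ and one further vertex $p$, with $w(t_1,p)=w(b_1,p)=1+i$, $t_k,b_k$ of charge $1$, $w(t_k,b_k)=-1$. $S_1$: a single vertex of charge $2$. $S_4$: vertices $a,b,c,d$ of charges $1,-1,-1,1$; $w(a,b)=w(c,d)=1$, $w(a,c)=-1-i$, $w(b,d)=1+i$. $S_4^\dagger$: vertices $a,b,c,d$ of charges $1,0,-1,0$; $w(a,b)=w(c,d)=w(b,c)=1$, $w(a,d)=-1$, $w(c,a)=i$, $w(b,d)=1+i$. $S_7$: vertices $a,\dots,g$; $a,e,f$ have charge $1$, $d$ has charge $-1$, $b,c,g$ charge $0$; weight $1$: $ab, ad, cf, bg, de, df, cg, eg, bc$; weight $-1$: $ac, fg, be$. $S_8$: vertices $a,\dots,h$; $b,c,e,h$ have charge $1$, $a,d,f,g$ charge $-1$; weight $1$: $ab, ae, cg, cd, bd, ef, eg, fh, dh$; weight $-1$: $ac, bf, gh$. $S_8'$: vertices $a,\dots,h$; $b,g$ have charge $1$, $a,h$ charge $-1$, $c,d,e,f$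 charge $0$; weight $1$: $ab, ac, ae, cg, bd, ef, gh, fh, dh, df, ce$; weight $-1$: $cd, bf, eg$. *)

theory Defs
  imports
    "Jordan_Normal_Form.Schur_Decomposition"
    "Jordan_Normal_Form.DL_Submatrix"
    "Graph_Theory.Digraph_Component"
begin

section \<open>Cyclotomic matrices over the Gaussian integers\<close>

definition gauss_ints :: "complex set" where
  "gauss_ints = {of_int a + \<i> * of_int b | a b. True}"

definition gauss_mats :: "nat \<Rightarrow> complex mat set" where
  "gauss_mats n = {A \<in> carrier_mat n n. elements_mat A \<subseteq> gauss_ints}"

definition cyclotomic :: "complex mat \<Rightarrow> bool" where
  "cyclotomic A \<longleftrightarrow>
     A \<in> gauss_mats (dim_row A) \<and> mat_adjoint A = A \<and>
     (\<forall>x. eigenvalue A x \<longrightarrow> x \<in> complex_of_real ` {-2..2})"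

definition underlying_graph :: "complex mat \<Rightarrow> nat pair_pre_digraph" where
  "underlying_graph A =
     \<lparr> pverts = {0..<dim_row A},
       parcs = {(u, v). u < dim_row A \<and> v < dim_row A \<and> u \<noteq> v \<and> A $$ (u, v) \<noteq> 0} \<rparr>"

text \<open>
  The library's notion of connectedness excludes the null graph, so the empty matrix is
  not indecomposable.
\<close>

definition indecomposable :: "complex mat \<Rightarrow> bool" where
  "indecomposable A \<longleftrightarrow> Digraph_Component.connected (with_proj (underlying_graph A))"

definition maximal_indecomposable_cyclotomic :: "complex mat \<Rightarrow> bool" where
  "maximal_indecomposable_cyclotomic A \<longleftrightarrow>
     indecomposable A \<and> cyclotomic A \<and>
     \<not> (\<exists>B I. indecomposable B \<and> cyclotomic B \<and>
            I \<subset> {0..<dim_row B} \<and> A = submatrix B I I)"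

definition equivalent_mats :: "complex mat \<Rightarrow> complex mat \<Rightarrow> bool" where
  "equivalent_mats A B \<longleftrightarrow>
     (\<exists>n. A \<in> gauss_mats n \<and> B \<in> gauss_mats n \<and>
       (\<exists>Q \<in> gauss_mats n. Q * mat_adjoint Q = 1\<^sub>m n \<and> mat_adjoint Q * Q = 1\<^sub>m n \<and>
         (\<exists>s \<in> {1, -1}. \<exists>\<sigma> \<in> {id, cnj}.
            A = s \<cdot>\<^sub>m map_mat \<sigma> (Q * B * mat_adjoint Q))))"


section \<open>The weighted graphs\<close>

text \<open>
  A weighted graph is given by an enumeration of its vertices and the listed weights,
  where the weight of \<open>(v, v)\<close> is the charge of \<open>v\<close>. At most one of
  \<open>(u, v)\<close> and \<open>(v, u)\<close> is listed; the other weight is its conjugate. The order of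
  the enumeration is immaterial, since permutation matrices are among the unitary matrices
  allowed in \<^const>\<open>equivalent_mats\<close>.
\<close>

type_synonym 'v wgraph = "'v list \<times> ('v \<times> 'v \<Rightarrow> complex option)"

definition weight :: "('v \<times> 'v \<Rightarrow> complex option) \<Rightarrow> 'v \<Rightarrow> 'v \<Rightarrow> complex" where
  "weight w u v =
     (case w (u, v) of
        Some z \<Rightarrow> z
      | None \<Rightarrow> (case w (v, u) of Some z \<Rightarrow> cnj z | None \<Rightarrow> 0))"

fun adjacency_mat :: "'v wgraph \<Rightarrow> complex mat" where
  "adjacency_mat (vs, w) =
     mat (length vs) (length vs) (\<lambda>(i, j). weight w (vs ! i) (vs ! j))"

text \<open>
  \<open>Top j\<close>, \<open>Bot j\<close> and \<open>Apex\<close> stand for the vertices $t_j$, $b_j$ and $p$. The function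
  \<open>ladder\<close> describes the infinite ladder; the vertex list cuts out the part with $k$ rungs.
\<close>

datatype ladder_vertex = Top nat | Bot nat | Apex

fun ladder :: "ladder_vertex \<times> ladder_vertex \<Rightarrow> complex option" where
  "ladder (Top i, Top j) = (if j = Suc i then Some 1 else None)"
| "ladder (Top i, Bot j) = (if j = Suc i then Some 1 else None)"
| "ladder (Bot i, Top j) = (if j = Suc i then Some (-1) else None)"
| "ladder (Bot i, Bot j) = (if j = Suc i then Some (-1) else None)"
| "ladder _ = None"

definition ladder_vertices :: "nat \<Rightarrow> ladder_vertex list" where
  "ladder_vertices k = concat (map (\<lambda>j. [Top j, Bot j]) [1..<Suc k])"

text \<open>\<open>C_pp k\<close>, \<open>C_pm k\<close> and \<open>C_odd k\<close> are $C_{2k}^{++}$, $C_{2k}^{+-}$ and $C_{2k+1}$.\<close>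

definition C_pp :: "nat \<Rightarrow> ladder_vertex wgraph" where
  "C_pp k = (ladder_vertices k,
    ladder((Top 1, Top 1) \<mapsto> 1, (Bot 1, Bot 1) \<mapsto> 1, (Top 1, Bot 1) \<mapsto> 1,
      (Top k, Top k) \<mapsto> 1, (Bot k, Bot k) \<mapsto> 1, (Top k, Bot k) \<mapsto> -1))"

definition C_pm :: "nat \<Rightarrow> ladder_vertex wgraph" where
  "C_pm k = (ladder_vertices k,
    ladder((Top 1, Top 1) \<mapsto> 1, (Bot 1, Bot 1) \<mapsto> 1, (Top 1, Bot 1) \<mapsto> 1,
      (Top k, Top k) \<mapsto> -1, (Bot k, Bot k) \<mapsto> -1, (Top k, Bot k) \<mapsto> 1))"

definition C_odd :: "nat \<Rightarrow> ladder_vertex wgraph" where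
  "C_odd k = (ladder_vertices k @ [Apex],
    ladder((Top 1, Apex) \<mapsto> 1 + \<i>, (Bot 1, Apex) \<mapsto> 1 + \<i>,
      (Top k, Top k) \<mapsto> 1, (Bot k, Bot k) \<mapsto> 1, (Top k, Bot k) \<mapsto> -1))"

datatype letter = Va | Vb | Vc | Vd | Ve | Vf | Vg | Vh

definition S_1 :: "letter wgraph" where
  "S_1 = ([Va], [(Va, Va) \<mapsto> 2])"

definition S_4 :: "letter wgraph" where
  "S_4 = ([Va, Vb, Vc, Vd],
    [(Va, Va) \<mapsto> 1, (Vb, Vb) \<mapsto> -1, (Vc, Vc) \<mapsto> -1, (Vd, Vd) \<mapsto> 1,
     (Va, Vb) \<mapsto> 1, (Vc, Vd) \<mapsto> 1,
     (Va, Vc) \<mapsto> -1 - \<i>, (Vb, Vd) \<mapsto> 1 + \<i>])"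

definition S_4_dagger :: "letter wgraph" where
  "S_4_dagger = ([Va, Vb, Vc, Vd],
    [(Va, Va) \<mapsto> 1, (Vc, Vc) \<mapsto> -1,
     (Va, Vb) \<mapsto> 1, (Vc, Vd) \<mapsto> 1, (Vb, Vc) \<mapsto> 1,
     (Va, Vd) \<mapsto> -1,
     (Vc, Va) \<mapsto> \<i>, (Vb, Vd) \<mapsto> 1 + \<i>])"

definition S_7 :: "letter wgraph" where
  "S_7 = ([Va, Vb, Vc, Vd, Ve, Vf, Vg],
    [(Va, Va) \<mapsto> 1, (Vd, Vd) \<mapsto> -1, (Ve, Ve) \<mapsto> 1, (Vf, Vf) \<mapsto> 1,
     (Va, Vb) \<mapsto> 1, (Va, Vd) \<mapsto> 1, (Vc, Vf) \<mapsto> 1, (Vb, Vg) \<mapsto> 1, (Vd, Ve) \<mapsto> 1,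
     (Vd, Vf) \<mapsto> 1, (Vc, Vg) \<mapsto> 1, (Ve, Vg) \<mapsto> 1, (Vb, Vc) \<mapsto> 1,
     (Va, Vc) \<mapsto> -1, (Vf, Vg) \<mapsto> -1, (Vb, Ve) \<mapsto> -1])"

definition S_8 :: "letter wgraph" where
  "S_8 = ([Va, Vb, Vc, Vd, Ve, Vf, Vg, Vh],
    [(Va, Va) \<mapsto> -1, (Vb, Vb) \<mapsto> 1, (Vc, Vc) \<mapsto> 1, (Vd, Vd) \<mapsto> -1, (Ve, Ve) \<mapsto> 1, (Vf, Vf) \<mapsto> -1, (Vg, Vg) \<mapsto> -1, (Vh, Vh) \<mapsto> 1,
     (Va, Vb) \<mapsto> 1, (Va, Ve) \<mapsto> 1, (Vc, Vg) \<mapsto> 1, (Vc, Vd) \<mapsto> 1, (Vb, Vd) \<mapsto> 1,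
     (Ve, Vf) \<mapsto> 1, (Ve, Vg) \<mapsto> 1, (Vf, Vh) \<mapsto> 1, (Vd, Vh) \<mapsto> 1,
     (Va, Vc) \<mapsto> -1, (Vb, Vf) \<mapsto> -1, (Vg, Vh) \<mapsto> -1])"

definition S_8' :: "letter wgraph" where
  "S_8' = ([Va, Vb, Vc, Vd, Ve, Vf, Vg, Vh],
    [(Va, Va) \<mapsto> -1, (Vb, Vb) \<mapsto> 1, (Vg, Vg) \<mapsto> 1, (Vh, Vh) \<mapsto> -1,
     (Va, Vb) \<mapsto> 1, (Va, Vc) \<mapsto> 1, (Va, Ve) \<mapsto> 1, (Vc, Vg) \<mapsto> 1, (Vb, Vd) \<mapsto> 1,
     (Ve, Vf) \<mapsto> 1, (Vg, Vh) \<mapsto> 1, (Vf, Vh) \<mapsto> 1, (Vd, Vh) \<mapsto> 1, (Vd, Vf) \<mapsto> 1,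
     (Vc, Ve) \<mapsto> 1,
     (Vc, Vd) \<mapsto> -1, (Vb, Vf) \<mapsto> -1, (Ve, Vg) \<mapsto> -1])"

end

theory Submission
  imports Defs "Jordan_Normal_Form.Spectral_Radius"
begin

text \<open>
  Put \<open>D = 4 - A\<^sup>2\<close>, which is positive semidefinite. If \<open>y\<close> is a complex vector such that \<open>D y\<close> is
  integral and \<open>c\<close> an integer with \<open>\<bar>c + y\<^sup>* D A y\<bar> \<le> 2 (1 - y\<^sup>* D y)\<close>, then bordering \<open>A\<close> with
  the column \<open>D y\<close> and the charge \<open>c\<close> gives a cyclotomic matrix again. Short vectors \<open>y\<close> supported
  near a row of norm less than four therefore contradict maximality as soon as some charge is nonzero;
  hence all rows have norm four, and since the diagonal of \<open>D\<close> vanishes, \<open>A\<^sup>2 = 4\<close>.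

  The rest is local: distinct rows are orthogonal, which leaves few possibilities for the neighbours
  of a charged vertex. Two of them (\<open>star3\<close> and \<open>star4\<close>) lead to \<open>S_7\<close>, \<open>S_8\<close> and \<open>S_8'\<close>; each of the others
  either closes up to a small graph or starts a ladder that is forced to continue until one of its
  three possible ends.
\<close>

section \<open>Gaussian integers\<close>

lemma gauss_ints_iff: "z \<in> gauss_ints \<longleftrightarrow> Re z \<in> \<int> \<and> Im z \<in> \<int>"
proof
  assume "z \<in> gauss_ints"
  then show "Re z \<in> \<int> \<and> Im z \<in> \<int>" by (auto simp: gauss_ints_def)
next
  assume "Re z \<in> \<int> \<and> Im z \<in> \<int>"
  then obtain p q where "Re z = of_int p" "Im z = of_int q" by (auto elim!: Ints_cases)
  then have "z = of_int p + \<i> * of_int q" by (simp add: complex_eq_iff)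
  then show "z \<in> gauss_ints" by (auto simp: gauss_ints_def)
qed

lemma gauss_ints_simps [simp, intro]:
  "0 \<in> gauss_ints" "1 \<in> gauss_ints" "\<i> \<in> gauss_ints" "numeral k \<in> gauss_ints" "of_int m \<in> gauss_ints"
  by (auto simp: gauss_ints_iff)

lemma gauss_ints_closed [intro]:
  "x \<in> gauss_ints \<Longrightarrow> y \<in> gauss_ints \<Longrightarrow> x + y \<in> gauss_ints"
  "x \<in> gauss_ints \<Longrightarrow> y \<in> gauss_ints \<Longrightarrow> x - y \<in> gauss_ints"
  "x \<in> gauss_ints \<Longrightarrow> y \<in> gauss_ints \<Longrightarrow> x * y \<in> gauss_ints"
  "x \<in> gauss_ints \<Longrightarrow> - x \<in> gauss_ints"
  "x \<in> gauss_ints \<Longrightarrow> cnj x \<in> gauss_ints"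
  by (auto simp: gauss_ints_iff)

lemma gauss_ints_uminus_iff [simp]: "- x \<in> gauss_ints \<longleftrightarrow> x \<in> gauss_ints"
  and gauss_ints_cnj_iff [simp]: "cnj x \<in> gauss_ints \<longleftrightarrow> x \<in> gauss_ints"
  by (auto simp: gauss_ints_iff)

lemma gauss_ints_sum [intro]: "(\<And>i. i \<in> S \<Longrightarrow> f i \<in> gauss_ints) \<Longrightarrow> sum f S \<in> gauss_ints"
  by (induction S rule: infinite_finite_induct) auto

definition gnorm :: "complex \<Rightarrow> nat" where "gnorm z = nat \<lfloor>(cmod z)\<^sup>2\<rfloor>"

lemma gnorm_of_ints:
  assumes "Re z = of_int p" "Im z = of_int q"
  shows "gnorm z = nat (p\<^sup>2 + q\<^sup>2)"
proof -
  have "(cmod z)\<^sup>2 = of_int (p\<^sup>2 + q\<^sup>2)" by (simp add: cmod_power2 assms)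
  then show ?thesis unfolding gnorm_def by (metis floor_of_int)
qed

lemma gauss_ints_obtain:
  assumes "z \<in> gauss_ints"
  obtains p q where "Re z = of_int p" "Im z = of_int q" "gnorm z = nat (p\<^sup>2 + q\<^sup>2)"
  using assms gnorm_of_ints by (auto simp: gauss_ints_iff elim!: Ints_cases)

lemma of_nat_gnorm: "z \<in> gauss_ints \<Longrightarrow> real (gnorm z) = (cmod z)\<^sup>2"
  by (erule gauss_ints_obtain) (simp add: cmod_power2)

lemma complex_of_nat_gnorm: "z \<in> gauss_ints \<Longrightarrow> of_nat (gnorm z) = z * cnj z"
  using of_nat_gnorm[of z] by (metis complex_norm_square of_real_of_nat_eq)

lemma cmod_square: "(complex_of_real (cmod z))\<^sup>2 = z * cnj z"
  by (simp add: complex_norm_square flip: of_real_power)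

lemma gnorm_simps [simp]: "gnorm 0 = 0" "gnorm (- z) = gnorm z" "gnorm (cnj z) = gnorm z"
  by (auto simp: gnorm_def)

lemma gnorm_eq_0 [simp]: "z \<in> gauss_ints \<Longrightarrow> gnorm z = 0 \<longleftrightarrow> z = 0"
  using of_nat_gnorm[of z] by auto

lemma gnorm_mult: "x \<in> gauss_ints \<Longrightarrow> y \<in> gauss_ints \<Longrightarrow> gnorm (x * y) = gnorm x * gnorm y"
  using of_nat_gnorm[of x] of_nat_gnorm[of y] of_nat_gnorm[of "x * y"]
  by (simp add: norm_mult power_mult_distrib gauss_ints_closed(3))
    (metis of_nat_eq_iff of_nat_mult)

lemma int_square_ge_4: "\<bar>p\<bar> \<ge> 2 \<Longrightarrow> p\<^sup>2 \<ge> 4" for p :: int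
  using power_mono[of 2 "\<bar>p\<bar>" 2] by simp

lemma gnorm_cases:
  assumes "z \<in> gauss_ints"
  shows "gnorm z = 0 \<and> z = 0 \<or> gnorm z = 1 \<and> z \<in> {1, -1, \<i>, -\<i>}
    \<or> gnorm z = 2 \<and> z \<in> {1 + \<i>, 1 - \<i>, -1 + \<i>, -1 - \<i>} \<or> gnorm z \<ge> 4"
proof -
  obtain p q where *: "Re z = of_int p" "Im z = of_int q" "gnorm z = nat (p\<^sup>2 + q\<^sup>2)"
    using gauss_ints_obtain[OF assms] .
  show ?thesis
  proof (cases "\<bar>p\<bar> \<ge> 2 \<or> \<bar>q\<bar> \<ge> 2")
    case True
    then have "p\<^sup>2 + q\<^sup>2 \<ge> 4"
      using int_square_ge_4[of p] int_square_ge_4[of q] zero_le_power2[of p] zero_le_power2[of q] by linarith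
    then show ?thesis using * by linarith
  next
    case False
    then have "(p = -1 \<or> p = 0 \<or> p = 1) \<and> (q = -1 \<or> q = 0 \<or> q = 1)" by arith
    then show ?thesis unfolding complex_eq_iff *(3) insert_iff
      by (elim conjE disjE) (simp_all add: *(1,2))
  qed
qed

lemma gnorm_eq_1: "z \<in> gauss_ints \<Longrightarrow> gnorm z = 1 \<longleftrightarrow> z * cnj z = 1"
  using complex_of_nat_gnorm[of z] by (metis of_nat_1 of_nat_eq_iff)

section \<open>Hermitian forms\<close>

locale hermitian_form =
  fixes n :: nat and a :: "nat \<Rightarrow> nat \<Rightarrow> complex"
  assumes outside: "\<not> (i < n \<and> j < n) \<Longrightarrow> a i j = 0"
    and herm: "a j i = cnj (a i j)"
begin

definition ip :: "(nat \<Rightarrow> complex) \<Rightarrow> (nat \<Rightarrow> complex) \<Rightarrow> complex" where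
  "ip u v = (\<Sum>i<n. cnj (u i) * v i)"

definition nsq :: "(nat \<Rightarrow> complex) \<Rightarrow> real" where
  "nsq v = (\<Sum>i<n. (cmod (v i))\<^sup>2)"

definition ap :: "(nat \<Rightarrow> complex) \<Rightarrow> nat \<Rightarrow> complex" where
  "ap v i = (\<Sum>j<n. a i j * v j)"

lemma ip_lin:
  "ip (\<lambda>i. u i + v i) w = ip u w + ip v w"
  "ip (\<lambda>i. u i - v i) w = ip u w - ip v w"
  "ip (\<lambda>i. c * u i) w = cnj c * ip u w"
  "ip w (\<lambda>i. u i + v i) = ip w u + ip w v"
  "ip w (\<lambda>i. u i - v i) = ip w u - ip w v"
  "ip w (\<lambda>i. c * u i) = c * ip w u"
  by (simp_all add: ip_def algebra_simps sum.distrib sum_subtractf sum_distrib_left)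

lemma ap_lin:
  "ap (\<lambda>i. u i + v i) = (\<lambda>i. ap u i + ap v i)"
  "ap (\<lambda>i. u i - v i) = (\<lambda>i. ap u i - ap v i)"
  "ap (\<lambda>i. c * u i) = (\<lambda>i. c * ap u i)"
  by (simp_all add: ap_def fun_eq_iff algebra_simps sum.distrib sum_subtractf sum_distrib_left)

lemma ip_cnj: "cnj (ip u v) = ip v u"
  by (simp add: ip_def mult.commute)

lemma ip_ap: "ip u (ap v) = ip (ap u) v"
proof -
  have "ip u (ap v) = (\<Sum>i<n. \<Sum>j<n. cnj (u i) * (a i j * v j))"
    by (simp add: ip_def ap_def sum_distrib_left)
  also have "\<dots> = (\<Sum>j<n. \<Sum>i<n. cnj (u i) * (a i j * v j))" by (rule sum.swap)
  also have "\<dots> = (\<Sum>j<n. \<Sum>i<n. cnj (a j i) * cnj (u i) * v j)"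
    by (intro sum.cong refl) (subst herm, simp add: mult_ac)
  also have "\<dots> = ip (ap u) v" by (simp add: ip_def ap_def sum_distrib_right)
  finally show ?thesis .
qed

lemma ip_self: "ip v v = of_real (nsq v)"
  by (simp add: ip_def nsq_def cmod_square mult.commute)

lemma nsq_nonneg: "nsq v \<ge> 0"
  by (simp add: nsq_def sum_nonneg)

lemma cauchy_schwarz: "(cmod (ip u v))\<^sup>2 \<le> nsq u * nsq v"
proof (cases "nsq u = 0")
  case True
  then have "u i = 0" if "i < n" for i
    using that by (simp add: nsq_def sum_nonneg_eq_0_iff)
  then have "ip u v = 0" by (simp add: ip_def)
  then show ?thesis using True by simp
next
  case False
  then have pos: "nsq u > 0" using nsq_nonneg[of u] by simp
  define s where "s = ip u v / of_real (nsq u)"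
  have "ip (\<lambda>i. v i - s * u i) (\<lambda>i. v i - s * u i)
     = ip v v - s * ip v u - cnj s * ip u v + cnj s * s * ip u u"
    by (simp add: ip_lin algebra_simps)
  also have "\<dots> = of_real (nsq v - (cmod (ip u v))\<^sup>2 / nsq u)"
  proof -
    have vu: "ip v u = cnj (ip u v)" by (simp add: ip_cnj)
    have "s * ip v u = (ip u v * cnj (ip u v)) / of_real (nsq u)"
      "cnj s * ip u v = (ip u v * cnj (ip u v)) / of_real (nsq u)"
      "cnj s * s * ip u u = (ip u v * cnj (ip u v)) / of_real (nsq u)"
      using pos by (simp_all add: s_def vu ip_self)
    then show ?thesis by (simp add: ip_self cmod_square)
  qed
  finally have "nsq (\<lambda>i. v i - s * u i) = nsq v - (cmod (ip u v))\<^sup>2 / nsq u"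
    by (simp only: ip_self of_real_eq_iff)
  then have "(cmod (ip u v))\<^sup>2 / nsq u \<le> nsq v" using nsq_nonneg[of "\<lambda>i. v i - s * u i"] by linarith
  then show ?thesis using pos by (simp add: field_simps)
qed

lemma log_convex: "(nsq (ap v))\<^sup>2 \<le> nsq v * nsq (ap (ap v))"
proof -
  have "nsq (ap v) = cmod (ip v (ap (ap v)))"
    using nsq_nonneg[of "ap v"] by (simp add: ip_ap ip_self)
  then show ?thesis using cauchy_schwarz[of v "ap (ap v)"] by simp
qed

lemma nsq_funpow_ge:
  assumes r: "nsq (ap v) \<ge> r * nsq v" "r \<ge> 0" and pos: "nsq v > 0" "nsq (ap v) > 0"
  shows "nsq ((ap ^^ k) v) \<ge> r ^ k * nsq v"
proof -
  have "nsq ((ap ^^ k) v) > 0 \<and> nsq ((ap ^^ Suc k) v) > 0 \<and>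
    nsq ((ap ^^ Suc k) v) \<ge> r * nsq ((ap ^^ k) v)" for k
  proof (induction k)
    case 0
    then show ?case using assms by simp
  next
    case (Suc k)
    let ?p = "nsq ((ap ^^ k) v)" and ?q = "nsq ((ap ^^ Suc k) v)" and ?s = "nsq ((ap ^^ Suc (Suc k)) v)"
    have lc: "?q\<^sup>2 \<le> ?p * ?s" using log_convex[of "(ap ^^ k) v"] by simp
    have p: "?p > 0" and q: "?q > 0" and qp: "?q \<ge> r * ?p" using Suc by auto
    have "0 < ?p * ?s" using lc q by (smt (verit) zero_less_power)
    then have s: "?s > 0" using p zero_less_mult_pos by blast
    have "?p * (r * ?q) \<le> ?q * ?q" using qp q by (simp add: mult.assoc[symmetric] mult.commute)
    also have "\<dots> \<le> ?p * ?s" using lc by (simp add: power2_eq_square)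
    finally have "r * ?q \<le> ?s" using p by (simp only: mult_le_cancel_left_pos)
    then show ?case using q s by simp
  qed
  note step = this
  show ?thesis
  proof (induction k)
    case (Suc k)
    have "r ^ Suc k * nsq v \<le> r * nsq ((ap ^^ k) v)"
      using Suc r(2) by (simp add: mult.assoc mult_left_mono)
    also have "\<dots> \<le> nsq ((ap ^^ Suc k) v)" using step[of k] by blast
    finally show ?case .
  qed simp
qed

end

section \<open>Cyclotomic matrices as bounded Hermitian forms\<close>

definition entries :: "complex mat \<Rightarrow> nat \<Rightarrow> nat \<Rightarrow> complex" where
  "entries A i j = (if i < dim_row A \<and> j < dim_row A then A $$ (i, j) else 0)"

lemma adjoint_index:
  "A \<in> carrier_mat n n \<Longrightarrow> i < n \<Longrightarrow> j < n \<Longrightarrow> mat_adjoint A $$ (i, j) = cnj (A $$ (j, i))"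
  for A :: "complex mat"
  by (auto simp: mat_adjoint_def mat_of_rows_def)

lemma adjoint_carrier: "A \<in> carrier_mat n n \<Longrightarrow> mat_adjoint A \<in> carrier_mat n n"
  by (auto simp: mat_adjoint_def)

lemma gauss_mats_iff:
  "A \<in> gauss_mats n \<longleftrightarrow> A \<in> carrier_mat n n \<and> (\<forall>i<n. \<forall>j<n. A $$ (i, j) \<in> gauss_ints)"
  by (fastforce simp: gauss_mats_def elements_mat_def)

lemma eigenvalue_scale:
  assumes A: "(A :: complex mat) \<in> carrier_mat n n" and s: "s \<noteq> 0"
    and ev: "eigenvalue (inverse s \<cdot>\<^sub>m A) x"
  shows "eigenvalue A (s * x)"
proof -
  obtain v where v: "v \<in> carrier_vec n" "v \<noteq> 0\<^sub>v n" "(inverse s \<cdot>\<^sub>m A) *\<^sub>v v = x \<cdot>\<^sub>v v"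
    using ev A by (auto simp: eigenvalue_def eigenvector_def)
  have "A *\<^sub>v v = s \<cdot>\<^sub>v ((inverse s \<cdot>\<^sub>m A) *\<^sub>v v)"
    using A v(1) s by (intro eq_vecI) (auto simp: scalar_prod_def sum_distrib_left simp flip: mult.assoc)
  also have "\<dots> = (s * x) \<cdot>\<^sub>v v" by (simp add: v smult_smult_assoc)
  finally show ?thesis using A v by (auto simp: eigenvalue_def eigenvector_def)
qed

lemma cyclotomic_hermitian_form:
  assumes "cyclotomic A"
  shows "hermitian_form (dim_row A) (entries A)"
proof
  have A: "A \<in> carrier_mat (dim_row A) (dim_row A)" and adj: "mat_adjoint A = A"
    using assms by (auto simp: cyclotomic_def gauss_mats_def)
  show "entries A j i = cnj (entries A i j)" for i j
    using adjoint_index[OF A, of j i] adj by (auto simp: entries_def)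
qed (auto simp: entries_def)

lemma cyclotomic_contraction:
  assumes cyc: "cyclotomic A"
  shows "hermitian_form.nsq (dim_row A) (hermitian_form.ap (dim_row A) (entries A) v)
    \<le> 4 * hermitian_form.nsq (dim_row A) v"
proof -
  define n where "n = dim_row A"
  define a where "a = entries A"
  interpret hermitian_form n a unfolding n_def a_def by (rule cyclotomic_hermitian_form[OF cyc])
  have A: "A \<in> carrier_mat n n" using cyc by (auto simp: cyclotomic_def gauss_mats_def n_def)
  have ev: "\<And>x. eigenvalue A x \<Longrightarrow> cmod x \<le> 2"
    using cyc by (force simp: cyclotomic_def)
  have "nsq (ap v) \<le> 4 * nsq v"
  proof (rule ccontr)
    assume "\<not> ?thesis"
    then have gt: "nsq (ap v) > 4 * nsq v" by simp
    have v0: "nsq v > 0"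
    proof (rule ccontr)
      assume "\<not> nsq v > 0"
      then have "nsq v = 0" using nsq_nonneg[of v] by simp
      then have "v i = 0" if "i < n" for i
        using that by (simp add: nsq_def sum_nonneg_eq_0_iff)
      then have "nsq (ap v) = 0" by (simp add: nsq_def ap_def)
      then show False using gt \<open>nsq v = 0\<close> by simp
    qed
    have n0: "n > 0"
    proof (rule ccontr)
      assume "\<not> n > 0"
      then have "nsq v = 0" unfolding nsq_def by simp
      then show False using v0 by simp
    qed
    define r where "r = nsq (ap v) / nsq v"
    have r4: "r > 4" using gt v0 by (simp add: r_def field_simps)
    obtain q where q: "4 < q" "q < r" using dense r4 by blast
    define s where "s = sqrt q"
    have "sqrt 4 < sqrt q" using q(1) by (subst real_sqrt_less_iff)
    then have s2: "s > 2" by (simp add: s_def)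
    have ss: "s\<^sup>2 = q" using q by (simp add: s_def)
    define B where "B = inverse (complex_of_real s) \<cdot>\<^sub>m A"
    have B: "B \<in> carrier_mat n n" using A by (simp add: B_def)
    have "spectral_radius B < 1"
    proof -
      obtain x where x: "eigenvalue B x" "spectral_radius B = cmod x"
        using spectral_radius_mem_max(1)[OF B n0] by (auto simp: spectrum_def)
      have "eigenvalue A (complex_of_real s * x)"
        using eigenvalue_scale[OF A _ x(1)[unfolded B_def]] s2 by simp
      then have "cmod (complex_of_real s * x) \<le> 2" by (rule ev)
      then have "s * cmod x \<le> 2" using s2 by (simp add: norm_mult)
      also have "\<dots> < s * 1" using s2 by simp
      finally show ?thesis using s2 x(2) by simp
    qed
    then obtain c where c: "\<And>k. norm_bound (B ^\<^sub>m k) c"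
      using spectral_radius_jnf_norm_bound_less_1_upper_triangular[OF B] by blast
    have aB: "a l j = of_real s * B $$ (l, j)" if "l < n" "j < n" for l j
      using A s2 that by (simp add: a_def entries_def flip: n_def) (simp add: B_def)
    have pow: "((ap ^^ k) v) i = of_real s ^ k * (\<Sum>j<n. (B ^\<^sub>m k) $$ (i, j) * v j)" if "i < n" for k i
      using that
    proof (induction k arbitrary: v)
      case 0
      have "(\<Sum>j<n. (1\<^sub>m n) $$ (i, j) * v j) = (\<Sum>j<n. if j = i then v i else 0)"
        using 0 by (intro sum.cong) auto
      then show ?case using 0 B by (simp add: carrier_matD)
    next
      case (Suc k)
      have Bk: "B ^\<^sub>m k \<in> carrier_mat n n" using B by simp
      have "(ap ^^ Suc k) v i = (ap ^^ k) (ap v) i" by (simp only: funpow_Suc_right o_def)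
      also have "\<dots> = of_real s ^ k * (\<Sum>l<n. (B ^\<^sub>m k) $$ (i, l) * ap v l)" by (rule Suc.IH[OF Suc.prems])
      also have "(\<Sum>l<n. (B ^\<^sub>m k) $$ (i, l) * ap v l)
        = (\<Sum>l<n. \<Sum>j<n. of_real s * ((B ^\<^sub>m k) $$ (i, l) * B $$ (l, j)) * v j)"
        unfolding ap_def sum_distrib_left by (intro sum.cong refl) (simp add: aB)
      also have "\<dots> = of_real s * (\<Sum>j<n. (\<Sum>l<n. (B ^\<^sub>m k) $$ (i, l) * B $$ (l, j)) * v j)"
        by (subst sum.swap) (simp add: sum_distrib_left sum_distrib_right mult_ac)
      also have "(\<Sum>j<n. (\<Sum>l<n. (B ^\<^sub>m k) $$ (i, l) * B $$ (l, j)) * v j) = (\<Sum>j<n. (B ^\<^sub>m Suc k) $$ (i, j) * v j)"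
        using B Bk Suc.prems
        by (intro sum.cong refl) (simp add: scalar_prod_def atLeast0LessThan)
      finally show ?case by (simp add: mult_ac)
    qed
    define M where "M = (\<Sum>j<n. \<bar>c\<bar> * cmod (v j))"
    have M: "cmod ((ap ^^ k) v i) \<le> s ^ k * M" if "i < n" for k i
    proof -
      have "cmod (\<Sum>j<n. (B ^\<^sub>m k) $$ (i, j) * v j) \<le> M"
        unfolding M_def
      proof (rule order_trans[OF norm_sum], rule sum_mono)
        fix j assume "j \<in> {..<n}"
        then have "cmod ((B ^\<^sub>m k) $$ (i, j)) \<le> c"
          using c[of k] B that by (auto simp: norm_bound_def carrier_matD)
        then show "cmod ((B ^\<^sub>m k) $$ (i, j) * v j) \<le> \<bar>c\<bar> * cmod (v j)"
          by (simp add: norm_mult mult_right_mono)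
      qed
      then show ?thesis using s2 pow[OF that, of k] by (simp add: norm_mult norm_power)
    qed
    have bnd: "(r / q) ^ k \<le> of_nat n * M\<^sup>2 / nsq v" for k
    proof -
      have "r ^ k * nsq v \<le> nsq ((ap ^^ k) v)"
        using v0 gt r4 by (intro nsq_funpow_ge) (auto simp: r_def)
      also have "\<dots> \<le> (\<Sum>i<n. (s ^ k * M)\<^sup>2)"
        unfolding nsq_def using M by (intro sum_mono power_mono) auto
      also have "\<dots> = q ^ k * (of_nat n * M\<^sup>2)"
        by (simp add: power_mult_distrib ss[symmetric] power_mult[symmetric] mult.commute)
      finally show ?thesis using v0 q by (simp add: field_simps)
    qed
    obtain k where "of_nat n * M\<^sup>2 / nsq v < (r / q) ^ k"
      using real_arch_pow[of "r / q"] q by auto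
    then show False using bnd[of k] by simp
  qed
  then show ?thesis by (simp only: n_def a_def)
qed

lemma cyclotomic_if_form_bounded:
  assumes H: "hermitian_form n a" and g: "\<And>i j. a i j \<in> gauss_ints"
    and bnd: "\<And>v. \<bar>Re (hermitian_form.ip n v (hermitian_form.ap n a v))\<bar> \<le> 2 * hermitian_form.nsq n v"
  shows "cyclotomic (mat n n (\<lambda>(i, j). a i j))"
proof -
  interpret hermitian_form n a by (rule H)
  let ?A = "mat n n (\<lambda>(i, j). a i j)"
  have A: "?A \<in> carrier_mat n n" by simp
  have "mat_adjoint ?A = ?A"
  proof (rule eq_matI)
    fix i j assume "i < dim_row ?A" "j < dim_col ?A"
    then show "mat_adjoint ?A $$ (i, j) = ?A $$ (i, j)"
      using herm[of i j] by (simp add: adjoint_index[OF A])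
  qed (use adjoint_carrier[OF A] in auto)
  moreover have "x \<in> complex_of_real ` {-2..2}" if ev: "eigenvalue ?A x" for x
  proof -
    obtain w where w: "w \<in> carrier_vec n" "w \<noteq> 0\<^sub>v n" "?A *\<^sub>v w = x \<cdot>\<^sub>v w"
      using ev unfolding eigenvalue_def eigenvector_def by fastforce
    define v where "v i = w $ i" for i
    have ap: "ap v i = x * v i" if "i < n" for i
    proof -
      have "(?A *\<^sub>v w) $ i = x * v i" using w(1) that by (simp add: w(3) v_def)
      then show ?thesis using w(1) that
        by (auto simp: ap_def v_def scalar_prod_def atLeast0LessThan carrier_vecD)
    qed
    have ipx: "ip v (ap v) = x * of_real (nsq v)"
      using ap by (simp add: ip_def nsq_def cmod_square sum_distrib_left mult_ac)
    have v0: "nsq v > 0"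
    proof (rule ccontr)
      assume "\<not> nsq v > 0"
      then have "nsq v = 0" using nsq_nonneg[of v] by simp
      then have "v i = 0" if "i < n" for i
        using that by (simp add: nsq_def sum_nonneg_eq_0_iff)
      then have "w = 0\<^sub>v n" using w(1) by (intro eq_vecI) (auto simp: v_def)
      then show False using w by simp
    qed
    have "cnj x * of_real (nsq v) = x * of_real (nsq v)"
      using ip_cnj[of v "ap v"] ip_ap[of v v] by (simp add: ipx)
    then have "cnj x = x" using v0 by simp
    then have im: "Im x = 0" by (simp add: complex_eq_iff)
    have "\<bar>Re x * nsq v\<bar> \<le> 2 * nsq v" using bnd[of v] by (simp add: ipx)
    then have "\<bar>Re x\<bar> \<le> 2" using v0 by (simp add: abs_mult)
    then show ?thesis using im by (auto simp: complex_eq_iff intro!: image_eqI[of _ _ "Re x"])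
  qed
  ultimately show ?thesis using g by (auto simp: cyclotomic_def gauss_mats_iff)
qed

section \<open>Extension by one vertex\<close>

locale contraction = hermitian_form +
  assumes contr: "nsq (ap v) \<le> 4 * nsq v"
begin

definition dp :: "(nat \<Rightarrow> complex) \<Rightarrow> nat \<Rightarrow> complex" where
  "dp v i = 4 * v i - ap (ap v) i"

lemma form_bounded: "\<bar>Re (ip v (ap v))\<bar> \<le> 2 * nsq v"
proof -
  have "(cmod (ip v (ap v)))\<^sup>2 \<le> nsq v * nsq (ap v)" by (rule cauchy_schwarz)
  also have "\<dots> \<le> nsq v * (4 * nsq v)" by (intro mult_left_mono contr nsq_nonneg)
  also have "\<dots> = (2 * nsq v)\<^sup>2" by (simp add: power2_eq_square)
  finally have "cmod (ip v (ap v)) \<le> 2 * nsq v"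
    by (rule power2_le_imp_le) (simp add: nsq_nonneg)
  then show ?thesis using abs_Re_le_cmod order_trans by blast
qed

lemma dp_psd: "Re (ip v (dp v)) \<ge> 0"
proof -
  have "ip v (dp v) = 4 * ip v v - ip (ap v) (ap v)"
    unfolding dp_def by (simp add: ip_lin ip_ap)
  then show ?thesis using contr[of v] by (simp add: ip_self)
qed

lemma extension_bound:
  fixes t :: complex
  assumes x: "\<And>i. i < n \<Longrightarrow> x i = dp y i"
    and c: "\<bar>c + Re (ip (ap y) (dp y))\<bar> \<le> 2 * (1 - Re (ip y (dp y)))"
  shows "\<bar>Re (ip z (ap z)) + 2 * Re (t * ip z x) + c * (cmod t)\<^sup>2\<bar> \<le> 2 * (nsq z + (cmod t)\<^sup>2)"
proof -
  have ipx: "ip u x = ip u (dp y)" for u using x by (simp add: ip_def)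
  have key: "0 \<le> 2 * nsq z - e * Re (ip z (ap z)) - e * 2 * Re (t * ip z x)
      + (cmod t)\<^sup>2 * (2 * Re (ip y (dp y)) + e * Re (ip (ap y) (dp y)))" if e: "e = 1 \<or> e = -1" for e :: real
  proof -
    define f where "f = complex_of_real e"
    have f: "f * f = 1" "cnj f = f" "f = 1 \<or> f = -1" using e by (auto simp: f_def)
    define w where "w i = 2 * y i + f * ap y i" for i
    define s where "s i = z i - f * t * w i" for i
    have apw: "2 * w i - f * ap w i = dp y i" for i
    proof -
      have "ap w = (\<lambda>i. 2 * ap y i + f * ap (ap y) i)"
        unfolding w_def[abs_def] by (simp add: ap_lin)
      then have "2 * w i - f * ap w i = 4 * y i - f * f * ap (ap y) i"
        by (simp add: w_def algebra_simps)
      then show ?thesis by (simp add: f(1) dp_def)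
    qed
    have "2 * s i - f * ap s i = (2 * z i - f * ap z i) - f * t * dp y i" for i
    proof -
      have "ap s = (\<lambda>i. ap z i - f * t * ap w i)"
        unfolding s_def[abs_def] by (simp add: ap_lin)
      then show ?thesis by (simp add: s_def apw[symmetric] algebra_simps)
    qed
    then have "ip s (\<lambda>i. 2 * s i - f * ap s i) = ip s (\<lambda>i. (2 * z i - f * ap z i) - f * t * dp y i)"
      by simp
    also have "\<dots> = 2 * ip s z - f * ip s (ap z) - f * t * ip s (dp y)"
      by (simp add: ip_lin)
    also have "\<dots> = 2 * ip z z - f * ip z (ap z) - f * cnj t * (2 * ip w z - f * ip w (ap z))
       - f * t * ip z (dp y) + cnj t * t * ip w (dp y)"
    proof -
      have s: "ip s g = ip z g - f * cnj t * ip w g" for g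
        unfolding s_def[abs_def] by (simp add: ip_lin f(2))
      have "2 * (p - f * T * p') - f * (q - f * T * q') - f * t * (r - f * T * r')
        = 2 * p - f * q - f * T * (2 * p' - f * q') - f * t * r + T * t * r'" for p p' q q' r r' T :: complex
        using f(3) by (elim disjE) (simp_all add: algebra_simps)
      then show ?thesis unfolding s .
    qed
    also have "2 * ip w z - f * ip w (ap z) = ip (\<lambda>i. 2 * w i - f * ap w i) z"
      using f by (simp add: ip_lin ip_ap)
    also have "\<dots> = cnj (ip z (dp y))" by (simp only: apw ip_cnj)
    also have "ip w (dp y) = 2 * ip y (dp y) + f * ip (ap y) (dp y)"
      unfolding w_def using f by (simp add: ip_lin)
    finally have E: "ip s (\<lambda>i. 2 * s i - f * ap s i) = 2 * ip z z - f * ip z (ap z)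
      - f * cnj t * cnj (ip z (dp y)) - f * t * ip z (dp y)
      + cnj t * t * (2 * ip y (dp y) + f * ip (ap y) (dp y))" .
    have ctt: "cnj t * t = of_real ((cmod t)\<^sup>2)" by (metis complex_norm_square mult.commute)
    have "Re (ip s (\<lambda>i. 2 * s i - f * ap s i)) = 2 * nsq z - e * Re (ip z (ap z)) - e * 2 * Re (t * ip z x)
      + (cmod t)\<^sup>2 * (2 * Re (ip y (dp y)) + e * Re (ip (ap y) (dp y)))"
      unfolding E ctt ipx using e by (elim disjE) (simp_all add: f_def ip_self algebra_simps)
    moreover have "Re (ip s (\<lambda>i. 2 * s i - f * ap s i)) \<ge> 0"
    proof -
      have "ip s (\<lambda>i. 2 * s i - f * ap s i) = of_real (2 * nsq s) - of_real e * ip s (ap s)"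
        by (simp add: ip_lin ip_self f_def)
      then have "Re (ip s (\<lambda>i. 2 * s i - f * ap s i)) = 2 * nsq s - e * Re (ip s (ap s))" by simp
      then show ?thesis using form_bounded[of s] e by auto
    qed
    ultimately show ?thesis by simp
  qed
  define T where "T = (cmod t)\<^sup>2"
  have T: "T \<ge> 0" by (simp add: T_def)
  have 1: "T * (2 * Re (ip y (dp y)) + Re (ip (ap y) (dp y))) \<le> T * (2 - c)"
    using c T by (intro mult_left_mono) auto
  have 2: "T * (2 * Re (ip y (dp y)) - Re (ip (ap y) (dp y))) \<le> T * (2 + c)"
    using c T by (intro mult_left_mono) auto
  show ?thesis using key[of 1] key[of "-1"] 1 2
    by (simp add: T_def[symmetric] algebra_simps abs_le_iff)
qed

end

section \<open>Maximal graphs\<close>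

definition delta :: "nat \<Rightarrow> nat \<Rightarrow> complex" where "delta i j = (if j = i then 1 else 0)"

locale gauss_form = hermitian_form +
  assumes gauss: "a i j \<in> gauss_ints"
begin

definition deg :: "nat \<Rightarrow> nat" where "deg i = (\<Sum>k<n. gnorm (a i k))"

definition sq :: "nat \<Rightarrow> nat \<Rightarrow> complex" where "sq i j = (\<Sum>k<n. a i k * a k j)"

lemma gnorm_sym: "gnorm (a j i) = gnorm (a i j)"
  using herm[of i j] by simp

lemma nonzero_sym: "a j i = 0 \<longleftrightarrow> a i j = 0"
  using herm[of i j] by simp

lemma nonzero_less: "a i j \<noteq> 0 \<Longrightarrow> i < n \<and> j < n"
  using outside by blast

lemma sq_self: "sq i i = of_nat (deg i)"
  unfolding sq_def deg_def of_nat_sum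
  by (intro sum.cong refl) (metis complex_of_nat_gnorm gauss herm)

lemma sq_sym: "sq j i = cnj (sq i j)"
  unfolding sq_def cnj_sum complex_cnj_mult
  by (intro sum.cong refl) (metis herm mult.commute)

lemma sq_gauss [simp, intro]: "sq i j \<in> gauss_ints"
  unfolding sq_def by (intro gauss_ints_sum gauss_ints_closed gauss)

lemma sq_supp:
  assumes "finite S" "\<And>k. k \<notin> S \<Longrightarrow> a i k * a k j = 0"
  shows "sq i j = (\<Sum>k\<in>S. a i k * a k j)"
  unfolding sq_def
proof (rule sum.mono_neutral_cong)
  show "a i k * a k j = 0" if "k \<in> S - {..<n}" for k using that outside[of i k] by auto
qed (use assms in auto)

lemma deg_ge:
  assumes "finite S"
  shows "(\<Sum>k\<in>S. gnorm (a i k)) \<le> deg i"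
proof -
  have "(\<Sum>k\<in>S. gnorm (a i k)) = (\<Sum>k\<in>S \<inter> {..<n}. gnorm (a i k))"
    by (rule sum.mono_neutral_right) (use assms outside in auto)
  also have "\<dots> \<le> deg i" unfolding deg_def by (rule sum_mono2) auto
  finally show ?thesis .
qed

lemma row_supp:
  assumes "finite S" "(\<Sum>k\<in>S. gnorm (a i k)) \<ge> deg i" "k \<notin> S"
  shows "a i k = 0"
proof -
  have "(\<Sum>k\<in>insert k S. gnorm (a i k)) \<le> deg i" using assms(1) by (intro deg_ge) simp
  then have "gnorm (a i k) = 0" using assms by simp
  then show ?thesis using gauss[of i k] by simp
qed

lemma ip_delta: "i < n \<Longrightarrow> ip (delta i) v = v i"
  by (simp add: ip_def delta_def if_distrib[of cnj] if_distrib[of "\<lambda>x. x * _"] cong: if_cong)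

lemma ap_delta: "i < n \<Longrightarrow> ap (delta i) = (\<lambda>j. a j i)"
  by (simp add: fun_eq_iff ap_def delta_def if_distrib[of "\<lambda>x. _ * x"] cong: if_cong)

lemma ap_ap_delta: "i < n \<Longrightarrow> ap (ap (delta i)) = (\<lambda>j. sq j i)"
  by (simp add: ap_delta) (simp add: fun_eq_iff ap_def sq_def)

end

locale cyclotomic_graph = contraction + gauss_form +
  assumes n_pos: "n > 0"
    and conn: "S \<subseteq> {..<n} \<Longrightarrow> S \<noteq> {} \<Longrightarrow> (\<And>i j. i \<in> S \<Longrightarrow> a i j \<noteq> 0 \<Longrightarrow> j \<in> S) \<Longrightarrow> S = {..<n}"
begin

lemma dp_lin:
  "dp (\<lambda>i. u i + v i) = (\<lambda>i. dp u i + dp v i)"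
  "dp (\<lambda>i. u i - v i) = (\<lambda>i. dp u i - dp v i)"
  "dp (\<lambda>i. c * u i) = (\<lambda>i. c * dp u i)"
  by (simp_all add: fun_eq_iff dp_def ap_lin algebra_simps)

lemma dp_delta: "i < n \<Longrightarrow> dp (delta i) = (\<lambda>j. (if j = i then 4 else 0) - sq j i)"
  by (auto simp: fun_eq_iff dp_def ap_ap_delta) (simp_all add: delta_def)

lemma deg_le: "i < n \<Longrightarrow> deg i \<le> 4"
  using dp_psd[of "delta i"] by (simp add: ip_delta dp_delta sq_self)

lemma full_row:
  assumes i: "deg i = 4" "i \<noteq> j"
  shows "sq i j = 0"
proof (cases "i < n \<and> j < n")
  case True
  have psd: "0 \<le> Re (ip v (dp v))" for v by (rule dp_psd)
  have "ip (\<lambda>m. s * delta i m + delta j m) (dp (\<lambda>m. s * delta i m + delta j m))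
     = - (cnj s * sq i j) - s * sq j i + of_nat (4 - deg j)" for s
    using True i deg_le[of j] by (simp add: dp_lin ip_lin ip_delta dp_delta sq_self of_nat_diff)
  then have ge: "0 \<le> Re (- (cnj s * sq i j) - s * sq j i + of_nat (4 - deg j))" for s
    using psd by metis
  have "Re (cnj s * cnj z) = Re (s * z)" for s z by simp
  have 1: "Re (- (cnj s * sq i j) - s * sq j i + of_nat (4 - deg j)) = real (4 - deg j) - 2 * Re (cnj s * sq i j)" for s
    unfolding sq_sym[of j i] by simp
  have "0 \<le> real (4 - deg j) - 2 * Re (cnj (3 * sq i j) * sq i j)" using ge[of "3 * sq i j"] unfolding 1 .
  also have "\<dots> = real (4 - deg j) - 6 * (cmod (sq i j))\<^sup>2"
    unfolding cmod_power2 by (simp add: power2_eq_square)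
  finally have "6 * (cmod (sq i j))\<^sup>2 \<le> 4" by linarith
  then have "gnorm (sq i j) = 0"
    using of_nat_gnorm[OF sq_gauss[of i j]] by linarith
  then show ?thesis by simp
next
  case False
  then have "a i k * a k j = 0" for k using outside by auto
  then show ?thesis by (simp add: sq_def)
qed

end

locale maximal_graph = cyclotomic_graph +
  assumes maximal: "(\<And>i. x i \<in> gauss_ints) \<Longrightarrow> \<exists>i<n. x i \<noteq> 0 \<Longrightarrow>
    \<not> (\<forall>z t. \<bar>Re (ip z (ap z)) + 2 * Re (t * ip z x) + real_of_int c * (cmod t)\<^sup>2\<bar> \<le> 2 * (nsq z + (cmod t)\<^sup>2))"
begin

lemma no_extension:
  assumes "\<And>i. i < n \<Longrightarrow> dp y i \<in> gauss_ints" "\<exists>i<n. dp y i \<noteq> 0"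
    "\<bar>real_of_int c + Re (ip (ap y) (dp y))\<bar> \<le> 2 * (1 - Re (ip y (dp y)))"
  shows False
proof -
  define x where "x i = (if i < n then dp y i else 0)" for i
  have "\<bar>Re (ip z (ap z)) + 2 * Re (t * ip z x) + of_int c * (cmod t)\<^sup>2\<bar> \<le> 2 * (nsq z + (cmod t)\<^sup>2)" for z t
    by (rule extension_bound[OF _ assms(3)]) (simp add: x_def)
  moreover have "x i \<in> gauss_ints" for i using assms(1) by (simp add: x_def)
  moreover have "\<exists>i<n. x i \<noteq> 0" using assms(2) by (auto simp: x_def)
  ultimately show False using maximal by blast
qed

lemma deg_neq_3:
  assumes i: "i < n"
  shows "deg i \<noteq> 3"
proof
  assume d: "deg i = 3"
  let ?r = "ip (ap (delta i)) (dp (delta i))"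
  have g: "dp (delta i) j \<in> gauss_ints" for j using i by (auto simp: dp_delta)
  have "?r \<in> gauss_ints" unfolding ip_def
    by (intro gauss_ints_sum gauss_ints_closed g) (simp add: ap_delta i gauss)
  then obtain m where m: "Re ?r = of_int m" by (auto simp: gauss_ints_iff elim: Ints_cases)
  show False
  proof (rule no_extension[of "delta i" "- m"])
    show "\<exists>j<n. dp (delta i) j \<noteq> 0" using i d by (intro exI[of _ i]) (simp add: dp_delta sq_self)
    show "\<bar>of_int (- m) + Re ?r\<bar> \<le> 2 * (1 - Re (ip (delta i) (dp (delta i))))"
      using i d m by (simp add: ip_delta dp_delta sq_self)
  qed (rule g)
qed

lemma no_twin:
  assumes i: "i < n" "deg i = 2" and tw: "\<And>j. j < n \<Longrightarrow> j \<noteq> i \<Longrightarrow> \<exists>g\<in>gauss_ints. sq j i = 2 * g"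
  shows False
proof -
  let ?d = "dp (delta i)"
  have half: "\<exists>g\<in>gauss_ints. ?d j = 2 * g" if j: "j < n" for j
  proof (cases "j = i")
    case True
    show ?thesis
    proof (rule bexI)
      show "?d j = 2 * 1" by (simp add: dp_delta[OF i(1)] sq_self i(2) True)
    qed simp
  next
    case False
    then obtain g where g: "g \<in> gauss_ints" "sq j i = 2 * g" using tw[OF j] by blast
    show ?thesis
    proof (rule bexI)
      show "?d j = 2 * (- g)" by (simp add: dp_delta[OF i(1)] False g)
    qed (simp add: g)
  qed
  define h where "h j = ?d j / 2" for j
  have h: "\<And>j. j < n \<Longrightarrow> h j \<in> gauss_ints" "\<And>j. ?d j = 2 * h j"
    using half by (force simp: h_def)+
  define s where "s = (1 - \<i>) / 2"
  define y where "y j = s * delta i j" for j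
  have ss: "cnj s * s = 1 / 2" by (simp add: s_def complex_eq_iff)
  have dpy: "dp y j = (1 - \<i>) * h j" if "j < n" for j
    using h(2) unfolding y_def by (simp add: dp_lin) (simp add: s_def)
  define r where "r = (\<Sum>j<n. cnj (a j i) * h j)"
  have ipr: "ip (ap (delta i)) ?d = 2 * r"
    unfolding r_def sum_distrib_left ip_def using i h(2) by (intro sum.cong) (auto simp: ap_delta)
  have "r \<in> gauss_ints" unfolding r_def by (intro gauss_ints_sum gauss_ints_closed gauss h(1)) simp
  then obtain m where m: "Re r = of_int m" by (auto simp: gauss_ints_iff elim: Ints_cases)
  have "ip (ap y) (dp y) = cnj s * s * (2 * r)"
    unfolding y_def by (simp add: dp_lin ap_lin ip_lin ipr)
  then have 1: "ip (ap y) (dp y) = r" by (simp only: ss) simp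
  have "ip y (dp y) = cnj s * s * ?d i"
    unfolding y_def using i by (simp add: dp_lin ip_lin ip_delta)
  then have 2: "ip y (dp y) = 1" unfolding ss using i by (simp add: dp_delta sq_self)
  show False
  proof (rule no_extension[of y "- m"])
    show "dp y j \<in> gauss_ints" if "j < n" for j
      unfolding dpy[OF that] using h(1)[OF that] by auto
    have "h i = 1" using h(2)[of i] i by (simp add: dp_delta sq_self)
    then show "\<exists>j<n. dp y j \<noteq> 0" using i dpy by (intro exI[of _ i]) (simp add: complex_eq_iff)
    show "\<bar>of_int (- m) + Re (ip (ap y) (dp y))\<bar> \<le> 2 * (1 - Re (ip y (dp y)))"
      by (simp add: 1 2 m)
  qed
qed

lemma no_fork:
  assumes less: "k < n" "i < n" "j < n" and ne: "i \<noteq> j" "i \<noteq> k" "j \<noteq> k"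
    and d: "deg i = 2" "deg j = 2" and u: "gnorm (a i k) = 1" "gnorm (a j k) = 1" "a i j = 0"
    and si: "\<And>m. m \<noteq> i \<Longrightarrow> m \<noteq> k \<Longrightarrow> sq m i = a m k * a k i" "sq k i = 0"
    and sj: "\<And>m. m \<noteq> j \<Longrightarrow> m \<noteq> k \<Longrightarrow> sq m j = a m k * a k j" "sq k j = 0"
    and bnd: "\<bar>Re (a i i + a j j)\<bar> \<le> 2"
  shows False
proof -
  define x where "x m = a i k * delta i m - a j k * delta j m" for m
  have ui: "a i k * a k i = 1" "a k i * a i k = 1"
    using u(1) herm[of i k] gnorm_eq_1[OF gauss[of i k]] by (auto simp: mult.commute)
  have uj: "a j k * a k j = 1" "a k j * a j k = 1"
    using u(2) herm[of j k] gnorm_eq_1[OF gauss[of j k]] by (auto simp: mult.commute)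
  have ji: "a j i = 0" using u(3) herm[of i j] by simp
  have dpx: "dp x m = 3 * x m" for m
  proof -
    have "dp x m = a i k * ((if m = i then 4 else 0) - sq m i) - a j k * ((if m = j then 4 else 0) - sq m j)"
      unfolding x_def using less by (simp add: dp_lin dp_delta)
    moreover consider "m = i" | "m = j" | "m = k" | "m \<noteq> i" "m \<noteq> j" "m \<noteq> k" by blast
    then have "a i k * ((if m = i then 4 else 0) - sq m i) - a j k * ((if m = j then 4 else 0) - sq m j) = 3 * x m"
    proof cases
      case 1
      have "a j k * (a i k * a k j) = a i k" using uj by (simp add: mult_ac)
      then show ?thesis using 1 ne d by (simp add: x_def delta_def sq_self sj)
    next
      case 2
      have "a i k * (a j k * a k i) = a j k" using ui by (simp add: mult_ac)
      then show ?thesis using 2 ne d by (simp add: x_def delta_def sq_self si)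
    next
      case 3
      then show ?thesis using ne si sj by (simp add: x_def delta_def)
    next
      case 4
      show ?thesis using 4 ui uj
        by (simp only: si(1)[OF 4(1,3)] sj(1)[OF 4(2,3)]) (simp add: x_def delta_def)
    qed
    ultimately show ?thesis by simp
  qed
  define y where "y m = (1 / 3) * x m" for m
  have "dp y = (\<lambda>m. (1 / 3) * dp x m)" unfolding y_def[abs_def] by (rule dp_lin)
  then have dpy: "dp y = x" by (simp add: dpx fun_eq_iff)
  have ci: "cnj (a i k) = a k i" "cnj (a j k) = a k j" by (simp_all flip: herm)
  have "ip x v = a k i * v i - a k j * v j" for v
    unfolding x_def using less by (simp add: ip_lin ip_delta ci)
  note ipx = this
  have 1: "ip y (dp y) = 2 / 3"
    unfolding dpy unfolding y_def ip_lin ipx using ne ui uj by (simp add: x_def delta_def)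
  have apx: "ap x m = a i k * a m i - a j k * a m j" for m
    unfolding x_def using less by (simp add: ap_lin ap_delta)
  have "ip x (ap x) = a k i * (a i k * a i i) + a k j * (a j k * a j j)"
    unfolding ipx apx using u(3) ji by simp
  also have "\<dots> = a i i + a j j" using ui uj by (simp add: mult.assoc[symmetric])
  finally have "ip (ap x) x = a i i + a j j" by (simp add: ip_ap)
  then have 2: "ip (ap y) (dp y) = (a i i + a j j) / 3"
    unfolding dpy unfolding y_def ap_lin ip_lin by simp
  show False
  proof (rule no_extension[of y 0])
    show "dp y m \<in> gauss_ints" for m
      unfolding dpy x_def delta_def by (auto simp: gauss)
    have "x i \<noteq> 0" using ne ui by (auto simp: x_def delta_def)
    then show "\<exists>m<n. dp y m \<noteq> 0" using less dpy by auto
    show "\<bar>of_int 0 + Re (ip (ap y) (dp y))\<bar> \<le> 2 * (1 - Re (ip y (dp y)))"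
      using bnd unfolding 1 2 by simp
  qed
qed

end

section \<open>All rows of a charged maximal graph have norm four\<close>

context gauss_form
begin

lemma unit_prod: "gnorm (a i j) = 1 \<Longrightarrow> a i j * a j i = 1"
  using gnorm_eq_1[OF gauss[of i j]] herm[of i j] by simp

lemma gnorm_pos: "a i j \<noteq> 0 \<Longrightarrow> gnorm (a i j) \<ge> 1"
  using gnorm_eq_0[OF gauss[of i j]] by linarith

lemma gnorm_0_iff: "gnorm (a i j) = 0 \<longleftrightarrow> a i j = 0"
  using gnorm_eq_0[OF gauss[of i j]] .

lemma gnorm_not_3: "gnorm (a i j) \<noteq> 3"
  using gnorm_cases[OF gauss[of i j]] by linarith

lemma diag_real: "Im (a i i) = 0"
  using herm[of i i] by (simp add: complex_eq_iff)

lemma diag_cases: "a i i = 0 \<or> a i i = 1 \<or> a i i = -1 \<or> gnorm (a i i) \<ge> 4"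
  using gnorm_cases[OF gauss[of i i]] diag_real[of i] by auto

lemma pick_nbr:
  assumes "finite S" "(\<Sum>k\<in>S. gnorm (a i k)) < deg i"
  obtains m where "m \<notin> S" "a i m \<noteq> 0" "m < n"
proof -
  have "\<exists>m. m \<notin> S \<and> a i m \<noteq> 0"
  proof (rule ccontr)
    assume "\<not> ?thesis"
    then have "deg i = (\<Sum>k\<in>S. gnorm (a i k))"
      unfolding deg_def using assms(1) outside
      by (intro sum.mono_neutral_cong) (auto simp: gnorm_0_iff)
    then show False using assms(2) by simp
  qed
  then show thesis using that nonzero_less by blast
qed

lemma sq_col1:
  assumes "\<And>m. m \<noteq> p \<Longrightarrow> a i m = 0"
  shows "sq j i = a j p * a p i"
  using sq_supp[of "{p}" j i] assms nonzero_sym by auto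

lemma sq_col2:
  assumes "\<And>m. m \<noteq> p \<Longrightarrow> m \<noteq> q \<Longrightarrow> a i m = 0" "p \<noteq> q"
  shows "sq j i = a j p * a p i + a j q * a q i"
  using sq_supp[of "{p, q}" j i] assms nonzero_sym by auto

lemma sq_row4:
  assumes "\<And>m. m \<notin> {p, q, r, s} \<Longrightarrow> a i m = 0" "distinct [p, q, r, s]"
  shows "sq i j = a i p * a p j + a i q * a q j + a i r * a r j + a i s * a s j"
  using sq_supp[of "{p, q, r, s}" i j] assms by auto

lemma sq_row3:
  assumes "\<And>m. m \<notin> {p, q, r} \<Longrightarrow> a i m = 0" "distinct [p, q, r]"
  shows "sq i j = a i p * a p j + a i q * a q j + a i r * a r j"
  using sq_supp[of "{p, q, r}" i j] assms by auto

lemma low_cases [consumes 3, case_names leaf charged path]: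
  assumes low: "deg i \<le> 2" and k: "a i k \<noteq> 0" "i \<noteq> k"
  obtains "\<And>m. m \<noteq> k \<Longrightarrow> a i m = 0"
  | "gnorm (a i k) = 1" "gnorm (a i i) = 1" "deg i = 2" "\<And>m. m \<noteq> k \<Longrightarrow> m \<noteq> i \<Longrightarrow> a i m = 0"
  | l where "l \<noteq> k" "l \<noteq> i" "gnorm (a i k) = 1" "gnorm (a i l) = 1" "deg i = 2"
      "\<And>m. m \<noteq> k \<Longrightarrow> m \<noteq> l \<Longrightarrow> a i m = 0"
proof (cases "\<exists>m. m \<noteq> k \<and> a i m \<noteq> 0")
  case True
  then obtain m where m: "m \<noteq> k" "a i m \<noteq> 0" by blast
  have "gnorm (a i k) + gnorm (a i m) \<le> deg i" using deg_ge[of "{k, m}" i] m by simp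
  then have d: "gnorm (a i k) = 1" "gnorm (a i m) = 1" "deg i = 2"
    using low gnorm_pos[OF k(1)] gnorm_pos[OF m(2)] by auto
  have supp: "a i j = 0" if "j \<noteq> k" "j \<noteq> m" for j
    using row_supp[of "{k, m}" i j] m that d by simp
  show thesis using that(2,3) d supp m by (cases "m = i") auto
qed (use that(1) in blast)

end

context maximal_graph
begin

lemma degs: "i < n \<Longrightarrow> deg i \<le> 2 \<or> deg i = 4"
  using deg_le[of i] deg_neq_3[of i] by linarith

text \<open>
  The new vertex \<open>b\<close> is a copy of the charged vertex \<open>s\<close> with the sign of its edge to \<open>t\<close>
  reversed. After rotating \<open>s\<close> and \<open>b\<close> to \<open>s + b\<close> and \<open>s - b\<close>, diagonal dominance suffices.
\<close>

lemma no_charged_path_aux: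
  assumes low: "\<And>i. i < n \<Longrightarrow> deg i \<le> 2"
    and st: "s < n" "t < n" "s \<noteq> t" "gnorm (a s t) = 1" "\<And>m. m \<noteq> s \<Longrightarrow> m \<noteq> t \<Longrightarrow> a s m = 0"
    and e: "a s s = of_int e" "\<bar>e\<bar> = 1"
  shows False
proof -
  define x where "x m = of_int e * delta s m - a t s * delta t m" for m
  define b where "b i j = (if i = s \<or> j = s then 0 else a i j)" for i j
  define r where "r i = (\<Sum>j<n. cmod (b i j))" for i
  have cle: "cmod (a i j) \<le> gnorm (a i j)" for i j
  proof (cases "a i j = 0")
    case False
    then have "real (gnorm (a i j)) \<ge> 1" using gnorm_pos by fastforce
    then have "1 \<le> (cmod (a i j))\<^sup>2" using of_nat_gnorm[OF gauss[of i j]] by simp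
    then have "1 \<le> cmod (a i j)" by (simp add: power2_nonneg_ge_1_iff)
    then have "cmod (a i j) * 1 \<le> cmod (a i j) * cmod (a i j)" by (intro mult_left_mono) auto
    then show ?thesis using of_nat_gnorm[OF gauss[of i j]] by (simp add: power2_eq_square)
  qed simp
  have r2: "r i \<le> 2" if "i < n" for i
  proof -
    have "r i \<le> (\<Sum>j<n. real (gnorm (a i j)))"
      unfolding r_def by (intro sum_mono) (simp add: b_def cle)
    also have "\<dots> = real (deg i)" by (simp add: deg_def)
    finally show ?thesis using low[OF that] by simp
  qed
  have rt: "r t \<le> 1"
  proof -
    have "r t + 1 \<le> (\<Sum>j<n. cmod (b t j)) + (\<Sum>j<n. if j = s then 1 else 0)"
      using st by (simp add: r_def)
    also have "\<dots> = (\<Sum>j<n. cmod (b t j) + (if j = s then 1 else 0))" by (simp add: sum.distrib)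
    also have "\<dots> \<le> (\<Sum>j<n. real (gnorm (a t j)))"
      using st(4) gnorm_sym[of t s] by (intro sum_mono) (auto simp: b_def cle)
    also have "\<dots> = real (deg t)" by (simp add: deg_def)
    finally show ?thesis using low[OF st(2)] by simp
  qed
  have rs: "r s = 0" by (simp add: r_def b_def)
  have "\<bar>Re (ip z (ap z)) + 2 * Re (\<beta> * ip z x) + of_int e * (cmod \<beta>)\<^sup>2\<bar> \<le> 2 * (nsq z + (cmod \<beta>)\<^sup>2)" for z \<beta>
  proof -
    define bz where "bz i = (\<Sum>j<n. b i j * z j)" for i
    define u where "u = cnj (z t) * a t s"
    have uz: "cmod u = cmod (z t)"
      using of_nat_gnorm[OF gauss[of s t]] st(4) gnorm_sym[of s t] of_nat_gnorm[OF gauss[of t s]]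
      by (simp add: u_def norm_mult power2_eq_1_iff) (smt (verit) norm_ge_zero)
    have apz: "ap z i = bz i + ((a s s * z s + a s t * z t) * delta s i + (a t s * z s) * delta t i)" if i: "i < n" for i
    proof (cases "i = s")
      case True
      have "ap z s = (\<Sum>j\<in>{s, t}. a s j * z j)"
        unfolding ap_def by (rule sum.mono_neutral_right) (use st in auto)
      then show ?thesis using True st by (simp add: bz_def b_def delta_def)
    next
      case False
      have "ap z i = (\<Sum>j<n. b i j * z j + (if j = s then a i s * z s else 0))"
        unfolding ap_def by (intro sum.cong) (auto simp: b_def False)
      also have "\<dots> = bz i + a i s * z s" using st by (simp add: bz_def sum.distrib)
      finally show ?thesis using st(5)[of i] False nonzero_sym[of i s] by (auto simp: delta_def)
    qed
    have "ip z (ap z) = ip z (\<lambda>i. bz i + ((a s s * z s + a s t * z t) * delta s i + (a t s * z s) * delta t i))"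
      unfolding ip_def by (intro sum.cong refl) (simp add: apz)
    moreover have cd: "ip z (delta j) = cnj (z j)" if "j < n" for j
      using ip_delta[OF that, of z] ip_cnj[of "delta j" z] by simp
    ultimately have "ip z (ap z) = ip z bz + (a s s * z s + a s t * z t) * cnj (z s) + (a t s * z s) * cnj (z t)"
      using st by (simp add: ip_lin)
    then have "ip z (ap z) = ip z bz + of_int e * (z s * cnj (z s)) + (u * z s + cnj (u * z s))"
      by (simp add: u_def e herm[of t s] algebra_simps)
    then have ipz: "Re (ip z (ap z)) = Re (ip z bz) + of_int e * (cmod (z s))\<^sup>2 + 2 * Re (u * z s)"
      by (simp only: complex_norm_square[symmetric]) simp
    have ipx: "ip z x = of_int e * cnj (z s) - u"
      unfolding x_def using st cd by (simp add: ip_lin) (simp add: u_def mult.commute)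
    have sum: "Re (ip z (ap z)) + 2 * Re (\<beta> * ip z x) + of_int e * (cmod \<beta>)\<^sup>2
      = Re (ip z bz) + of_int e * (cmod (z s + \<beta>))\<^sup>2 + 2 * Re (u * (z s - \<beta>))"
      unfolding ipz ipx cmod_power2 by (simp add: algebra_simps power2_eq_square)
    have par: "2 * (cmod (z s))\<^sup>2 + 2 * (cmod \<beta>)\<^sup>2 = (cmod (z s + \<beta>))\<^sup>2 + (cmod (z s - \<beta>))\<^sup>2"
      unfolding cmod_power2 by (simp add: algebra_simps power2_eq_square)
    have "\<bar>Re (u * (z s - \<beta>))\<bar> \<le> cmod u * cmod (z s - \<beta>)"
      by (metis abs_Re_le_cmod norm_mult)
    moreover have "2 * (p * q) \<le> p\<^sup>2 + q\<^sup>2" for p q :: real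
      using sum_squares_bound[of p q] by simp
    ultimately have cross: "2 * \<bar>Re (u * (z s - \<beta>))\<bar> \<le> (cmod (z t))\<^sup>2 + (cmod (z s - \<beta>))\<^sup>2"
      unfolding uz by (smt (verit, best))
    have bsym: "cmod (b j i) = cmod (b i j)" for i j
      using herm[of i j] by (simp add: b_def)
    have "cmod (ip z bz) \<le> (\<Sum>i<n. \<Sum>j<n. cmod (b i j) * (cmod (z i) * cmod (z j)))"
      unfolding ip_def bz_def sum_distrib_left
      by (intro order_trans[OF norm_sum] sum_mono) (simp add: norm_mult mult_ac)
    also have "\<dots> \<le> (\<Sum>i<n. \<Sum>j<n. cmod (b i j) * (((cmod (z i))\<^sup>2 + (cmod (z j))\<^sup>2) / 2))"
    proof (intro sum_mono mult_left_mono)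
      show "cmod (z i) * cmod (z j) \<le> ((cmod (z i))\<^sup>2 + (cmod (z j))\<^sup>2) / 2" for i j
        using sum_squares_bound[of "cmod (z i)" "cmod (z j)"] by simp
    qed auto
    also have "\<dots> = (\<Sum>i<n. \<Sum>j<n. cmod (b i j) * (cmod (z i))\<^sup>2 / 2) + (\<Sum>i<n. \<Sum>j<n. cmod (b i j) * (cmod (z j))\<^sup>2 / 2)"
      by (simp add: sum.distrib[symmetric] field_simps)
    also have "(\<Sum>i<n. \<Sum>j<n. cmod (b i j) * (cmod (z j))\<^sup>2 / 2) = (\<Sum>i<n. \<Sum>j<n. cmod (b i j) * (cmod (z i))\<^sup>2 / 2)"
      by (subst sum.swap) (simp add: bsym)
    also have "(\<Sum>i<n. \<Sum>j<n. cmod (b i j) * (cmod (z i))\<^sup>2 / 2) + (\<Sum>i<n. \<Sum>j<n. cmod (b i j) * (cmod (z i))\<^sup>2 / 2)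
       = (\<Sum>i<n. r i * (cmod (z i))\<^sup>2)"
      by (simp add: r_def sum_distrib_right sum.distrib[symmetric])
    also have "\<dots> \<le> (\<Sum>i<n. 2 * (cmod (z i))\<^sup>2 - (if i = s then 2 * (cmod (z s))\<^sup>2 else 0) - (if i = t then (cmod (z t))\<^sup>2 else 0))"
    proof (intro sum_mono)
      fix i assume "i \<in> {..<n}"
      then have "r i * (cmod (z i))\<^sup>2 \<le> 2 * (cmod (z i))\<^sup>2" using r2 by (intro mult_right_mono) auto
      moreover have "r t * (cmod (z t))\<^sup>2 \<le> 1 * (cmod (z t))\<^sup>2" using rt by (intro mult_right_mono) auto
      ultimately show "r i * (cmod (z i))\<^sup>2 \<le> 2 * (cmod (z i))\<^sup>2 - (if i = s then 2 * (cmod (z s))\<^sup>2 else 0) - (if i = t then (cmod (z t))\<^sup>2 else 0)"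
        using rs st(3) by auto
    qed
    also have "\<dots> = 2 * nsq z - 2 * (cmod (z s))\<^sup>2 - (cmod (z t))\<^sup>2"
      using st by (simp add: sum_subtractf nsq_def sum_distrib_left)
    finally have "\<bar>Re (ip z bz)\<bar> \<le> 2 * nsq z - 2 * (cmod (z s))\<^sup>2 - (cmod (z t))\<^sup>2"
      using abs_Re_le_cmod order_trans by blast
    moreover have "\<bar>of_int e * (cmod (z s + \<beta>))\<^sup>2\<bar> \<le> (cmod (z s + \<beta>))\<^sup>2"
    proof -
      have "\<bar>real_of_int e\<bar> = 1" using e(2) by (metis of_int_1 of_int_abs)
      then show ?thesis by (simp add: abs_mult)
    qed
    ultimately show ?thesis unfolding sum using cross par by (smt (verit))
  qed
  moreover have "x i \<in> gauss_ints" for i by (auto simp: x_def delta_def gauss)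
  moreover have "\<exists>i<n. x i \<noteq> 0"
    using st e by (intro exI[of _ s]) (auto simp: x_def delta_def)
  ultimately show False using maximal[of x e] by blast
qed

lemma no_charged_path:
  assumes low: "\<And>i. i < n \<Longrightarrow> deg i \<le> 2" and s: "s < n" "a s s \<noteq> 0"
  shows False
proof -
  have "gnorm (a s s) \<le> deg s" using deg_ge[of "{s}" s] by simp
  then have "gnorm (a s s) \<le> 2" using low[OF s(1)] by simp
  then have "a s s = 1 \<or> a s s = -1" using diag_cases[of s] s by auto
  then obtain e where e: "a s s = of_int e" "\<bar>e\<bar> = 1"
    by (metis abs_minus_cancel abs_one of_int_1 of_int_minus)
  have g1: "gnorm (a s s) = 1"
    using \<open>a s s = 1 \<or> a s s = -1\<close> gnorm_eq_1[of 1] by auto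
  show False
  proof (cases "\<exists>t. t \<noteq> s \<and> a s t \<noteq> 0")
    case True
    then obtain t where t: "t \<noteq> s" "a s t \<noteq> 0" by blast
    have "gnorm (a s s) + gnorm (a s t) \<le> deg s" using deg_ge[of "{s, t}" s] t by simp
    then have u: "gnorm (a s t) = 1" "deg s = 2" using low[OF s(1)] gnorm_pos[OF t(2)] g1 by auto
    show False
    proof (rule no_charged_path_aux[OF low s(1) _ _ u(1) _ e])
      show "a s m = 0" if "m \<noteq> s" "m \<noteq> t" for m
        using row_supp[of "{s, t}" s m] t that u g1 by simp
    qed (use t nonzero_less in auto)
  next
    case False
    then have supp: "\<And>m. m \<noteq> s \<Longrightarrow> a s m = 0" by blast
    have sqs: "sq j s = a j s * a s s" for j by (rule sq_col1) (rule supp)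
    have ss: "a s s * a s s = 1" using unit_prod[OF g1] .
    define y where "y j = (1 / 3) * delta s j" for j
    have "dp y j = delta s j" for j
    proof -
      have "dp y j = (1 / 3) * ((if j = s then 4 else 0) - a j s * a s s)"
        unfolding y_def using s by (simp only: dp_lin dp_delta sqs)
      then show ?thesis using nonzero_sym[of j s] supp[of j] ss by (auto simp: delta_def)
    qed
    then have dpy: "dp y = delta s" by blast
    show False
    proof (rule no_extension[of y 0])
      have "ip y (delta s) = cnj (1 / 3) * delta s s" unfolding y_def using s by (simp only: ip_lin ip_delta)
      moreover have "ip (ap y) (delta s) = cnj (1 / 3) * ip (ap (delta s)) (delta s)"
        unfolding y_def by (simp only: ap_lin ip_lin)
      moreover have "ip (ap (delta s)) (delta s) = of_int e"
        unfolding ip_ap[symmetric] using s e by (simp add: ip_delta ap_delta)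
      ultimately have q: "ip y (dp y) = 1 / 3" "ip (ap y) (dp y) = of_int e / 3"
        unfolding dpy by (simp_all add: delta_def)
      show "\<bar>of_int 0 + Re (ip (ap y) (dp y))\<bar> \<le> 2 * (1 - Re (ip y (dp y)))"
        unfolding q using e(2) by (auto simp: abs_if split: if_splits)
    qed (use s in \<open>auto simp: dpy delta_def\<close>)
  qed
qed

lemma low_uncharged:
  assumes k: "deg k = 4" and i: "deg i \<le> 2" "a k i \<noteq> 0"
  shows "a i i = 0"
proof (rule ccontr)
  assume ii: "a i i \<noteq> 0"
  have ik: "a i k \<noteq> 0" using i nonzero_sym by blast
  have ne: "i \<noteq> k" using k i by auto
  have less: "i < n" "k < n" using nonzero_less[OF i(2)] by auto
  from i(1) ik ne have T2: "gnorm (a i k) = 1 \<and> gnorm (a i i) = 1 \<and> deg i = 2 \<and> (\<forall>m. m \<noteq> k \<longrightarrow> m \<noteq> i \<longrightarrow> a i m = 0)"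
    by (cases rule: low_cases) (use ii ne in auto)
  then have u: "gnorm (a i k) = 1" "gnorm (a i i) = 1" "deg i = 2"
    and supp: "\<And>m. m \<noteq> k \<Longrightarrow> m \<noteq> i \<Longrightarrow> a i m = 0" by auto
  have col: "sq m i = a m k * a k i + a m i * a i i" for m
    using sq_col2[of k i i m] supp ne by auto
  have k0: "sq k j = 0" if "j \<noteq> k" for j using full_row[OF k, of j] that by simp
  have "a k k * a k i + a k i * a i i = 0" using k0[of i] col[of k] ne by simp
  then have "a k i * (a k k + a i i) = 0" by (simp add: algebra_simps)
  then have kk: "a k k = - a i i" using i(2) by (simp add: eq_neg_iff_add_eq_0)
  then have gkk: "gnorm (a k k) = 1" using u by simp
  have gki: "gnorm (a k i) = 1" using u gnorm_sym[of k i] by simp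
  have low: "deg j \<le> 2" if "j \<noteq> k" "j \<noteq> i" "a k j \<noteq> 0" for j
  proof (rule ccontr)
    assume "\<not> deg j \<le> 2"
    then have "deg j = 4" using degs[of j] nonzero_less[OF that(3)] by auto
    then have "sq j i = 0" using full_row that by blast
    moreover have "a j i = 0" using supp[of j] that nonzero_sym[of j i] by blast
    ultimately show False using col[of j] that i(2) nonzero_sym[of j k] by simp
  qed
  obtain j where j: "j \<notin> {k, i}" "a k j \<noteq> 0" "j < n"
    using pick_nbr[of "{k, i}" k] k ne gkk gki by auto
  have jlow: "deg j \<le> 2" using low j by auto
  have jk: "a j k \<noteq> 0" "j \<noteq> k" "a j i = 0" using j nonzero_sym[of j k] supp[of j] nonzero_sym[of j i] by auto
  have kkj: "a k k * a k j \<noteq> 0" using j gkk by auto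
  have notleaf: "\<not> (\<forall>m. m \<noteq> k \<longrightarrow> a j m = 0)"
    using sq_col1[of k j k] k0[of j] kkj j by auto
  have gj: "gnorm (a j k) = 1" "deg j = 2"
    using jlow jk(1,2) by (cases rule: low_cases; use notleaf in blast)+
  have gkj: "gnorm (a k j) = 1" using gj gnorm_sym[of k j] by simp
  obtain j' where j': "j' \<notin> {k, i, j}" "a k j' \<noteq> 0" "j' < n"
    using pick_nbr[of "{k, i, j}" k] k ne gkk gki gkj j by auto
  have "gnorm (a k j') + 3 \<le> 4"
    using deg_ge[of "{k, i, j, j'}" k] k ne gkk gki gkj j j' by simp
  then have gkj': "gnorm (a k j') = 1" using gnorm_pos[OF j'(2)] by simp
  have ksupp: "a k m = 0" if "m \<notin> {k, i, j, j'}" for m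
    by (rule row_supp[of "{k, i, j, j'}"]) (use k ne gkk gki gkj gkj' j j' that in auto)
  have "sq m j = a m k * a k j" if m: "m \<noteq> j" "m \<noteq> k" for m
    using jlow jk(1,2)
  proof (cases rule: low_cases)
    case leaf
    then show ?thesis using notleaf by blast
  next
    case charged
    then have "sq m j = a m k * a k j + a m j * a j j" using sq_col2[of k j j m] jk by auto
    moreover have "a m j = 0" using charged(4)[of m] m nonzero_sym[of m j] by simp
    ultimately show ?thesis by simp
  next
    case (path l)
    have sqj: "sq q j = a q k * a k j + a q l * a l j" for q
      using sq_col2[of k l j q] path by auto
    then have "a k l \<noteq> 0" using k0[of j] kkj j by auto
    moreover have "l \<noteq> i" using jk(3) path(4) by auto
    ultimately have l: "l = j'" using ksupp[of l] path by blast
    have lj: "gnorm (a l j) = 1" using path(4) gnorm_sym[of l j] by simp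
    have llow: "deg l \<le> 2" using low j' l by auto
    have "a l m = 0"
    proof (rule row_supp[of "{k, j}"])
      show "deg l \<le> (\<Sum>k\<in>{k, j}. gnorm (a l k))"
        using llow lj gkj' l gnorm_sym[of l k] j by auto
    qed (use m in auto)
    then show ?thesis using sqj nonzero_sym[of m l] by simp
  qed
  note sqj = this
  have "\<bar>Re (a i i + a j j)\<bar> \<le> 2"
  proof -
    have "gnorm (a j j) \<le> 1"
      using jlow jk(1,2) by (cases rule: low_cases) (use jk in auto)
    then show ?thesis using diag_cases[of i] diag_cases[of j] u by auto
  qed
  moreover have "sq m i = a m k * a k i" if "m \<noteq> i" "m \<noteq> k" for m
    using col[of m] supp[of m] nonzero_sym[of m i] that by simp
  moreover have "a i j = 0" using supp j by auto
  ultimately show False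
    using no_fork[of k i j] less j ne u gj sqj k0[of i] k0[of j] by auto
qed

lemma triangle_identity:
  fixes e :: complex
  assumes "e * p + r * q = 0" "r' * p + f * q = 0" "e * r + p * q' + r * f + s * v = 0"
    "q * q' = 1" "r * r' = 1" "s * s' = 1" "e * e = 1"
  shows "v * q = s' * p"
proof -
  have *: "s * v = - (e * r + p * q' + r * f)" "r * q = - (e * p)" "f * q = - (r' * p)"
    using assms(1-3) by (simp_all add: eq_neg_iff_add_eq_0 algebra_simps)
  have "v * q = (s * s') * (v * q)" using assms by simp
  also have "\<dots> = s' * ((s * v) * q)" by (simp add: mult_ac)
  also have "\<dots> = s' * (- (e * (r * q) + p * (q * q') + r * (f * q)))"
    unfolding *(1) by (simp add: algebra_simps)
  also have "\<dots> = s' * ((e * e) * p - p + (r * r') * p)"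
    unfolding *(2,3) assms(4) by (simp add: algebra_simps)
  finally show ?thesis using assms by simp
qed

lemma no_triangle:
  assumes k: "deg k = 4" and i: "deg i = 2" "i \<noteq> k" "l \<noteq> k" "l \<noteq> i" "gnorm (a i k) = 1" "gnorm (a i l) = 1"
      "\<And>m. m \<noteq> k \<Longrightarrow> m \<noteq> l \<Longrightarrow> a i m = 0"
  shows "a k l = 0"
proof (rule ccontr)
  assume kl: "a k l \<noteq> 0"
  have less: "i < n" "k < n" "l < n"
    using nonzero_less[OF kl] i nonzero_less[of i k] by (auto simp flip: gnorm_0_iff)
  have g: "gnorm (a k i) = 1" "gnorm (a l i) = 1" using i gnorm_sym by metis+
  have col: "sq m i = a m k * a k i + a m l * a l i" for m
    using sq_col2[of k l i m] i by auto
  have k0: "sq k j = 0" if "j \<noteq> k" for j using full_row[OF k, of j] that by simp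
  have e1: "a k k * a k i + a k l * a l i = 0" using k0[of i] col[of k] i by simp
  then have "a k k * a k i = - (a k l * a l i)" by (simp add: eq_neg_iff_add_eq_0)
  then have "gnorm (a k k * a k i) = gnorm (a k l * a l i)" by simp
  then have geq: "gnorm (a k k) = gnorm (a k l)" using g by (simp add: gnorm_mult gauss)
  have "gnorm (a k k) + gnorm (a k i) + gnorm (a k l) \<le> 4"
    using deg_ge[of "{k, i, l}" k] k i by simp
  then have g1: "gnorm (a k l) = 1" "gnorm (a k k) = 1" using geq g gnorm_pos[OF kl] by auto
  have glk: "gnorm (a l k) = 1" using g1 gnorm_sym[of l k] by simp
  obtain m where m: "m \<notin> {k, i, l}" "a k m \<noteq> 0" "m < n"
    using pick_nbr[of "{k, i, l}" k] k i g g1 by auto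
  have "gnorm (a k m) + 3 \<le> 4" using deg_ge[of "{k, i, l, m}" k] k i g g1 m by simp
  then have gm: "gnorm (a k m) = 1" using gnorm_pos[OF m(2)] by simp
  have ksupp: "a k j = 0" if "j \<notin> {k, i, l, m}" for j
    by (rule row_supp[of "{k, i, l, m}"]) (use k i g g1 gm m that in auto)
  have im: "a i m = 0" using i(7) m by auto
  have sqk: "sq k j = a k k * a k j + a k i * a i j + a k l * a l j + a k m * a m j" for j
    using sq_row4[of k i l m k j] ksupp i m by auto
  show False
  proof (cases "deg l = 4")
    case False
    then have llow: "deg l \<le> 2" using degs less by blast
    have lsupp: "a l j = 0" if "j \<notin> {k, i}" for j
      using row_supp[of "{k, i}" l j] llow glk g i that by simp
    then have "sq m l = a m k * a k l + a m i * a i l" using sq_col2[of k i l m] i by auto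
    then have "sq m l \<noteq> 0" using im nonzero_sym[of m i] nonzero_sym[of m k] m kl by simp
    then have "deg m \<noteq> 4" using full_row[of m l] m by auto
    then have "a m m = 0" using low_uncharged[OF k _ m(2)] degs m by blast
    moreover have "a l m = 0" using lsupp m by auto
    ultimately have "sq k m = a k k * a k m" using sqk[of m] im by simp
    moreover have "a k k \<noteq> 0" using g1 by auto
    ultimately show False using k0[of m] m by auto
  next
    case True
    have l0: "sq l j = 0" if "j \<noteq> l" for j using full_row[OF True, of j] that by simp
    have e2: "a l k * a k i + a l l * a l i = 0" using l0[of i] col[of l] i by simp
    have e3: "a k k * a k l + a k i * a i l + a k l * a l l + a k m * a m l = 0"
      using k0[of l] sqk[of l] i by simp
    have key: "a m l * a l i = a m k * a k i"
    proof (rule triangle_identity[OF e1 e2 e3])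
      show "a k k * a k k = 1" using unit_prod[of k k] g1 by simp
    qed (use unit_prod[of l i] unit_prod[of k l] unit_prod[of k m] g g1 gm in auto)
    have "a m k * a k i \<noteq> 0" using m nonzero_sym[of m k] g by auto
    then have ml: "a m l \<noteq> 0" using key by auto
    have ll: "a l l \<noteq> 0" using e2 glk g by auto
    have lsupp: "a l j = 0" if "j \<notin> {l, k, i, m}" for j
    proof (rule row_supp[of "{l, k, i, m}"])
      show "deg l \<le> (\<Sum>k\<in>{l, k, i, m}. gnorm (a l k))"
        using True glk g gnorm_pos[OF ll] ml nonzero_sym[of l m] gnorm_pos[of l m] i m by auto
    qed (use that in auto)
    show False
    proof (rule no_twin[OF less(1) i(1)])
      fix j assume j: "j < n" "j \<noteq> i"
      consider "j = k" | "j = l" | "j = m" | "j \<notin> {k, l, i, m}" using j by blast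
      then show "\<exists>g\<in>gauss_ints. sq j i = 2 * g"
      proof cases
        case 1
        then show ?thesis using k0[of i] i by (intro bexI[of _ 0]) auto
      next
        case 2
        then show ?thesis using l0[of i] i by (intro bexI[of _ 0]) auto
      next
        case 3
        then show ?thesis using col[of m] key
          by (intro bexI[of _ "a m k * a k i"]) (auto simp: gauss)
      next
        case 4
        then show ?thesis using col[of j] ksupp[of j] lsupp[of j] nonzero_sym[of j k] nonzero_sym[of j l]
          by (intro bexI[of _ 0]) auto
      qed
    qed
  qed
qed

text \<open>
  In the situation of the following lemmas \<open>i\<close> has exactly the neighbours \<open>k\<close> and \<open>l\<close>; rows of
  norm four are orthogonal to all others, which controls the weights at \<open>l\<close>.
\<close>

definition joins :: "nat \<Rightarrow> nat \<Rightarrow> nat \<Rightarrow> bool" where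
  "joins i k l \<longleftrightarrow> deg i = 2 \<and> i \<noteq> k \<and> l \<noteq> k \<and> l \<noteq> i \<and> gnorm (a i k) = 1 \<and> gnorm (a i l) = 1 \<and>
     (\<forall>m. m \<noteq> k \<longrightarrow> m \<noteq> l \<longrightarrow> a i m = 0)"

lemma joinsD:
  assumes "joins i k l"
  shows "i < n" "k < n" "l < n" "sq m i = a m k * a k i + a m l * a l i"
    "a k i \<noteq> 0" "a i k \<noteq> 0" "a l i \<noteq> 0" "a i l \<noteq> 0" "a i m \<noteq> 0 \<Longrightarrow> m = k \<or> m = l"
    "a i k * a k i = 1" "a k i * a i k = 1" "a i l * a l i = 1" "a l i * a i l = 1"
proof -
  have g: "gnorm (a i k) = 1" "gnorm (a i l) = 1" "gnorm (a k i) = 1" "gnorm (a l i) = 1"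
    using assms gnorm_sym[of i k] gnorm_sym[of i l] by (auto simp: joins_def)
  show nz: "a k i \<noteq> 0" "a i k \<noteq> 0" "a l i \<noteq> 0" "a i l \<noteq> 0" using g by auto
  show "i < n" "k < n" "l < n" using nonzero_less nz by blast+
  show "sq m i = a m k * a k i + a m l * a l i"
    using sq_col2[of k l i m] assms by (auto simp: joins_def)
  show "a i m \<noteq> 0 \<Longrightarrow> m = k \<or> m = l" using assms by (auto simp: joins_def)
  show "a i k * a k i = 1" "a k i * a i k = 1" "a i l * a l i = 1" "a l i * a i l = 1"
    using unit_prod g by auto
qed

lemma low_neighbour_cases [consumes 3, case_names leaf joins]:
  assumes k: "deg k = 4" and i: "deg i \<le> 2" "a k i \<noteq> 0"
  obtains "\<And>m. m \<noteq> k \<Longrightarrow> a i m = 0" "a k k = 0" | l where "joins i k l" "a k l = 0" "a k k = 0"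
proof -
  have ne: "i \<noteq> k" using k i by auto
  have ik: "a i k \<noteq> 0" using i nonzero_sym by blast
  have k0: "sq k i = 0" using full_row[OF k, of i] ne by simp
  from i(1) ik ne show thesis
  proof (cases rule: low_cases)
    case leaf
    then have "sq k i = a k k * a k i" by (rule sq_col1)
    then show thesis using that(1) leaf k0 i by auto
  next
    case charged
    then show thesis using low_uncharged[OF k i] by simp
  next
    case (path l)
    have kl: "a k l = 0" by (rule no_triangle[OF k _ _ _ _ _ _]) (use path ne in auto)
    have j: "joins i k l" using path ne by (auto simp: joins_def)
    have "a k k = 0" using joinsD(4)[OF j, of k] kl k0 i by simp
    then show thesis using that(2) j kl by blast
  qed
qed

lemma leaf_neighbours_low:
  assumes k: "deg k = 4" and i: "a k i \<noteq> 0" "i \<noteq> k" "\<And>m. m \<noteq> k \<Longrightarrow> a i m = 0" and j: "a k j \<noteq> 0" "j \<noteq> k" "j \<noteq> i"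
  shows "deg j \<noteq> 4"
proof
  assume "deg j = 4"
  then have "sq j i = 0" using full_row j by blast
  moreover have "sq j i = a j k * a k i" using i(3) by (rule sq_col1)
  ultimately show False using i j nonzero_sym[of j k] by simp
qed

lemma joins_high:
  assumes J: "joins i k l" and h: "deg h = 4" "a k h \<noteq> 0" "h \<noteq> i"
  shows "a k h * a h l = - of_nat (gnorm (a k h)) * (a k i * a i l)" "gnorm (a l h) = gnorm (a k h)"
proof -
  have "a h k * a k i + a h l * a l i = 0"
    using full_row[OF h(1), of i] h joinsD(4)[OF J, of h] by simp
  then have "a h l * a l i = - (a h k * a k i)" by (simp add: eq_neg_iff_add_eq_0 add.commute)
  then have "a h l * a l i * a i l = - (a h k * a k i) * a i l" by simp
  then have hl: "a h l = - (a h k * a k i * a i l)"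
    using joinsD(13)[OF J] by (simp add: mult.assoc)
  have n: "of_nat (gnorm (a k h)) = a k h * a h k"
    using complex_of_nat_gnorm[OF gauss[of k h]] by (simp flip: herm)
  show "a k h * a h l = - of_nat (gnorm (a k h)) * (a k i * a i l)"
    unfolding hl n by (simp add: mult.assoc)
  have "gnorm (a k i) = 1" "gnorm (a i l) = 1" using J gnorm_sym[of k i] by (auto simp: joins_def)
  then have "gnorm (a h l) = gnorm (a h k)" unfolding hl by (simp add: gnorm_mult gauss gauss_ints_closed)
  then show "gnorm (a l h) = gnorm (a k h)" using gnorm_sym by metis
qed

lemma joins_not_adjacent_twin:
  assumes k: "deg k = 4" and J: "joins i k l" "a k l = 0" and m: "m \<noteq> i" "a k m * a m l = a k i * a i l"
    "gnorm (a k m) = 1"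
    and high: "\<And>j. j \<noteq> i \<Longrightarrow> j \<noteq> m \<Longrightarrow> a k j \<noteq> 0 \<or> a l j \<noteq> 0 \<Longrightarrow> deg j = 4"
  shows False
proof (rule no_twin[of i])
  show "i < n" by (rule joinsD[OF J(1)])
  show "deg i = 2" using J(1) by (simp add: joins_def)
  fix j assume j: "j < n" "j \<noteq> i"
  show "\<exists>g\<in>gauss_ints. sq j i = 2 * g"
  proof (cases "j = m")
    case True
    have "a m k * a k m = 1" using unit_prod m(3) gnorm_sym by metis
    then have "a m l = a m k * (a k m * a m l)" by (simp flip: mult.assoc)
    then have "a m l * a l i = a m k * (a k i * (a i l * a l i))" unfolding m(2) by (simp add: mult.assoc)
    then have "a m l * a l i = a m k * a k i" using joinsD(12)[OF J(1)] by simp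
    then show ?thesis unfolding joinsD(4)[OF J(1)] True
      by (intro bexI[of _ "a m k * a k i"]) (auto simp: gauss)
  next
    case False
    have "sq j i = 0"
    proof (cases "a k j \<noteq> 0 \<or> a l j \<noteq> 0")
      case True
      then show ?thesis using full_row high j False by blast
    next
      case False
      then show ?thesis using joinsD(4)[OF J(1)] nonzero_sym[of j k] nonzero_sym[of j l] by simp
    qed
    then show ?thesis by (intro bexI[of _ 0]) auto
  qed
qed

lemma mixed_neighbours:
  assumes k: "deg k = 4" and i: "deg i \<le> 2" "a k i \<noteq> 0" and h: "deg h = 4" "a k h \<noteq> 0" "h \<noteq> k"
  obtains l p q where "joins i k l" "a k l = 0" "a k k = 0" "distinct [i, h, p, q]" "p \<noteq> k" "q \<noteq> k" "deg p \<le> 2" "deg q \<le> 2"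
    "gnorm (a k h) = 1" "gnorm (a k p) = 1" "gnorm (a k q) = 1" "\<And>j. j \<notin> {i, h, p, q} \<Longrightarrow> a k j = 0"
proof -
  have ih: "i \<noteq> h" "i \<noteq> k" using i h k by auto
  have noleaf: "\<exists>l. joins x k l \<and> a k l = 0 \<and> a k k = 0" if x: "deg x \<le> 2" "a k x \<noteq> 0" for x
    using k x
  proof (cases rule: low_neighbour_cases)
    case leaf
    have "x \<noteq> k" "h \<noteq> x" using x k h by auto
    then show ?thesis using leaf_neighbours_low[OF k x(2) _ leaf(1) h(2,3)] h(1) by blast
  qed blast
  then obtain l where J: "joins i k l" "a k l = 0" "a k k = 0" using i by blast
  define w where "w = a k i * a i l"
  have w0: "w \<noteq> 0" using joinsD[OF J(1)] by (simp add: w_def)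
  have gi: "gnorm (a k i) = 1" "gnorm (a l i) = 1" "l \<noteq> k"
    using J(1) gnorm_sym[of k i] gnorm_sym[of l i] by (auto simp: joins_def)
  have kl: "sq k l = 0" using full_row[OF k, of l] gi by simp
  have low: "deg x \<le> 2 \<or> deg x = 4" if "a k x \<noteq> 0" for x using degs nonzero_less[OF that] by blast
  have unit: "gnorm (a k x) = 1" if "deg x \<le> 2" "a k x \<noteq> 0" for x
    using noleaf[OF that] gnorm_sym[of k x] by (auto simp: joins_def)
  have hw: "a k x * a x l = - of_nat (gnorm (a k x)) * w" if "deg x = 4" "a k x \<noteq> 0" for x
  proof -
    have "x \<noteq> i" using that i by auto
    then show ?thesis unfolding w_def by (rule joins_high(1)[OF J(1) that])
  qed
  have hl: "gnorm (a l x) = gnorm (a k x)" if "deg x = 4" "a k x \<noteq> 0" for x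
  proof -
    have "x \<noteq> i" using that i by auto
    then show ?thesis by (rule joins_high(2)[OF J(1) that])
  qed
  have gh: "gnorm (a k i) + gnorm (a k h) \<le> 4" using deg_ge[of "{i, h}" k] k ih by simp
  then have gh3: "gnorm (a k h) < 3" using gi gnorm_not_3[of k h] by auto
  obtain p where p: "p \<notin> {i, h}" "a k p \<noteq> 0" using pick_nbr[of "{i, h}" k] k ih gi gh3 by auto
  have gp: "gnorm (a k i) + gnorm (a k h) + gnorm (a k p) \<le> 4" using deg_ge[of "{i, h, p}" k] k ih p by simp
  have pos: "gnorm (a k h) \<ge> 1" "gnorm (a k p) \<ge> 1" using gnorm_pos h p by auto
  have ldeg: "deg l \<le> 4" using deg_le joinsD(3)[OF J(1)] by blast
  show thesis
  proof (cases "gnorm (a k h) + gnorm (a k p) = 3")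
    case True
    have supp: "a k j = 0" if "j \<notin> {i, h, p}" for j
      by (rule row_supp[of "{i, h, p}"]) (use k ih p gi True that in auto)
    have "sq k l = w + a k h * a h l + a k p * a p l"
      using sq_row3[of i h p k l] supp ih p by (auto simp: w_def)
    then have s: "w + - of_nat (gnorm (a k h)) * w + a k p * a p l = 0" using kl hw[OF h(1,2)] by simp
    from low[OF p(2)] show thesis
    proof
      assume "deg p = 4"
      then have "w * (1 - of_nat (gnorm (a k h)) - of_nat (gnorm (a k p))) = 0"
        using s hw[of p] p by (simp add: algebra_simps)
      then have "1 - of_nat (gnorm (a k h)) - of_nat (gnorm (a k p)) = (0 :: complex)" using w0 by simp
      then have "of_nat (gnorm (a k h) + gnorm (a k p)) = (1 :: complex)" by (simp add: algebra_simps)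
      then show thesis unfolding True by simp
    next
      assume plow: "deg p \<le> 2"
      then have gp1: "gnorm (a k p) = 1" using unit p by blast
      then have gh2: "gnorm (a k h) = 2" using True by simp
      have pw: "a k p * a p l = w" using s gh2 by simp
      then have "a l p \<noteq> 0" using w0 nonzero_sym[of l p] by auto
      then have lsupp: "a l j = 0" if "j \<notin> {i, h, p}" for j
        by (intro row_supp[of "{i, h, p}"]) (use ldeg gi hl[OF h(1,2)] gh2 gnorm_pos[of l p] ih p that in auto)
      show thesis
        by (rule FalseE, rule joins_not_adjacent_twin[OF k J(1,2) _ pw[unfolded w_def] gp1])
          (use p supp lsupp h in auto)
    qed
  next
    case False
    have "gnorm (a k h) \<noteq> 3" "gnorm (a k p) \<noteq> 3" by (simp_all add: gnorm_not_3)
    then have g1: "gnorm (a k h) = 1" "gnorm (a k p) = 1" using gp gi pos False by linarith+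
    obtain q where q: "q \<notin> {i, h, p}" "a k q \<noteq> 0" using pick_nbr[of "{i, h, p}" k] k ih gi g1 p by auto
    have "gnorm (a k i) + gnorm (a k h) + gnorm (a k p) + gnorm (a k q) \<le> 4"
      using deg_ge[of "{i, h, p, q}" k] k ih p q by simp
    then have gq: "gnorm (a k q) = 1" using gi g1 gnorm_pos[OF q(2)] by simp
    have supp: "a k j = 0" if "j \<notin> {i, h, p, q}" for j
      by (rule row_supp[of "{i, h, p, q}"]) (use k ih p q gi g1 gq that in auto)
    have "sq k l = w + a k h * a h l + a k p * a p l + a k q * a q l"
      using sq_row4[of i h p q k l] supp ih p q by (auto simp: w_def)
    then have s: "a k p * a p l + a k q * a q l = 0" using kl hw[OF h(1,2)] g1 by simp
    have one: False if x: "deg x \<le> 2" "deg y = 4" "{x, y} = {p, q}" for x y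
    proof -
      have xy: "x \<noteq> i" "x \<noteq> h" "y \<noteq> i" "y \<noteq> h" "x \<noteq> y" "a k x \<noteq> 0" "a k y \<noteq> 0" "gnorm (a k x) = 1" "gnorm (a k y) = 1"
        using x p q g1 gq by (auto simp: doubleton_eq_iff)
      have "a k x * a x l + a k y * a y l = 0" using s x(3) by (auto simp: doubleton_eq_iff add.commute)
      then have pw: "a k x * a x l = w" using hw[OF x(2)] xy by simp
      then have "a l x \<noteq> 0" using w0 nonzero_sym[of l x] by auto
      then have lsupp: "a l j = 0" if "j \<notin> {i, h, x, y}" for j
        by (intro row_supp[of "{i, h, x, y}"])
          (use ldeg gi hl[OF h(1,2)] hl[OF x(2)] g1 gnorm_pos[of l x] ih xy that in auto)
      have ksupp: "a k j = 0" if "j \<notin> {i, h, x, y}" for j using supp[of j] x(3) that by auto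
      show False
        by (rule joins_not_adjacent_twin[OF k J(1,2) xy(1) pw[unfolded w_def] xy(8)])
          (use ksupp lsupp h x in auto)
    qed
    have "\<not> (deg p = 4 \<and> deg q = 4)"
    proof
      assume "deg p = 4 \<and> deg q = 4"
      then have "a k p * a p l = - w" "a k q * a q l = - w" using hw[of p] hw[of q] p q g1 gq by auto
      then show False using s w0 by simp
    qed
    then have "deg p \<le> 2" "deg q \<le> 2" using one[of p q] one[of q p] low[OF p(2)] low[OF q(2)] by auto
    moreover have "p \<noteq> k" "q \<noteq> k" using p q J(3) by auto
    ultimately show thesis using that[of l p q] J ih p q g1 gq supp by auto
  qed
qed

end

context maximal_graph
begin

lemma mixed_distinct:
  assumes k: "deg k = 4" and h: "deg h = 4" "a k h \<noteq> 0" "h \<noteq> k" "gnorm (a k h) = 1"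
    and d: "distinct [x, h, y, z]" "deg x \<le> 2" "deg y \<le> 2" "deg z \<le> 2" "a k x \<noteq> 0" "a k y \<noteq> 0" "a k z \<noteq> 0"
    and supp: "\<And>j. j \<notin> {x, h, y, z} \<Longrightarrow> a k j = 0"
    and J: "joins x k l"
  shows "a l y = 0 \<and> a l z = 0"
proof -
  define w where "w = a k x * a x l"
  have w0: "w \<noteq> 0" using joinsD[OF J] by (simp add: w_def)
  have lk: "l \<noteq> k" using J by (simp add: joins_def)
  have hl: "a k h * a h l = - w" unfolding w_def using joins_high(1)[OF J h(1,2)] h d by simp
  have other: "a k v * a v l = 0 \<or> a k v * a v l = w" if v: "v \<noteq> h" "deg v \<le> 2" "a k v \<noteq> 0" for v
  proof (cases "a v l = 0")
    case False
    have Jv: "joins v k l"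
      using k v(2,3)
    proof (cases rule: low_neighbour_cases)
      case leaf
      then show ?thesis using False lk by blast
    next
      case (joins l')
      then have "l = l'" using joinsD(9)[OF joins(1) False] lk by blast
      then show ?thesis using joins by blast
    qed
    then show ?thesis using joins_high(1)[OF Jv h(1,2)] h(4) v hl by simp
  qed simp
  have "sq k l = w + a k h * a h l + a k y * a y l + a k z * a z l"
    using sq_row4[of x h y z k l] supp d by (auto simp: w_def)
  then have "a k y * a y l + a k z * a z l = 0" using hl full_row[OF k, of l] lk by simp
  then have "a k y * a y l = 0 \<and> a k z * a z l = 0" using other[of y] other[of z] d w0 by auto
  then show ?thesis using d nonzero_sym[of l y] nonzero_sym[of l z] by auto
qed

text \<open>
  If a vertex \<open>k\<close> of degree 4 has both a neighbour \<open>i\<close> of smaller degree and a neighbour \<open>h\<close> of degree 4,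
  the graph consists of \<open>h\<close>, its four neighbours, and the neighbours of those.
\<close>

lemma mixed_uncharged:
  assumes k: "deg k = 4" and i: "deg i \<le> 2" "a k i \<noteq> 0" and h: "deg h = 4" "a k h \<noteq> 0" "h \<noteq> k" and s: "s < n"
  shows "a s s = 0"
proof -
  have high: "a x x = 0 \<and> (\<forall>y. a x y \<noteq> 0 \<longrightarrow> y = h \<or> (\<exists>l. joins y x l \<and> a h l \<noteq> 0))"
    if x: "deg x = 4" "a x h \<noteq> 0" "x \<noteq> h" and y0: "deg y0 \<le> 2" "a x y0 \<noteq> 0" for x y0
  proof -
    obtain l p q where *: "a x x = 0" "deg p \<le> 2" "deg q \<le> 2" "\<And>j. j \<notin> {y0, h, p, q} \<Longrightarrow> a x j = 0"
      using mixed_neighbours[OF x(1) y0 h(1) x(2)] x(3) by metis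
    moreover have "\<exists>l. joins y x l \<and> a h l \<noteq> 0" if y: "a x y \<noteq> 0" "y \<noteq> h" for y
    proof -
      have "y \<in> {y0, h, p, q}" using *(4) y by blast
      then have ylow: "deg y \<le> 2" using *(2,3) y y0 by auto
      have yx: "y \<noteq> x" using ylow x by auto
      obtain l where l: "joins y x l"
        using x(1) ylow y(1)
      proof (cases rule: low_neighbour_cases)
        case leaf
        then show ?thesis using leaf_neighbours_low[OF x(1) y(1) yx leaf(1) x(2)] h x y by auto
      qed blast
      have "gnorm (a l h) = gnorm (a x h)" using joins_high(2)[OF l h(1) x(2)] y by auto
      then have "a l h \<noteq> 0" using x(2) gnorm_0_iff by metis
      then show ?thesis using l nonzero_sym by blast
    qed
    ultimately show ?thesis by blast
  qed
  obtain l p q where *: "joins i k l" "a k l = 0" "a k k = 0" "distinct [i, h, p, q]" "p \<noteq> k" "q \<noteq> k"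
    "deg p \<le> 2" "deg q \<le> 2" "gnorm (a k h) = 1" "gnorm (a k p) = 1" "gnorm (a k q) = 1"
    "\<And>j. j \<notin> {i, h, p, q} \<Longrightarrow> a k j = 0"
    using mixed_neighbours[OF k i h] by metis
  have kpq: "a k p \<noteq> 0" "a k q \<noteq> 0" using * by auto
  have hk: "a k h \<noteq> 0" "k \<noteq> h" using h by auto
  obtain l1 l2 where l12: "joins p k l1" "a h l1 \<noteq> 0" "joins q k l2" "a h l2 \<noteq> 0"
    using high[OF k hk i] kpq * by (metis distinct_length_2_or_more)
  have hl: "a h l \<noteq> 0"
    using joins_high(2)[OF *(1) h(1,2)] h *(4) nonzero_sym[of h l] gnorm_0_iff by (metis distinct_length_2_or_more)
  have "a l p = 0 \<and> a l q = 0"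
    by (rule mixed_distinct[OF k h *(9,4) i(1) *(7,8) i(2) kpq *(12) *(1)])
  moreover have "a l1 i = 0 \<and> a l1 q = 0"
    by (rule mixed_distinct[OF k h *(9) _ *(7) i(1) *(8) kpq(1) i(2) kpq(2) _ l12(1)]) (use * in auto)
  ultimately have dist: "distinct [k, l, l1, l2]"
    using *(1) l12 joinsD(7)[OF *(1)] joinsD(7)[OF l12(1)] joinsD(7)[OF l12(3)] by (auto simp: joins_def)
  have hk': "a h k \<noteq> 0" using h nonzero_sym by blast
  have hsupp: "a h x = 0" if "x \<notin> {k, l, l1, l2}" for x
    by (rule row_supp[of "{k, l, l1, l2}"])
      (use h dist gnorm_pos[OF hk'] gnorm_pos[OF hl] gnorm_pos[OF l12(2)] gnorm_pos[OF l12(4)] that in auto)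
  have hh: "a h h = 0"
  proof -
    have "l \<noteq> h \<and> l1 \<noteq> h \<and> l2 \<noteq> h"
      using joins_def high[OF k hk i] *(2) h(2) hsupp
    proof -
      have "a k v = 0" if "joins u k v" "a k u \<noteq> 0" "deg u \<le> 2" for u v
        using k that(3,2)
      proof (cases rule: low_neighbour_cases)
        case leaf
        then show ?thesis using that(1) by (auto simp: joins_def)
      next
        case (joins l')
        then have "v = l'" using joinsD(9)[OF joins(1), of v] joinsD(8)[OF that(1)] that(1) by (auto simp: joins_def)
        then show ?thesis using joins by simp
      qed
      then show ?thesis using *(1,7,8) l12 kpq i h(2) by blast
    qed
    then show ?thesis using hsupp[of h] h by auto
  qed
  have nbr: "a x x = 0 \<and> (\<forall>y. a x y \<noteq> 0 \<longrightarrow> y = h \<or> (a y y = 0 \<and> (\<forall>z. a y z \<noteq> 0 \<longrightarrow> a h z \<noteq> 0)))"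
    if x: "a h x \<noteq> 0" for x
  proof -
    have xh: "a x h \<noteq> 0" "x \<noteq> h" using x nonzero_sym hh by auto
    have "x \<in> {k, l, l1, l2}" using hsupp x by blast
    then obtain y0 where y0: "deg y0 \<le> 2" "a x y0 \<noteq> 0" "y0 \<noteq> h" "joins y0 k x \<or> x = k"
      using i l12 *(1,4,7,8) joinsD(7)[OF *(1)] joinsD(7)[OF l12(1)] joinsD(7)[OF l12(3)] by auto
    show ?thesis
    proof (cases "deg x = 4")
      case True
      have "a y y = 0 \<and> (\<forall>z. a y z \<noteq> 0 \<longrightarrow> a h z \<noteq> 0)" if y: "a x y \<noteq> 0" "y \<noteq> h" for y
      proof -
        obtain l' where l': "joins y x l'" "a h l' \<noteq> 0" using high[OF True xh y0(1,2)] y by blast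
        then show ?thesis using joinsD(9)[OF l'(1)] x by (auto simp: joins_def)
      qed
      then show ?thesis using high[OF True xh y0(1,2)] by blast
    next
      case False
      then have xlow: "deg x \<le> 2" using degs nonzero_less[OF x] by blast
      then have J: "joins y0 k x" using y0(4) k by auto
      have xsupp: "a x j = 0" if "j \<notin> {y0, h}" for j
        by (rule row_supp[of "{y0, h}"])
          (use xlow gnorm_pos[OF y0(2)] gnorm_pos[OF xh(1)] y0(3) that in auto)
      have "x \<noteq> y0" using J by (auto simp: joins_def)
      then have "a x x = 0" using xsupp xh by auto
      moreover have "a y0 y0 = 0" using J by (auto simp: joins_def)
      moreover have "y = y0 \<or> y = h" if "a x y \<noteq> 0" for y using xsupp that by blast
      moreover have "a h z \<noteq> 0" if "a y0 z \<noteq> 0" for z using joinsD(9)[OF J that] x hk' by auto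
      ultimately show ?thesis by metis
    qed
  qed
  define S where "S = {h} \<union> {x. a h x \<noteq> 0} \<union> {y. y \<noteq> h \<and> (\<exists>x. a h x \<noteq> 0 \<and> a x y \<noteq> 0)}"
  have "S = {..<n}"
  proof (rule conn)
    show "S \<subseteq> {..<n}" using nonzero_less hk by (auto simp: S_def)
    show "j \<in> S" if "u \<in> S" "a u j \<noteq> 0" for u j
      using that nbr unfolding S_def by blast
  qed (simp add: S_def)
  then have "s \<in> S" using s by simp
  then show ?thesis using hh nbr unfolding S_def by blast
qed

lemma full_degree:
  assumes s: "s < n" "a s s \<noteq> 0" and i: "i < n"
  shows "deg i = 4"
proof (rule ccontr)
  assume "deg i \<noteq> 4"
  then have ilow: "deg i \<le> 2" using degs i by blast
  have "\<exists>i k. deg i \<le> 2 \<and> deg k = 4 \<and> a k i \<noteq> 0"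
  proof (rule ccontr)
    assume no: "\<not> ?thesis"
    have "{v. v < n \<and> deg v \<le> 2} = {..<n}"
    proof (rule conn)
      show "j \<in> {v. v < n \<and> deg v \<le> 2}" if "u \<in> {v. v < n \<and> deg v \<le> 2}" "a u j \<noteq> 0" for u j
        using that no degs[of j] nonzero_less[OF that(2)] nonzero_sym[of j u] by auto
    qed (use i ilow in auto)
    then show False using no_charged_path[OF _ s] by blast
  qed
  then obtain i k where ik: "deg i \<le> 2" "deg k = 4" "a k i \<noteq> 0" by blast
  have unmixed: "deg j \<le> 2" if "deg k = 4" "deg i \<le> 2" "a k i \<noteq> 0" "a k j \<noteq> 0" "j \<noteq> k" for k i j
    using mixed_uncharged[OF that(1-3) _ that(4,5) s(1)] s degs[of j] nonzero_less[OF that(4)] by blast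
  define K where "K = {k. deg k = 4 \<and> (\<exists>i. deg i \<le> 2 \<and> a k i \<noteq> 0)}"
  define N where "N = {y. \<exists>k\<in>K. a k y \<noteq> 0}"
  define M where "M = {l. l \<notin> K \<and> (\<exists>y\<in>N. a y l \<noteq> 0)}"
  have K: "a k k = 0" if k: "k \<in> K" for k
  proof -
    obtain i where i: "deg k = 4" "deg i \<le> 2" "a k i \<noteq> 0" using k by (auto simp: K_def)
    then show ?thesis by (cases rule: low_neighbour_cases) auto
  qed
  have N: "deg y \<le> 2 \<and> a y y = 0" if k: "k \<in> K" "a k y \<noteq> 0" for k y
  proof -
    obtain i where i: "deg k = 4" "deg i \<le> 2" "a k i \<noteq> 0" using k by (auto simp: K_def)
    have "y \<noteq> k" using K k by auto
    then show ?thesis using unmixed[OF i k(2)] low_uncharged[OF i(1) _ k(2)] by blast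
  qed
  have M: "a l l = 0 \<and> (\<forall>z. a l z \<noteq> 0 \<longrightarrow> z \<in> N)" if l: "l \<in> M" for l
  proof -
    obtain k y where ky: "k \<in> K" "a k y \<noteq> 0" "a y l \<noteq> 0" "l \<notin> K" using l unfolding M_def N_def by blast
    have k4: "deg k = 4" using ky(1) by (simp add: K_def)
    have ylow: "deg y \<le> 2" using N[OF ky(1,2)] by simp
    have ly: "a l y \<noteq> 0" using ky nonzero_sym by blast
    have lk: "l \<noteq> k" using ky by auto
    have kl: "a k l = 0"
      using k4 ylow ky(2)
    proof (cases rule: low_neighbour_cases)
      case leaf
      then show ?thesis using ky lk by blast
    next
      case (joins l')
      then show ?thesis using joinsD(9)[OF joins(1) ky(3)] lk by auto
    qed
    have llow: "deg l \<le> 2"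
      using degs[of l] nonzero_less[OF ly] ky(4) ylow ly by (auto simp: K_def)
    have "\<exists>m. m \<noteq> y \<and> a k m * a m l \<noteq> 0"
    proof (rule ccontr)
      assume "\<not> ?thesis"
      then have "sq k l = a k y * a y l" using sq_supp[of "{y}" k l] by auto
      then show False using full_row[OF k4, of l] lk ky by simp
    qed
    then obtain m where m: "m \<noteq> y" "a k m \<noteq> 0" "a m l \<noteq> 0" by auto
    have lm: "a l m \<noteq> 0" using m nonzero_sym by blast
    have supp: "a l z = 0" if "z \<notin> {y, m}" for z
      by (rule row_supp[of "{y, m}"]) (use llow gnorm_pos[OF ly] gnorm_pos[OF lm] m that in auto)
    have "l \<notin> {y, m}" using kl ky m by auto
    then have "a l l = 0" by (rule supp)
    moreover have "z = y \<or> z = m" if "a l z \<noteq> 0" for z using supp that by blast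
    moreover have "y \<in> N" "m \<in> N" using ky m by (auto simp: N_def)
    ultimately show ?thesis by blast
  qed
  have "K \<union> N \<union> M = {..<n}"
  proof (rule conn)
    show "K \<union> N \<union> M \<subseteq> {..<n}" using nonzero_less by (fastforce simp: K_def N_def M_def)
    show "K \<union> N \<union> M \<noteq> {}" using ik by (auto simp: K_def)
    show "j \<in> K \<union> N \<union> M" if "u \<in> K \<union> N \<union> M" "a u j \<noteq> 0" for u j
      using that M unfolding N_def M_def by blast
  qed
  then have "s \<in> K \<union> N \<union> M" using s by simp
  then show False using s K N M unfolding N_def by blast
qed

end

section \<open>Indecomposable and maximal matrices as graphs\<close>

lemma reachable_underlying_graph:
  assumes A: "A \<in> carrier_mat n n" and sym: "\<And>i j. i < n \<Longrightarrow> j < n \<Longrightarrow> A $$ (i, j) = 0 \<longleftrightarrow> A $$ (j, i) = 0"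
  shows "u \<rightarrow>\<^sup>*\<^bsub>with_proj (mk_symmetric (with_proj (underlying_graph A)))\<^esub> v \<longleftrightarrow>
    (u, v) \<in> rtrancl_on {0..<n} {(u, v). u < n \<and> v < n \<and> u \<noteq> v \<and> A $$ (u, v) \<noteq> 0}"
proof -
  have "parcs (mk_symmetric (with_proj (underlying_graph A))) = {(u, v). u < n \<and> v < n \<and> u \<noteq> v \<and> A $$ (u, v) \<noteq> 0}"
    unfolding mk_symmetric_def underlying_graph_def using A sym by auto
  moreover have "pverts (mk_symmetric (with_proj (underlying_graph A))) = {0..<n}"
    unfolding mk_symmetric_def underlying_graph_def using A by auto
  ultimately show ?thesis unfolding reachable_def by simp
qed

lemma indecomposable_iff:
  assumes A: "A \<in> carrier_mat n n" and sym: "\<And>i j. i < n \<Longrightarrow> j < n \<Longrightarrow> A $$ (i, j) = 0 \<longleftrightarrow> A $$ (j, i) = 0"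
  shows "indecomposable A \<longleftrightarrow> n > 0 \<and>
    (\<forall>S. S \<subseteq> {..<n} \<longrightarrow> S \<noteq> {} \<longrightarrow> (\<forall>i\<in>S. \<forall>j<n. A $$ (i, j) \<noteq> 0 \<longrightarrow> j \<in> S) \<longrightarrow> S = {..<n})"
proof -
  define E where "E = {(u, v). u < n \<and> v < n \<and> u \<noteq> v \<and> A $$ (u, v) \<noteq> 0}"
  have "verts (with_proj (mk_symmetric (with_proj (underlying_graph A)))) = {0..<n}"
    using A by (simp add: underlying_graph_def)
  moreover have "u \<rightarrow>\<^sup>*\<^bsub>with_proj (mk_symmetric (with_proj (underlying_graph A)))\<^esub> v \<longleftrightarrow> (u, v) \<in> rtrancl_on {0..<n} E" for u v
    unfolding E_def by (rule reachable_underlying_graph[OF assms])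
  ultimately have ind: "indecomposable A \<longleftrightarrow> n > 0 \<and> (\<forall>u<n. \<forall>v<n. (u, v) \<in> rtrancl_on {0..<n} E)"
    unfolding indecomposable_def Digraph_Component.connected_def strongly_connected_def by auto
  show ?thesis
  proof
    assume ia: "indecomposable A"
    show "0 < n \<and> (\<forall>S. S \<subseteq> {..<n} \<longrightarrow> S \<noteq> {} \<longrightarrow> (\<forall>i\<in>S. \<forall>j<n. A $$ (i, j) \<noteq> 0 \<longrightarrow> j \<in> S) \<longrightarrow> S = {..<n})"
    proof (intro conjI allI impI)
    show "0 < n" using ia ind by blast
    fix S assume S: "S \<subseteq> {..<n}" "S \<noteq> {}" "\<forall>i\<in>S. \<forall>j<n. A $$ (i, j) \<noteq> 0 \<longrightarrow> j \<in> S"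
    obtain u where u: "u \<in> S" using S by blast
    have "v \<in> S" if "v < n" for v
    proof -
      have "(u, v) \<in> rtrancl_on {0..<n} E" using ia that u S(1) unfolding ind by blast
      then show ?thesis
      proof (induction rule: rtrancl_on_induct)
        case base
        show ?case by (rule u)
      next
        case (step y z)
        then show ?case using S(3) by (auto simp: E_def)
      qed
    qed
    then show "S = {..<n}" using S(1) by blast
    qed
  next
    assume r: "0 < n \<and> (\<forall>S. S \<subseteq> {..<n} \<longrightarrow> S \<noteq> {} \<longrightarrow> (\<forall>i\<in>S. \<forall>j<n. A $$ (i, j) \<noteq> 0 \<longrightarrow> j \<in> S) \<longrightarrow> S = {..<n})"
    have "(u, v) \<in> rtrancl_on {0..<n} E" if uv: "u < n" "v < n" for u v
    proof -
      define S where "S = {w. (u, w) \<in> rtrancl_on {0..<n} E}"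
      have sub: "S \<subseteq> {..<n}" unfolding S_def using in_rtrancl_on_in_F(2) by fastforce
      have "u \<in> S" using uv by (simp add: S_def)
      moreover have "j \<in> S" if ij: "i \<in> S" "j < n" "A $$ (i, j) \<noteq> 0" for i j
      proof (cases "i = j")
        case False
        then have "(i, j) \<in> E" using ij sub by (auto simp: E_def)
        then show ?thesis using ij unfolding S_def by (auto intro: rtrancl_on_into_rtrancl_on)
      qed (use ij in simp)
      ultimately have "S = {..<n}" using r sub by blast
      then show ?thesis using uv unfolding S_def by blast
    qed
    then show "indecomposable A" unfolding ind using r by blast
  qed
qed

definition extend_by :: "nat \<Rightarrow> (nat \<Rightarrow> nat \<Rightarrow> complex) \<Rightarrow> (nat \<Rightarrow> complex) \<Rightarrow> complex \<Rightarrow> nat \<Rightarrow> nat \<Rightarrow> complex" where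
  "extend_by n a x c i j = (if i < n \<and> j < n then a i j else if i < n \<and> j = n then x i
     else if i = n \<and> j < n then cnj (x j) else if i = n \<and> j = n then c else 0)"

lemma maximal_graph_entries:
  assumes "maximal_indecomposable_cyclotomic A"
  shows "maximal_graph (dim_row A) (entries A)"
proof -
  define n where "n = dim_row A"
  define a where "a = entries A"
  have cyc: "cyclotomic A" and ind: "indecomposable A"
    using assms by (auto simp: maximal_indecomposable_cyclotomic_def)
  interpret hermitian_form n a unfolding n_def a_def by (rule cyclotomic_hermitian_form[OF cyc])
  have A: "A \<in> carrier_mat n n" and gA: "A $$ (i, j) \<in> gauss_ints" if "i < n" "j < n" for i j
    using cyc that by (auto simp: cyclotomic_def gauss_mats_iff n_def)
  have A: "A \<in> carrier_mat n n" using cyc by (auto simp: cyclotomic_def gauss_mats_iff n_def)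
  have aA: "a i j = A $$ (i, j)" if "i < n" "j < n" for i j
    using that by (simp add: a_def entries_def n_def)
  have symA: "A $$ (i, j) = 0 \<longleftrightarrow> A $$ (j, i) = 0" if "i < n" "j < n" for i j
    using that herm[of i j] by (simp add: aA)
  have conn: "n > 0 \<and> (\<forall>S. S \<subseteq> {..<n} \<longrightarrow> S \<noteq> {} \<longrightarrow> (\<forall>i\<in>S. \<forall>j<n. A $$ (i, j) \<noteq> 0 \<longrightarrow> j \<in> S) \<longrightarrow> S = {..<n})"
    using ind by (subst (asm) indecomposable_iff[OF A]) (use symA in auto)
  have "maximal_graph n a"
  proof
    show "nsq (ap v) \<le> 4 * nsq v" for v
      using cyclotomic_contraction[OF cyc] by (simp add: n_def a_def)
    show "a i j \<in> gauss_ints" for i j using gA by (auto simp: a_def entries_def n_def)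
    show "n > 0" using conn by blast
    show "S = {..<n}" if S: "S \<subseteq> {..<n}" "S \<noteq> {}" "\<And>i j. i \<in> S \<Longrightarrow> a i j \<noteq> 0 \<Longrightarrow> j \<in> S" for S
    proof -
      have "\<forall>i\<in>S. \<forall>j<n. A $$ (i, j) \<noteq> 0 \<longrightarrow> j \<in> S"
      proof (intro ballI allI impI)
        fix i j assume ij: "i \<in> S" "j < n" "A $$ (i, j) \<noteq> 0"
        then have "i < n" using S(1) by blast
        then show "j \<in> S" using S(3)[of i j] ij aA[of i j] by simp
      qed
      then show ?thesis using conn S by blast
    qed
    fix x :: "nat \<Rightarrow> complex" and c :: int
    assume x: "\<And>i. x i \<in> gauss_ints" "\<exists>i<n. x i \<noteq> 0"
    show "\<not> (\<forall>z t. \<bar>Re (ip z (ap z)) + 2 * Re (t * ip z x) + of_int c * (cmod t)\<^sup>2\<bar> \<le> 2 * (nsq z + (cmod t)\<^sup>2))"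
    proof
      assume bnd: "\<forall>z t. \<bar>Re (ip z (ap z)) + 2 * Re (t * ip z x) + of_int c * (cmod t)\<^sup>2\<bar> \<le> 2 * (nsq z + (cmod t)\<^sup>2)"
      define b where "b = extend_by n a x (of_int c)"
      have bsym: "b j i = cnj (b i j)" for i j
      proof -
        have h: "a j i = cnj (a i j)" by (rule herm)
        consider "i < n" "j < n" | "i < n" "j = n" | "i = n" "j < n" | "i = n" "j = n" | "i > n" | "j > n" by linarith
        then show ?thesis unfolding b_def
          by cases (simp_all only: extend_by_def h if_True if_False less_irrefl simp_thms, auto)
      qed
      have bout: "b i j = 0" if "\<not> (i < Suc n \<and> j < Suc n)" for i j
        using that by (auto simp: b_def extend_by_def)
      interpret b: hermitian_form "Suc n" b
        by (rule hermitian_form.intro) (rule bout, assumption, rule bsym)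
      define B where "B = mat (Suc n) (Suc n) (\<lambda>(i, j). b i j)"
      have B: "B \<in> carrier_mat (Suc n) (Suc n)" by (simp add: B_def)
      have cB: "cyclotomic B" unfolding B_def
      proof (rule cyclotomic_if_form_bounded[OF b.hermitian_form_axioms])
        show "b i j \<in> gauss_ints" for i j
          using x(1) gA by (auto simp: b_def extend_by_def aA)
        fix v
        have 1: "b.ap v i = ap v i + x i * v n" if "i < n" for i
          using that by (simp add: b.ap_def ap_def) (simp add: b_def extend_by_def)
        have 2: "b.ap v n = ip x v + of_int c * v n"
          by (simp add: b.ap_def ip_def) (simp add: b_def extend_by_def)
        have "b.ip v (b.ap v) = (\<Sum>i<n. cnj (v i) * (ap v i + x i * v n)) + cnj (v n) * (ip x v + of_int c * v n)"
          by (simp add: b.ip_def 1 2)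
        also have "(\<Sum>i<n. cnj (v i) * (ap v i + x i * v n)) = ip v (ap v) + v n * ip v x"
          by (simp add: ip_def algebra_simps sum.distrib sum_distrib_left)
        also have "cnj (v n) * (ip x v + of_int c * v n) = cnj (v n * ip v x) + of_int c * (v n * cnj (v n))"
          by (simp add: ip_cnj algebra_simps)
        finally have "Re (b.ip v (b.ap v)) = Re (ip v (ap v)) + 2 * Re (v n * ip v x) + of_int c * (cmod (v n))\<^sup>2"
          by (simp only: complex_norm_square[symmetric]) simp
        moreover have "b.nsq v = nsq v + (cmod (v n))\<^sup>2" by (simp add: b.nsq_def nsq_def)
        ultimately show "\<bar>Re (b.ip v (b.ap v))\<bar> \<le> 2 * b.nsq v" using bnd[rule_format, of v "v n"] by simp
      qed
      have "indecomposable B"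
      proof (subst indecomposable_iff[OF B])
        show "(B $$ (i, j) = 0) = (B $$ (j, i) = 0)" if "i < Suc n" "j < Suc n" for i j
          using that bsym[of i j] by (simp add: B_def)
        show "0 < Suc n \<and> (\<forall>S. S \<subseteq> {..<Suc n} \<longrightarrow> S \<noteq> {} \<longrightarrow>
          (\<forall>i\<in>S. \<forall>j<Suc n. B $$ (i, j) \<noteq> 0 \<longrightarrow> j \<in> S) \<longrightarrow> S = {..<Suc n})"
        proof (intro conjI allI impI)
          fix S assume S: "S \<subseteq> {..<Suc n}" "S \<noteq> {}" "\<forall>i\<in>S. \<forall>j<Suc n. B $$ (i, j) \<noteq> 0 \<longrightarrow> j \<in> S"
          then have cl: "j \<in> S" if "i \<in> S" "j < Suc n" "b i j \<noteq> 0" for i j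
            using that by (force simp: B_def)
          obtain i0 where i0: "i0 < n" "x i0 \<noteq> 0" using x(2) by blast
          have ne: "S \<inter> {..<n} \<noteq> {}"
          proof (cases "n \<in> S")
            case True
            then have "i0 \<in> S" using cl[of n i0] i0 by (simp add: b_def extend_by_def)
            then show ?thesis using i0 by blast
          next
            case False
            obtain v where v: "v \<in> S" using S(2) by blast
            then have "v < Suc n" "v \<noteq> n" using S(1) False by auto
            then show ?thesis using v by auto
          qed
          have cl': "\<forall>i\<in>S \<inter> {..<n}. \<forall>j<n. A $$ (i, j) \<noteq> 0 \<longrightarrow> j \<in> S \<inter> {..<n}"
          proof (intro ballI allI impI)
            fix i j assume "i \<in> S \<inter> {..<n}" "j < n" "A $$ (i, j) \<noteq> 0"
            then show "j \<in> S \<inter> {..<n}" using cl[of i j] by (simp add: b_def extend_by_def aA)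
          qed
          have "S \<inter> {..<n} = {..<n}"
            by (rule conn[THEN conjunct2, rule_format]) (use ne cl' in auto)
          then have sub: "{..<n} \<subseteq> S" by blast
          then have "i0 \<in> S" using i0 by blast
          then have "n \<in> S" using cl[of i0 n] i0 by (simp add: b_def extend_by_def)
          then show "S = {..<Suc n}" using S(1) sub unfolding lessThan_Suc by blast
        qed simp
      qed
      moreover have "A = submatrix B {0..<n} {0..<n}"
      proof (rule eq_matI)
        have c: "card {i. i < Suc n \<and> i \<in> {0..<n}} = n"
        proof -
          have "{i. i < Suc n \<and> i \<in> {0..<n}} = {0..<n}" by auto
          then show ?thesis by simp
        qed
        show dims: "dim_row A = dim_row (submatrix B {0..<n} {0..<n})" "dim_col A = dim_col (submatrix B {0..<n} {0..<n})"
          using A B c by (auto simp: dim_submatrix)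
        have pick: "pick {0..<n} i = i" if "i < n" for i
        proof -
          have "{k \<in> {0..<n}. k < i} = {0..<i}" using that by auto
          then show ?thesis using pick_card_in_set[of i "{0..<n}"] that by simp
        qed
        fix i j assume "i < dim_row (submatrix B {0..<n} {0..<n})" "j < dim_col (submatrix B {0..<n} {0..<n})"
        then have ij: "i < n" "j < n" using B c by (auto simp: dim_submatrix)
        show "A $$ (i, j) = submatrix B {0..<n} {0..<n} $$ (i, j)"
          using ij B c by (subst submatrix_index) (auto simp: pick B_def b_def extend_by_def aA)
      qed
      moreover have "{0..<n} \<subset> {0..<dim_row B}" using B by auto
      ultimately show False using assms cB unfolding maximal_indecomposable_cyclotomic_def by blast
    qed
  qed
  then show ?thesis by (simp add: n_def a_def)
qed

section \<open>Recognising the listed graphs\<close>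

definition unit :: "complex \<Rightarrow> bool" where "unit z \<longleftrightarrow> z \<in> gauss_ints \<and> z * cnj z = 1"

lemma unit_simps [simp]: "unit 1" "unit (-1)" "unit \<i>" "unit (- z) = unit z" "unit (cnj z) = unit z"
  by (auto simp: unit_def mult.commute)

lemma unit_mult: "unit x \<Longrightarrow> unit y \<Longrightarrow> unit (x * y)"
  by (simp add: unit_def gauss_ints_closed) (metis (no_types, opaque_lifting) mult.assoc mult.left_commute mult_1)

lemma unit_cnj: "unit z \<Longrightarrow> z * cnj z = 1" "unit z \<Longrightarrow> cnj z * z = 1"
  by (auto simp: unit_def mult.commute)

lemma unit_conj:
  assumes "unit p" "unit q"
  shows "cnj p * (p * x * cnj q) * q = x"
proof -
  have "cnj p * (p * x * cnj q) * q = (cnj p * p) * x * (cnj q * q)" by (simp add: mult_ac)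
  then show ?thesis using assms by (simp add: unit_cnj)
qed

definition realizes :: "nat \<Rightarrow> (nat \<Rightarrow> nat \<Rightarrow> complex) \<Rightarrow> 'v wgraph \<Rightarrow> bool" where
  "realizes n a G \<longleftrightarrow> (\<exists>g u s \<sigma>. bij_betw g (set (fst G)) {..<n} \<and> (\<forall>p. unit (u p)) \<and> s \<in> {1, -1} \<and> \<sigma> \<in> {id, cnj} \<and>
     (\<forall>p\<in>set (fst G). \<forall>q\<in>set (fst G). a (g p) (g q) = s * \<sigma> (u p * weight (snd G) p q * cnj (u q))))"

lemma realizesI:
  assumes "bij_betw g (set (fst G)) {..<n}" "\<And>p. unit (u p)"
    "\<And>p q. p \<in> set (fst G) \<Longrightarrow> q \<in> set (fst G) \<Longrightarrow> a (g p) (g q) = u p * weight (snd G) p q * cnj (u q)"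
  shows "realizes n a G"
  unfolding realizes_def
  by (rule exI[of _ g], rule exI[of _ u], rule exI[of _ 1], rule exI[of _ id]) (use assms in simp)

lemma realizes_switch:
  assumes "realizes n (\<lambda>i j. v i * a i j * cnj (v j)) G" and v: "\<And>i. unit (v i)"
  shows "realizes n a G"
proof -
  obtain g u s \<sigma> where *: "bij_betw g (set (fst G)) {..<n}" "\<forall>p. unit (u p)" "s \<in> {1, -1}" "\<sigma> \<in> {id, cnj}"
     "\<forall>p\<in>set (fst G). \<forall>q\<in>set (fst G). v (g p) * a (g p) (g q) * cnj (v (g q)) = s * \<sigma> (u p * weight (snd G) p q * cnj (u q))"
    using assms(1) unfolding realizes_def by metis
  have "a (g p) (g q) = s * \<sigma> ((\<sigma> (cnj (v (g p))) * u p) * weight (snd G) p q * cnj (\<sigma> (cnj (v (g q))) * u q))"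
    if "p \<in> set (fst G)" "q \<in> set (fst G)" for p q
  proof -
    have "a (g p) (g q) = cnj (v (g p)) * (v (g p) * a (g p) (g q) * cnj (v (g q))) * v (g q)"
      by (simp add: unit_conj v)
    also have "v (g p) * a (g p) (g q) * cnj (v (g q)) = s * \<sigma> (u p * weight (snd G) p q * cnj (u q))"
      using * that by blast
    finally show ?thesis using *(4) by (auto simp: mult_ac)
  qed
  moreover have "\<forall>p. unit (\<sigma> (cnj (v (g p))) * u p)" using * v by (auto intro!: unit_mult)
  ultimately show ?thesis unfolding realizes_def using *(1,3,4) by (intro exI[of _ g] exI[of _ "\<lambda>p. \<sigma> (cnj (v (g p))) * u p"] exI[of _ s] exI[of _ \<sigma>]) blast
qed

lemma realizes_uminus:
  assumes "realizes n (\<lambda>i j. - a i j) G"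
  shows "realizes n a G"
proof -
  obtain g u s \<sigma> where *: "bij_betw g (set (fst G)) {..<n}" "\<forall>p. unit (u p)" "s \<in> {1, -1}" "\<sigma> \<in> {id, cnj}"
     "\<forall>p\<in>set (fst G). \<forall>q\<in>set (fst G). - a (g p) (g q) = s * \<sigma> (u p * weight (snd G) p q * cnj (u q))"
    using assms(1) unfolding realizes_def by metis
  have "a (g p) (g q) = (- s) * \<sigma> (u p * weight (snd G) p q * cnj (u q))" if "p \<in> set (fst G)" "q \<in> set (fst G)" for p q
    using *(5) that by (metis mult_minus_left minus_minus)
  moreover have "- s \<in> {1, -1}" using *(3) by auto
  ultimately show ?thesis unfolding realizes_def using *(1,2,4)
    by (intro exI[of _ g] exI[of _ u] exI[of _ "- s"] exI[of _ \<sigma>]) blast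
qed

lemma realizes_cnj:
  assumes "realizes n (\<lambda>i j. cnj (a i j)) G"
  shows "realizes n a G"
proof -
  obtain g u s \<sigma> where *: "bij_betw g (set (fst G)) {..<n}" "\<forall>p. unit (u p)" "s \<in> {1, -1}" "\<sigma> \<in> {id, cnj}"
     "\<forall>p\<in>set (fst G). \<forall>q\<in>set (fst G). cnj (a (g p) (g q)) = s * \<sigma> (u p * weight (snd G) p q * cnj (u q))"
    using assms(1) unfolding realizes_def by metis
  define \<tau> where "\<tau> = (if \<sigma> = id then cnj else id)"
  have tau: "\<tau> z = cnj (\<sigma> z)" for z using *(4) by (auto simp: \<tau>_def)
  have "a (g p) (g q) = s * \<tau> (u p * weight (snd G) p q * cnj (u q))" if "p \<in> set (fst G)" "q \<in> set (fst G)" for p q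
  proof -
    have "a (g p) (g q) = cnj (s * \<sigma> (u p * weight (snd G) p q * cnj (u q)))"
      using *(5) that by (metis complex_cnj_cnj)
    then show ?thesis using *(3) by (auto simp: tau)
  qed
  moreover have "\<tau> \<in> {id, cnj}" by (simp add: \<tau>_def)
  ultimately show ?thesis unfolding realizes_def using *(1-3)
    by (intro exI[of _ g] exI[of _ u] exI[of _ s] exI[of _ \<tau>]) blast
qed

lemma equivalent_if_realizes:
  assumes A: "A \<in> gauss_mats n" and r: "realizes n (entries A) G" and d: "distinct (fst G)"
  shows "equivalent_mats A (adjacency_mat G)"
proof -
  obtain vs w where G: "G = (vs, w)" by (cases G)
  have dA: "dim_row A = n" using A by (auto simp: gauss_mats_iff)
  obtain g u s \<sigma> where *: "bij_betw g (set vs) {..<n}" "\<forall>p. unit (u p)" "s \<in> {1, -1}" "\<sigma> \<in> {id, cnj}"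
     "\<forall>p\<in>set vs. \<forall>q\<in>set vs. entries A (g p) (g q) = s * \<sigma> (u p * weight w p q * cnj (u q))"
    using r unfolding realizes_def G fst_conv snd_conv by blast
  have len: "length vs = n" using bij_betw_same_card[OF *(1)] d by (simp add: G distinct_card)
  define h where "h k = g (vs ! k)" for k
  define t where "t k = u (vs ! k)" for k
  define B where "B = adjacency_mat G"
  have B: "B \<in> carrier_mat n n" "\<And>k l. k < n \<Longrightarrow> l < n \<Longrightarrow> B $$ (k, l) = weight w (vs ! k) (vs ! l)"
    by (auto simp: B_def G len)
  have hb: "bij_betw h {..<n} {..<n}"
  proof -
    have "bij_betw ((!) vs) {..<n} (set vs)"
      using bij_betw_nth[OF d] by (simp add: G len)
    then show ?thesis unfolding h_def using bij_betw_trans[OF _ *(1)] by (force simp: o_def)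
  qed
  have hinj: "h k = h l \<longleftrightarrow> k = l" if "k < n" "l < n" for k l
    using hb that by (auto simp: bij_betw_def inj_on_def)
  have hless: "h k < n" if "k < n" for k using hb that by (auto simp: bij_betw_def)
  have hex: "\<exists>k<n. x = h k" if "x < n" for x using hb that by (auto simp: bij_betw_def)
  have t: "unit (t k)" for k using * by (simp add: t_def)
  have ent: "A $$ (h k, h l) = s * \<sigma> (t k * weight w (vs ! k) (vs ! l) * cnj (t l))" if "k < n" "l < n" for k l
  proof -
    have "vs ! k \<in> set vs" "vs ! l \<in> set vs" using that len by simp_all
    then have "entries A (h k) (h l) = s * \<sigma> (t k * weight w (vs ! k) (vs ! l) * cnj (t l))"
      using *(5) by (simp add: h_def t_def)
    then show ?thesis using hless that by (simp add: entries_def dA)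
  qed
  define Q where "Q = mat n n (\<lambda>(x, k). if x = h k then t k else 0)"
  have Q: "Q \<in> carrier_mat n n" by (simp add: Q_def)
  have Qi: "Q $$ (h k, l) = (if l = k then t k else 0)" if "k < n" "l < n" for k l
    using that by (auto simp: Q_def hinj hless)
  have Qa: "mat_adjoint Q \<in> carrier_mat n n" by (rule adjoint_carrier[OF Q])
  have Qai: "mat_adjoint Q $$ (l, h k) = (if l = k then cnj (t k) else 0)" if "k < n" "l < n" for k l
    using that by (simp add: adjoint_index[OF Q] hless Qi)
  have prod: "(Q * M) $$ (h k, y) = t k * M $$ (k, y)" if "M \<in> carrier_mat n n" "k < n" "y < n" for M k y
  proof -
    have "(Q * M) $$ (h k, y) = (\<Sum>l<n. Q $$ (h k, l) * M $$ (l, y))"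
      using that Q hless by (simp add: scalar_prod_def atLeast0LessThan)
    also have "\<dots> = (\<Sum>l<n. if l = k then t k * M $$ (k, y) else 0)"
      using that by (intro sum.cong) (auto simp: Qi)
    finally show ?thesis using that by simp
  qed
  have prod': "(M * mat_adjoint Q) $$ (x, h k) = M $$ (x, k) * cnj (t k)" if "M \<in> carrier_mat n n" "k < n" "x < n" for M k x
  proof -
    have "(M * mat_adjoint Q) $$ (x, h k) = (\<Sum>l<n. M $$ (x, l) * mat_adjoint Q $$ (l, h k))"
      using that Qa hless by (simp add: scalar_prod_def atLeast0LessThan)
    also have "\<dots> = (\<Sum>l<n. if l = k then M $$ (x, k) * cnj (t k) else 0)"
      using that by (intro sum.cong) (auto simp: Qai)
    finally show ?thesis using that by simp
  qed
  have QQ: "Q * mat_adjoint Q = 1\<^sub>m n"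
  proof (rule eq_matI)
    fix x y assume "x < dim_row (1\<^sub>m n :: complex mat)" "y < dim_col (1\<^sub>m n :: complex mat)"
    then obtain k l where kl: "k < n" "l < n" "x = h k" "y = h l" using hex[of x] hex[of y] by auto
    have "(Q * mat_adjoint Q) $$ (h k, h l) = t k * mat_adjoint Q $$ (k, h l)"
      by (rule prod[OF Qa kl(1) hless[OF kl(2)]])
    then have "(Q * mat_adjoint Q) $$ (h k, h l) = (if k = l then 1 else 0)"
      using kl by (simp add: Qai unit_cnj(1)[OF t])
    then show "(Q * mat_adjoint Q) $$ (x, y) = 1\<^sub>m n $$ (x, y)"
      using kl hless by (simp add: hinj)
  qed (use Q Qa in auto)
  have QQ': "mat_adjoint Q * Q = 1\<^sub>m n"
    using mat_mult_left_right_inverse[OF Q Qa QQ] .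
  have Qg: "Q \<in> gauss_mats n"
    using t by (auto simp: gauss_mats_iff Q_def unit_def)
  have entry: "A $$ (x, y) = (s \<cdot>\<^sub>m map_mat \<sigma> (Q * B * mat_adjoint Q)) $$ (x, y)" if xy: "x < n" "y < n" for x y
  proof -
    obtain k l where kl: "k < n" "l < n" "x = h k" "y = h l" using hex xy by metis
    have "(Q * B * mat_adjoint Q) $$ (h k, h l) = (Q * B) $$ (h k, l) * cnj (t l)"
      by (rule prod') (use Q B kl hless in auto)
    also have "(Q * B) $$ (h k, l) = t k * B $$ (k, l)"
      by (rule prod) (use B kl in auto)
    finally have "(Q * B * mat_adjoint Q) $$ (x, y) = t k * weight w (vs ! k) (vs ! l) * cnj (t l)"
      using kl B by simp
    moreover have "A $$ (x, y) = s * \<sigma> (t k * weight w (vs ! k) (vs ! l) * cnj (t l))"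
      unfolding kl(3,4) by (rule ent[OF kl(1,2)])
    moreover have "dim_row (Q * B * mat_adjoint Q) = n" "dim_col (Q * B * mat_adjoint Q) = n" using Q Qa by auto
    ultimately show ?thesis using xy by simp
  qed
  have AA: "A = s \<cdot>\<^sub>m map_mat \<sigma> (Q * B * mat_adjoint Q)"
    by (rule eq_matI) (use entry A Q Qa in \<open>auto simp: gauss_mats_iff\<close>)
  have Bg: "B \<in> gauss_mats n"
  proof -
    have "B $$ (k, l) \<in> gauss_ints" if kl: "k < n" "l < n" for k l
    proof -
      have "A $$ (h k, h l) = s * \<sigma> (t k * B $$ (k, l) * cnj (t l))"
        using ent[OF kl] B(2)[OF kl] by simp
      then have "\<sigma> (t k * B $$ (k, l) * cnj (t l)) \<in> gauss_ints"
        using A kl hless *(3) by (auto simp: gauss_mats_iff) (metis gauss_ints_uminus_iff)+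
      moreover have "\<sigma> z \<in> gauss_ints \<longleftrightarrow> z \<in> gauss_ints" for z using *(4) by auto
      ultimately have "t k * B $$ (k, l) * cnj (t l) \<in> gauss_ints" by simp
      moreover have "cnj (t k) \<in> gauss_ints" "t l \<in> gauss_ints" using t by (simp_all add: unit_def)
      ultimately have "cnj (t k) * (t k * B $$ (k, l) * cnj (t l)) * t l \<in> gauss_ints"
        using gauss_ints_closed(3) by metis
      moreover have "cnj (t k) * (t k * B $$ (k, l) * cnj (t l)) * t l = B $$ (k, l)"
        by (rule unit_conj[OF t t])
      ultimately show ?thesis by simp
    qed
    then show ?thesis using B by (simp add: gauss_mats_iff)
  qed
  show ?thesis unfolding equivalent_mats_def B_def[symmetric]
    using A Bg Qg QQ QQ' *(3,4) AA by blast
qed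

section \<open>Graphs whose adjacency matrix has square four\<close>

locale regular_graph = gauss_form +
  assumes n_pos: "n > 0"
    and conn: "S \<subseteq> {..<n} \<Longrightarrow> S \<noteq> {} \<Longrightarrow> (\<And>i j. i \<in> S \<Longrightarrow> a i j \<noteq> 0 \<Longrightarrow> j \<in> S) \<Longrightarrow> S = {..<n}"
    and deg4: "i < n \<Longrightarrow> deg i = 4"
    and orth: "i \<noteq> j \<Longrightarrow> sq i j = 0"

lemma (in maximal_graph) regular_if_charged:
  assumes "s < n" "a s s \<noteq> 0"
  shows "regular_graph n a"
proof
  show "deg i = 4" if "i < n" for i by (rule full_degree[OF assms that])
  then show "sq i j = 0" if "i \<noteq> j" for i j
    using full_row[of i j] that outside by (cases "i < n") (auto simp: sq_def)
qed (use n_pos conn in auto)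

definition listed :: "nat \<Rightarrow> (nat \<Rightarrow> nat \<Rightarrow> complex) \<Rightarrow> bool" where
  "listed n a \<longleftrightarrow> (\<exists>k\<ge>2. realizes n a (C_pp k)) \<or> (\<exists>k\<ge>2. realizes n a (C_pm k)) \<or> (\<exists>k\<ge>1. realizes n a (C_odd k)) \<or>
     realizes n a S_1 \<or> realizes n a S_4 \<or> realizes n a S_4_dagger \<or> realizes n a S_7 \<or> realizes n a S_8 \<or> realizes n a S_8'"

lemma listed_mono:
  assumes "\<And>G :: ladder_vertex wgraph. realizes n b G \<Longrightarrow> realizes n a G" "\<And>G :: letter wgraph. realizes n b G \<Longrightarrow> realizes n a G"
    "listed n b"
  shows "listed n a"
  using assms unfolding listed_def by meson

lemma listed_switch: "listed n (\<lambda>i j. v i * a i j * cnj (v j)) \<Longrightarrow> (\<And>i. unit (v i)) \<Longrightarrow> listed n a"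
  by (rule listed_mono[OF realizes_switch realizes_switch])

lemma listed_uminus: "listed n (\<lambda>i j. - a i j) \<Longrightarrow> listed n a"
  by (rule listed_mono[OF realizes_uminus realizes_uminus])

lemma listed_cnj: "listed n (\<lambda>i j. cnj (a i j)) \<Longrightarrow> listed n a"
  by (rule listed_mono[OF realizes_cnj realizes_cnj])

lemma unit_iff_gnorm: "z \<in> gauss_ints \<Longrightarrow> unit z \<longleftrightarrow> gnorm z = 1"
  unfolding unit_def using gnorm_eq_1 by blast

lemma gnorm_unit: "unit z \<Longrightarrow> gnorm z = 1"
  using unit_iff_gnorm unit_def by blast

lemma unit_gauss: "unit z \<Longrightarrow> z \<in> gauss_ints"
  by (simp add: unit_def)

lemma associated_if_same_small_norm:
  assumes z: "z \<in> gauss_ints" and t: "t \<in> gauss_ints" and g: "gnorm z = gnorm t" "gnorm t \<in> {1, 2}"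
  obtains w where "unit w" "z * w = t"
proof -
  have "\<exists>w. unit w \<and> z * w = t"
  proof (cases "gnorm t = 1")
    case True
    then have "unit z" "unit t" using g z t by (auto simp: unit_iff_gnorm)
    then have "unit (cnj z * t)" "z * (cnj z * t) = t"
      by (auto simp: unit_mult unit_cnj simp flip: mult.assoc)
    then show ?thesis by blast
  next
    case False
    then have g2: "gnorm z = 2" "gnorm t = 2" using g by auto
    define w where "w = cnj z * t / 2"
    have zz: "z * cnj z = 2" "t * cnj t = 2"
      using complex_of_nat_gnorm[OF z] complex_of_nat_gnorm[OF t] g2 by simp_all
    have "z \<in> {1 + \<i>, 1 - \<i>, -1 + \<i>, -1 - \<i>}" "t \<in> {1 + \<i>, 1 - \<i>, -1 + \<i>, -1 - \<i>}"
      using gnorm_cases[OF z] gnorm_cases[OF t] g2 by auto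
    then have "w \<in> {1, -1, \<i>, -\<i>}"
      by (elim insertE emptyE; simp add: w_def complex_eq_iff)
    then have "unit w" by auto
    moreover have "z * w = (z * cnj z) * t / 2" by (simp add: w_def)
    then have "z * w = t" by (simp add: zz)
    ultimately show ?thesis by blast
  qed
  then show thesis using that by blast
qed

fun upper_triangle :: "('v \<Rightarrow> 'v \<Rightarrow> bool) \<Rightarrow> 'v list \<Rightarrow> bool" where
  "upper_triangle P [] = True"
| "upper_triangle P (x # xs) = (P x x \<and> (\<forall>y\<in>set xs. P x y) \<and> upper_triangle P xs)"

lemma upper_triangleD: "upper_triangle P xs \<Longrightarrow> p \<in> set xs \<Longrightarrow> q \<in> set xs \<Longrightarrow> P p q \<or> P q p"
  by (induction xs) auto

fun tree_edges :: "(nat \<times> nat \<times> complex) list \<Rightarrow> bool" where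
  "tree_edges [] = True"
| "tree_edges ((p, c, t) # es) = (c \<noteq> p \<and> (\<forall>(p', c', t') \<in> set es. c \<noteq> p' \<and> c \<noteq> c') \<and> tree_edges es)"

context regular_graph
begin

lemma less_n: "a i j \<noteq> 0 \<Longrightarrow> i < n" "a i j \<noteq> 0 \<Longrightarrow> j < n"
  using nonzero_less by blast+

lemma regular_switch:
  assumes u: "\<And>i. unit (u i)"
  shows "regular_graph n (\<lambda>i j. u i * a i j * cnj (u j))"
proof -
  define b where "b i j = u i * a i j * cnj (u j)" for i j
  have u0: "u i \<noteq> 0" for i using unit_cnj(1)[OF u[of i]] by auto
  have g: "gnorm (b i j) = gnorm (a i j)" for i j
    unfolding b_def using u by (simp add: gnorm_mult gauss unit_gauss gauss_ints_closed gnorm_unit)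
  have b0: "b i j = 0 \<longleftrightarrow> a i j = 0" for i j by (simp add: b_def u0)
  have "regular_graph n b"
  proof unfold_locales
    show "b i j = 0" if "\<not> (i < n \<and> j < n)" for i j using outside[OF that] by (simp add: b_def)
    show "b j i = cnj (b i j)" for i j unfolding b_def using herm[of i j] by simp
    show "b i j \<in> gauss_ints" for i j unfolding b_def using u by (simp add: gauss unit_gauss gauss_ints_closed)
    show "n > 0" by (rule n_pos)
    show "S = {..<n}" if "S \<subseteq> {..<n}" "S \<noteq> {}" "\<And>i j. i \<in> S \<Longrightarrow> b i j \<noteq> 0 \<Longrightarrow> j \<in> S" for S
      using conn[OF that(1,2)] that(3) by (simp add: b0)
  next
    have H: "gauss_form n b"
    proof unfold_locales
      show "b i j = 0" if "\<not> (i < n \<and> j < n)" for i j using outside[OF that] by (simp add: b_def)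
      show "b j i = cnj (b i j)" for i j unfolding b_def using herm[of i j] by simp
      show "b i j \<in> gauss_ints" for i j unfolding b_def using u by (simp add: gauss unit_gauss gauss_ints_closed)
    qed
    interpret b: gauss_form n b by (rule H)
    show "b.deg i = 4" if "i < n" for i
      using deg4[OF that] by (simp add: b.deg_def deg_def g)
    have "b.sq i j = u i * sq i j * cnj (u j)" for i j
    proof -
      have "b i k * b k j = u i * (a i k * a k j) * cnj (u j)" for k
      proof -
        have "b i k * b k j = u i * (a i k * a k j) * cnj (u j) * (cnj (u k) * u k)"
          by (simp add: b_def mult_ac)
        then show ?thesis by (simp only: unit_cnj(2)[OF u] mult_1_right)
      qed
      then show ?thesis by (simp add: b.sq_def sq_def sum_distrib_left sum_distrib_right)
    qed
    then show "b.sq i j = 0" if "i \<noteq> j" for i j using orth[OF that] by simp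
  qed
  then show ?thesis by (simp add: b_def[abs_def])
qed

lemma regular_uminus: "regular_graph n (\<lambda>i j. - a i j)"
proof -
  have H: "gauss_form n (\<lambda>i j. - a i j)"
  proof unfold_locales
    show "- a j i = cnj (- a i j)" for i j using herm[of i j] by simp
  qed (simp_all add: outside gauss)
  interpret b: gauss_form n "\<lambda>i j. - a i j" by (rule H)
  have d: "b.deg i = deg i" for i by (simp add: b.deg_def deg_def)
  have s: "b.sq i j = sq i j" for i j by (simp add: b.sq_def sq_def)
  show ?thesis
  proof unfold_locales
    show "S = {..<n}" if "S \<subseteq> {..<n}" "S \<noteq> {}" "\<And>i j. i \<in> S \<Longrightarrow> - a i j \<noteq> 0 \<Longrightarrow> j \<in> S" for S
      using conn[OF that(1,2)] that(3) by simp
  qed (simp_all add: n_pos d s deg4 orth)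
qed

lemma regular_cnj: "regular_graph n (\<lambda>i j. cnj (a i j))"
proof -
  have H: "gauss_form n (\<lambda>i j. cnj (a i j))"
  proof unfold_locales
    show "cnj (a j i) = cnj (cnj (a i j))" for i j using herm[of i j] by simp
  qed (simp_all add: outside gauss)
  interpret b: gauss_form n "\<lambda>i j. cnj (a i j)" by (rule H)
  have d: "b.deg i = deg i" for i by (simp add: b.deg_def deg_def)
  have s: "b.sq i j = cnj (sq i j)" for i j by (simp add: b.sq_def sq_def)
  show ?thesis
  proof unfold_locales
    show "S = {..<n}" if "S \<subseteq> {..<n}" "S \<noteq> {}" "\<And>i j. i \<in> S \<Longrightarrow> cnj (a i j) \<noteq> 0 \<Longrightarrow> j \<in> S" for S
      using conn[OF that(1,2)] that(3) by simp
  qed (simp_all add: n_pos d s deg4 orth)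
qed

lemma normalizing_units:
  assumes "tree_edges es"
    and "\<And>p c t. (p, c, t) \<in> set es \<Longrightarrow> t \<in> gauss_ints \<and> gnorm t \<in> {1, 2} \<and> gnorm (a p c) = gnorm t"
  shows "\<exists>u. (\<forall>i. unit (u i)) \<and> (\<forall>(p, c, t)\<in>set es. u p * a p c * cnj (u c) = t) \<and>
    (\<forall>i. i \<notin> fst ` snd ` set es \<longrightarrow> u i = 1)"
  using assms
proof (induction es rule: tree_edges.induct)
  case 1
  show ?case by (intro exI[of _ "\<lambda>_. 1"]) simp
next
  case (2 p c t es)
  have "\<exists>u. (\<forall>i. unit (u i)) \<and> (\<forall>(p, c, t)\<in>set es. u p * a p c * cnj (u c) = t) \<and>
    (\<forall>i. i \<notin> fst ` snd ` set es \<longrightarrow> u i = 1)"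
  proof (rule 2(1))
    show "tree_edges es" using 2(2) by simp
    show "t' \<in> gauss_ints \<and> gnorm t' \<in> {1, 2} \<and> gnorm (a p' c') = gnorm t'" if "(p', c', t') \<in> set es" for p' c' t'
      using 2(3)[of p' c' t'] that by simp
  qed
  then obtain u where u: "\<And>i. unit (u i)" "\<forall>(p, c, t)\<in>set es. u p * a p c * cnj (u c) = t"
    "\<forall>i. i \<notin> fst ` snd ` set es \<longrightarrow> u i = 1" by blast
  have t: "t \<in> gauss_ints" "gnorm t \<in> {1, 2}" "gnorm (a p c) = gnorm t" using 2(3)[of p c t] by auto
  have "u p * a p c \<in> gauss_ints" "gnorm (u p * a p c) = gnorm t"
    using u(1)[of p] t gauss by (auto simp: unit_gauss gauss_ints_closed gnorm_mult gnorm_unit)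
  then obtain w where w: "unit w" "u p * a p c * w = t"
    using associated_if_same_small_norm t(1,2) by metis
  show ?case
  proof (intro exI[of _ "u(c := cnj w)"] conjI allI)
    show "unit ((u(c := cnj w)) i)" for i using u(1) w by simp
    show "\<forall>(p', c', t')\<in>set ((p, c, t) # es). (u(c := cnj w)) p' * a p' c' * cnj ((u(c := cnj w)) c') = t'"
      using u(2) w 2(2) by (fastforce split: prod.splits)
    show "i \<notin> fst ` snd ` set ((p, c, t) # es) \<longrightarrow> (u(c := cnj w)) i = 1" for i
      using u(3) by auto
  qed
qed

lemma normalization:
  assumes "tree_edges es"
    and "\<And>p c t. (p, c, t) \<in> set es \<Longrightarrow> t \<in> gauss_ints \<and> gnorm t \<in> {1, 2} \<and> gnorm (a p c) = gnorm t"
  obtains b where "regular_graph n b" "\<And>i j. gnorm (b i j) = gnorm (a i j)" "\<And>i j. b i j = 0 \<longleftrightarrow> a i j = 0"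
    "\<And>i. b i i = a i i" "\<And>i j k. b i j * b j k * b k i = a i j * a j k * a k i"
    "\<And>p c t. (p, c, t) \<in> set es \<Longrightarrow> b p c = t"
    "\<And>i j. i \<notin> fst ` snd ` set es \<Longrightarrow> j \<notin> fst ` snd ` set es \<Longrightarrow> b i j = a i j"
    "listed n b \<Longrightarrow> listed n a"
proof -
  obtain u where u: "\<And>i. unit (u i)" "\<forall>(p, c, t)\<in>set es. u p * a p c * cnj (u c) = t"
    "\<And>i. i \<notin> fst ` snd ` set es \<Longrightarrow> u i = 1"
    using normalizing_units[OF assms] by blast
  define b where "b i j = u i * a i j * cnj (u j)" for i j
  have u0: "u i \<noteq> 0" for i using unit_cnj(1)[OF u(1)[of i]] by auto
  show thesis
  proof (rule that)
    show "regular_graph n b" unfolding b_def[abs_def] by (rule regular_switch[OF u(1)])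
    show "gnorm (b i j) = gnorm (a i j)" for i j
      unfolding b_def using u(1) by (simp add: gnorm_mult gauss unit_gauss gauss_ints_closed gnorm_unit)
    show "b i j = 0 \<longleftrightarrow> a i j = 0" for i j by (simp add: b_def u0)
    show "b i i = a i i" for i
    proof -
      have "b i i = a i i * (u i * cnj (u i))" by (simp add: b_def mult_ac)
      then show ?thesis by (simp only: unit_cnj(1)[OF u(1)] mult_1_right)
    qed
    show "b i j * b j k * b k i = a i j * a j k * a k i" for i j k
    proof -
      have "b i j * b j k * b k i = a i j * a j k * a k i * (u i * cnj (u i)) * (u j * cnj (u j)) * (u k * cnj (u k))"
        by (simp add: b_def mult_ac)
      then show ?thesis by (simp only: unit_cnj(1)[OF u(1)] mult_1_right)
    qed
    show "b p c = t" if "(p, c, t) \<in> set es" for p c t using u(2) that by (auto simp: b_def)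
    show "b i j = a i j" if "i \<notin> fst ` snd ` set es" "j \<notin> fst ` snd ` set es" for i j
      using u(3) that by (simp add: b_def)
    show "listed n a" if "listed n b"
      using listed_switch[OF that[unfolded b_def[abs_def]]] u(1) by blast
  qed
qed

lemma wlog_normalized:
  assumes "tree_edges es"
    and "\<And>p c t. (p, c, t) \<in> set es \<Longrightarrow> t \<in> gauss_ints \<and> gnorm t \<in> {1, 2} \<and> gnorm (a p c) = gnorm t"
    and step: "\<And>b. regular_graph n b \<Longrightarrow> (\<And>i j. gnorm (b i j) = gnorm (a i j)) \<Longrightarrow> (\<And>i j. b i j = 0 \<longleftrightarrow> a i j = 0) \<Longrightarrow>
      (\<And>i. b i i = a i i) \<Longrightarrow> (\<And>i j k. b i j * b j k * b k i = a i j * a j k * a k i) \<Longrightarrow>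
      (\<And>p c t. (p, c, t) \<in> set es \<Longrightarrow> b p c = t) \<Longrightarrow> listed n b"
  shows "listed n a"
proof (rule normalization[OF assms(1,2)])
  fix b assume b: "regular_graph n b" "\<And>i j. gnorm (b i j) = gnorm (a i j)" "\<And>i j. b i j = 0 \<longleftrightarrow> a i j = 0"
    "\<And>i. b i i = a i i" "\<And>i j k. b i j * b j k * b k i = a i j * a j k * a k i"
    "\<And>p c t. (p, c, t) \<in> set es \<Longrightarrow> b p c = t" "listed n b \<Longrightarrow> listed n a"
  show ?thesis by (rule b(7), rule step) (fact b)+
qed

lemma realizes_by_upper_triangle:
  assumes g: "bij_betw g (set (fst G)) {..<n}"
    and W: "\<And>p q. weight (snd G) q p = cnj (weight (snd G) p q)"
    and upper: "upper_triangle (\<lambda>p q. a (g p) (g q) = weight (snd G) p q) (fst G)"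
  shows "realizes n a G"
proof (rule realizesI[of g _ _ "\<lambda>_. 1"])
  fix p q assume "p \<in> set (fst G)" "q \<in> set (fst G)"
  then have "a (g p) (g q) = weight (snd G) p q \<or> a (g q) (g p) = weight (snd G) q p"
    by (rule upper_triangleD[OF upper])
  then have "a (g p) (g q) = weight (snd G) p q"
    using herm[of "g p" "g q"] W[of p q] by (metis complex_cnj_cnj)
  then show "a (g p) (g q) = 1 * weight (snd G) p q * cnj 1" by simp
qed (use g in auto)

end

lemma weight_S_hermitian:
  "weight (snd S_4) q p = cnj (weight (snd S_4) p q)"
  "weight (snd S_4_dagger) q p = cnj (weight (snd S_4_dagger) p q)"
  "weight (snd S_7) q p = cnj (weight (snd S_7) p q)"
  "weight (snd S_8) q p = cnj (weight (snd S_8) p q)"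
  "weight (snd S_8') q p = cnj (weight (snd S_8') p q)"
  by (cases p; cases q; simp add: weight_def S_4_def S_4_dagger_def S_7_def S_8_def S_8'_def)+

section \<open>The neighbourhood of a charged vertex\<close>

lemma ladder_vertices_small:
  "ladder_vertices (Suc 0) = [Top 1, Bot 1]" "ladder_vertices 2 = [Top 1, Bot 1, Top 2, Bot 2]"
  by (simp_all add: ladder_vertices_def numeral_2_eq_2)

context regular_graph
begin

lemma S_1_if_isolated:
  assumes v: "v < n" "\<And>m. m \<noteq> v \<Longrightarrow> a v m = 0"
  shows "realizes n a S_1"
proof -
  have V: "{v} = {..<n}" by (rule conn) (use v in auto)
  have "deg v = gnorm (a v v)" unfolding deg_def V[symmetric] by simp
  then have g: "gnorm (a v v) = 4" using deg4[OF v(1)] by simp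
  have "(cmod (a v v))\<^sup>2 = 4" using of_nat_gnorm[OF gauss[of v v]] g by simp
  then have "(Re (a v v))\<^sup>2 = 2\<^sup>2" using diag_real[of v] by (simp add: cmod_power2)
  then have "Re (a v v) = 2 \<or> Re (a v v) = - 2" by (simp only: power2_eq_iff)
  then have vv: "a v v = 2 \<or> a v v = - 2" using diag_real[of v] by (auto simp: complex_eq_iff)
  have W: "weight (snd S_1) Va Va = 2" by (simp add: S_1_def weight_def)
  have b: "bij_betw (\<lambda>_. v) (set (fst S_1)) {..<n}" by (simp add: S_1_def V[symmetric])
  show ?thesis unfolding realizes_def
    by (rule exI[of _ "\<lambda>_. v"], rule exI[of _ "\<lambda>_. 1"], rule exI[of _ "a v v / 2"], rule exI[of _ id])
      (use vv b W in \<open>auto simp: S_1_def\<close>)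
qed

lemma C_odd_1_final:
  assumes V: "{..<n} = {v, d, b}" "distinct [v, d, b]" and ch: "a v v = 1" "a d d = 1" "a b b = 0"
    and t: "a v b = 1 + \<i>" "a v d = -1"
  shows "listed n a"
proof -
  have "sq v b = a v v * a v b + a v d * a d b + a v b * a b b"
    unfolding sq_def V(1) using V(2) by simp
  then have db: "a d b = 1 + \<i>" using orth[of v b] V(2) ch t by (simp add: add_eq_0_iff)
  have low: "a b d = 1 - \<i>" "a b v = 1 - \<i>" "a d v = -1"
    using herm[of b d] herm[of b v] herm[of d v] db t by (simp_all add: complex_eq_iff)
  define g where "g p = (case p of Top j \<Rightarrow> v | Bot j \<Rightarrow> d | Apex \<Rightarrow> b)" for p
  have S: "fst (C_odd 1) = [Top 1, Bot 1, Apex]" by (simp add: C_odd_def ladder_vertices_small)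
  have "realizes n a (C_odd 1)"
  proof (rule realizesI[of g _ _ "\<lambda>_. 1"])
    show "bij_betw g (set (fst (C_odd 1))) {..<n}"
      unfolding S V(1) using V(2) by (auto simp: bij_betw_def g_def)
    fix p q assume "p \<in> set (fst (C_odd 1))" "q \<in> set (fst (C_odd 1))"
    then have "p = Top 1 \<or> p = Bot 1 \<or> p = Apex" "q = Top 1 \<or> q = Bot 1 \<or> q = Apex" unfolding S by auto
    then show "a (g p) (g q) = 1 * weight (snd (C_odd 1)) p q * cnj 1"
      by (elim disjE; simp add: g_def C_odd_def weight_def ch t low db complex_eq_iff)
  qed simp
  then show ?thesis unfolding listed_def by blast
qed

lemma S_4_final:
  assumes V: "{..<n} = {v, d, b, e}" "distinct [v, d, b, e]"
    and ch: "a v v = 1" "a d d = -1" "a b b = -1" "a e e = 1"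
    and z: "a v e = 0" "a d b = 0"
    and t: "a v d = 1" "a v b = -1 - \<i>" "a d e = 1 + \<i>"
  shows "listed n a"
proof -
  have "sq v e = a v v * a v e + a v d * a d e + a v b * a b e + a v e * a e e"
    unfolding sq_def V(1) using V(2) by simp
  then have "(-1 - \<i>) * (a b e - 1) = 0" using orth[of v e] V(2) ch z t by (simp add: algebra_simps)
  moreover have "(-1 - \<i>) \<noteq> 0" by (simp add: complex_eq_iff)
  ultimately have be: "a b e = 1" by simp
  define g where "g p = (case p of Va \<Rightarrow> v | Vb \<Rightarrow> d | Vc \<Rightarrow> b | _ \<Rightarrow> e)" for p
  have S: "fst S_4 = [Va, Vb, Vc, Vd]" by (simp add: S_4_def)
  have "realizes n a S_4"
  proof (rule realizes_by_upper_triangle[OF _ weight_S_hermitian(1)])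
    show "bij_betw g (set (fst S_4)) {..<n}"
      unfolding S V(1) using V(2) by (auto simp: bij_betw_def g_def)
    show "upper_triangle (\<lambda>p q. a (g p) (g q) = weight (snd S_4) p q) (fst S_4)"
      unfolding S by (simp add: g_def S_4_def weight_def ch z t be)
  qed
  then show ?thesis unfolding listed_def by blast
qed

lemma listed_if_norm_two_neighbour:
  assumes v: "a v v = 1" "gnorm (a v b) = 2"
  shows "listed n a"
proof -
  have g1: "gnorm (1 :: complex) = 1" "gnorm (-1 :: complex) = 1" by (simp_all add: gnorm_unit)
  have vb: "a v b \<noteq> 0" "b \<noteq> v" using v g1 by auto
  have less: "v < n" "b < n" using less_n[OF vb(1)] by auto
  have deg: "(\<Sum>k\<in>S. gnorm (a i k)) \<le> 4" if "finite S" "i < n" for S i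
    using deg_ge[OF that(1), of i] deg4[OF that(2)] by simp
  obtain d where d: "d \<notin> {v, b}" "a v d \<noteq> 0" "d < n"
    using pick_nbr[of "{v, b}" v] deg4[OF less(1)] v vb g1 by auto
  have gd: "gnorm (a v d) = 1" using deg[of "{v, b, d}" v] less v vb d g1 gnorm_pos[OF d(2)] by simp
  have vsupp: "a v m = 0" if "m \<notin> {v, b, d}" for m
    by (rule row_supp[of "{v, b, d}"]) (use deg4[OF less(1)] v vb d gd g1 that in auto)
  have row: "sq v j = a v v * a v j + a v b * a b j + a v d * a d j" for j
    using sq_row3[of v b d v j] vsupp vb d by auto
  have e1: "a v b * (1 + a b b) = - (a v d * a d b)"
    using row[of b] orth[of v b] vb v by (simp add: algebra_simps eq_neg_iff_add_eq_0)
  have e2: "a v d * (1 + a d d) = - (a v b * a b d)"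
    using row[of d] orth[of v d] d v by (simp add: algebra_simps eq_neg_iff_add_eq_0)
  have gbv: "gnorm (a b v) = 2" "gnorm (a d v) = 1" using v gd gnorm_sym by metis+
  have G: "1 + a b b \<in> gauss_ints" "1 + a d d \<in> gauss_ints" by (auto simp: gauss)
  show ?thesis
  proof (cases "a b d = 0")
    case False
    have "gnorm (a v b * (1 + a b b)) = gnorm (a v d * a d b)" unfolding e1 by simp
    then have n1: "2 * gnorm (1 + a b b) = gnorm (a b d)"
      using v gd gnorm_sym[of d b] G by (simp add: gnorm_mult gauss)
    have "gnorm (a b d) + 2 \<le> 4" using deg[of "{v, d}" b] less d gbv by simp
    then have n2: "gnorm (a b d) = 2" using n1 gnorm_pos[OF False] by presburger
    have bsupp: "a b m = 0" if "m \<notin> {v, d}" for m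
      by (rule row_supp[of "{v, d}"]) (use deg4[OF less(2)] d gbv n2 that in auto)
    have bb: "a b b = 0" using bsupp vb d by auto
    have "gnorm (a v d * (1 + a d d)) = gnorm (a v b * a b d)" unfolding e2 by simp
    then have n3: "gnorm (1 + a d d) = 4" using gd v n2 G by (simp add: gnorm_mult gauss)
    have "gnorm (a d d) + 3 \<le> 4" using deg[of "{v, b, d}" d] vb d gbv n2 gnorm_sym[of d b] by simp
    then have "a d d = 0 \<or> a d d = 1 \<or> a d d = -1" using diag_cases[of d] by auto
    then have dd: "a d d = 1" using n3 g1 by auto
    have dsupp: "a d m = 0" if "m \<notin> {v, b, d}" for m
      by (rule row_supp[of "{v, b, d}"]) (use deg4[OF d(3)] d gbv n2 gnorm_sym[of d b] dd g1 vb that in auto)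
    have "{v, d, b} = {..<n}"
      by (rule conn) (use less d vsupp bsupp dsupp in blast)+
    then have V: "{..<n} = {v, d, b}" "distinct [v, d, b]" using d vb by auto
    show ?thesis
    proof (rule wlog_normalized[of "[(v, b, 1 + \<i>), (v, d, -1)]"])
      show "tree_edges [(v, b, 1 + \<i>), (v, d, - 1)]" using d vb by auto
      have "gnorm (1 + \<i>) = 2" using gnorm_of_ints[of "1 + \<i>" 1 1] by simp
      then show "t \<in> gauss_ints \<and> gnorm t \<in> {1, 2} \<and> gnorm (a p c) = gnorm t"
        if "(p, c, t) \<in> set [(v, b, 1 + \<i>), (v, d, - 1)]" for p c t
        using that v gd g1 by auto
      fix x assume "regular_graph n x" and diag: "\<And>i. x i i = a i i"
        and tree: "\<And>p c t. (p, c, t) \<in> set [(v, b, 1 + \<i>), (v, d, - 1)] \<Longrightarrow> x p c = t"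
      interpret x: regular_graph n x by fact
      show "listed n x"
        by (rule x.C_odd_1_final[OF V]) (use tree in \<open>auto simp: diag v dd bb\<close>)
    qed
  next
    case True
    then have db: "a d b = 0" using nonzero_sym by blast
    have bb: "a b b = -1" using e1 db vb by (simp add: add_eq_0_iff)
    have dd: "a d d = -1" using e2 True d by (simp add: add_eq_0_iff)
    obtain e where e: "e \<notin> {v, b}" "a b e \<noteq> 0" "e < n"
      using pick_nbr[of "{v, b}" b] deg4[OF less(2)] vb gbv bb g1 by auto
    have ge: "gnorm (a b e) = 1" using deg[of "{v, b, e}" b] less vb e gbv bb g1 gnorm_pos[OF e(2)] by simp
    have ed: "e \<noteq> d" using e True by auto
    have bsupp: "a b m = 0" if "m \<notin> {v, b, e}" for m
      by (rule row_supp[of "{v, b, e}"]) (use deg4[OF less(2)] vb e ge gbv bb g1 that in auto)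
    have ve: "a v e = 0" using vsupp e ed by auto
    have "a v b * a b e + a v d * a d e = 0" using row[of e] orth[of v e] ve e by simp
    then have "a v b * a b e = - (a v d * a d e)" by (simp add: eq_neg_iff_add_eq_0)
    then have "gnorm (a v b * a b e) = gnorm (a v d * a d e)" by simp
    then have de: "gnorm (a d e) = 2" using v ge gd by (simp add: gnorm_mult gauss)
    have dsupp: "a d m = 0" if "m \<notin> {v, d, e}" for m
      by (rule row_supp[of "{v, d, e}"]) (use deg4[OF d(3)] d e ed de gbv dd g1 that in auto)
    have "sq b e = a b v * a v e + a b b * a b e + a b e * a e e"
      using sq_row3[of v b e b e] bsupp vb e by auto
    then have "a b e * (a e e - 1) = 0" using orth[of b e] e ve bb by (simp add: algebra_simps)
    then have ee: "a e e = 1" using e by simp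
    have esupp: "a e m = 0" if "m \<notin> {b, d, e}" for m
      by (rule row_supp[of "{b, d, e}"])
        (use deg4[OF e(3)] d e ed de ge gnorm_sym[of e b] gnorm_sym[of e d] ee g1 that in auto)
    have "{v, d, b, e} = {..<n}"
      by (rule conn) (use less d e vsupp bsupp dsupp esupp in blast)+
    then have V: "{..<n} = {v, d, b, e}" "distinct [v, d, b, e]" using d vb e ed by auto
    let ?T = "[(v, b, -1 - \<i>), (d, e, 1 + \<i>), (v, d, 1)]"
    show ?thesis
    proof (rule wlog_normalized[of ?T])
      show "tree_edges ?T" using d vb e ed by auto
      have "gnorm (1 + \<i>) = 2" "gnorm (-1 - \<i>) = 2"
        using gnorm_of_ints[of "1 + \<i>" 1 1] gnorm_of_ints[of "-1 - \<i>" "-1" "-1"] by simp_all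
      moreover have "-1 - \<i> \<in> gauss_ints" by (simp add: gauss_ints_iff)
      ultimately show "t \<in> gauss_ints \<and> gnorm t \<in> {1, 2} \<and> gnorm (a p c) = gnorm t"
        if "(p, c, t) \<in> set ?T" for p c t
        using that v gd g1 de by auto
      fix x assume "regular_graph n x" and diag: "\<And>i. x i i = a i i" and zero: "\<And>i j. x i j = 0 \<longleftrightarrow> a i j = 0"
        and tree: "\<And>p c t. (p, c, t) \<in> set ?T \<Longrightarrow> x p c = t"
      interpret x: regular_graph n x by fact
      show "listed n x"
        by (rule x.S_4_final[OF V]) (use tree in \<open>auto simp: diag zero v dd bb ee ve db\<close>)
    qed
  qed
qed

end

lemma star_triangle_arith:
  fixes x y z m eb ec ed :: int
  assumes e: "x + z = - (1 + eb)" "x + y = - (1 + ec)" "y + z = - (1 + ed)"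
    and n: "eb\<^sup>2 + (x\<^sup>2 + m\<^sup>2) + (z\<^sup>2 + m\<^sup>2) \<le> 3" "ec\<^sup>2 + (x\<^sup>2 + m\<^sup>2) + (y\<^sup>2 + m\<^sup>2) \<le> 3" "ed\<^sup>2 + (y\<^sup>2 + m\<^sup>2) + (z\<^sup>2 + m\<^sup>2) \<le> 3"
  shows "m = 0 \<and> (x, y, z) \<in> {(-1,-1,-1), (1,-1,-1), (-1,1,-1), (-1,-1,1), (-1,-1,0), (-1,0,-1), (0,-1,-1),
      (-1,0,0), (0,-1,0), (0,0,-1), (0,0,0)} \<or>
    (m = 1 \<or> m = -1) \<and> (x, y, z) \<in> {(0,0,0), (-1,0,0), (0,-1,0), (0,0,-1)}"
proof -
  have small: "t = -1 \<or> t = 0 \<or> t = 1" if "t\<^sup>2 \<le> 3" for t :: int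
  proof -
    have "\<bar>t\<bar> < 2" using int_square_ge_4[of t] that by linarith
    then show ?thesis by arith
  qed
  have sq: "x\<^sup>2 \<ge> 0" "y\<^sup>2 \<ge> 0" "z\<^sup>2 \<ge> 0" "m\<^sup>2 \<ge> 0" "eb\<^sup>2 \<ge> 0" "ec\<^sup>2 \<ge> 0" "ed\<^sup>2 \<ge> 0" by simp_all
  have x: "x = -1 \<or> x = 0 \<or> x = 1" and y: "y = -1 \<or> y = 0 \<or> y = 1" and z: "z = -1 \<or> z = 0 \<or> z = 1"
    and m: "m = -1 \<or> m = 0 \<or> m = 1"
    using n sq by (intro small, linarith)+
  have eb: "eb = - 1 - x - z" and ec: "ec = - 1 - x - y" and ed: "ed = - 1 - y - z" using e by linarith+
  show ?thesis using x y z m n unfolding eb ec ed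
    by (elim disjE) simp_all
qed

context gauss_form
begin

definition star :: "nat \<Rightarrow> nat \<Rightarrow> nat \<Rightarrow> nat \<Rightarrow> bool" where
  "star v b c d \<longleftrightarrow> distinct [v, b, c, d] \<and> gnorm (a v b) = 1 \<and> gnorm (a v c) = 1 \<and> gnorm (a v d) = 1 \<and>
     (\<forall>m. m \<notin> {v, b, c, d} \<longrightarrow> a v m = 0)"

definition tri :: "nat \<Rightarrow> nat \<Rightarrow> nat \<Rightarrow> complex" where "tri v p q = a v p * a p q * a q v"

lemma star_rotate: "star v b c d \<Longrightarrow> star v c d b"
  by (auto simp: star_def)

lemma tri_cnj: "tri v q p = cnj (tri v p q)"
  unfolding tri_def using herm[of p v] herm[of q p] herm[of v q] by (simp add: mult_ac)

lemma tri_gauss: "tri v p q \<in> gauss_ints"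
  by (simp add: tri_def gauss gauss_ints_closed)

lemma gnorm_tri: "gnorm (a v p) = 1 \<Longrightarrow> gnorm (a v q) = 1 \<Longrightarrow> gnorm (tri v p q) = gnorm (a p q)"
  using gnorm_sym[of q v] by (simp add: tri_def gnorm_mult gauss gauss_ints_closed)

lemma tri_eq_0_iff: "gnorm (a v p) = 1 \<Longrightarrow> gnorm (a v q) = 1 \<Longrightarrow> tri v p q = 0 \<longleftrightarrow> a p q = 0"
  using gnorm_sym[of q v] by (auto simp: tri_def simp flip: gnorm_0_iff)

lemma starD:
  assumes "star v b c d"
  shows "v < n" "b < n" "c < n" "d < n" "a v b \<noteq> 0" "a v c \<noteq> 0" "a v d \<noteq> 0" "a b v \<noteq> 0" "a c v \<noteq> 0" "a d v \<noteq> 0"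
    "gnorm (a b v) = 1" "gnorm (a c v) = 1" "gnorm (a d v) = 1"
proof -
  show nz: "a v b \<noteq> 0" "a v c \<noteq> 0" "a v d \<noteq> 0" using assms by (auto simp: star_def simp flip: gnorm_0_iff)
  show "a b v \<noteq> 0" "a c v \<noteq> 0" "a d v \<noteq> 0" using nz nonzero_sym by auto
  show "v < n" "b < n" "c < n" "d < n" using nz nonzero_less by blast+
  show "gnorm (a b v) = 1" "gnorm (a c v) = 1" "gnorm (a d v) = 1" using assms gnorm_sym by (simp_all add: star_def)
qed

end

context regular_graph
begin

lemma star_charge:
  assumes s: "star v b c d"
  shows "a b b = - (a v v + tri v c b + tri v d b)"
proof -
  have u: "a v b * a b v = 1" using unit_prod s by (auto simp: star_def)
  have "sq v b = a v v * a v b + a v b * a b b + a v c * a c b + a v d * a d b"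
    using sq_row4[of v b c d v b] s by (auto simp: star_def)
  then have "0 = (a v v * a v b + a v b * a b b + a v c * a c b + a v d * a d b) * a b v"
    using orth[of v b] s by (simp add: star_def)
  also have "\<dots> = (a v v + a b b) * (a v b * a b v) + tri v c b + tri v d b"
    by (simp add: tri_def algebra_simps)
  finally have "a v v + a b b + tri v c b + tri v d b = 0" using u by simp
  then show ?thesis by (simp add: eq_neg_iff_add_eq_0 algebra_simps)
qed

lemma star_types:
  assumes v: "a v v = 1" and s0: "star v b c d"
  obtains b c d where "star v b c d"
    "(tri v b c, tri v c d, tri v d b) \<in> {(-1,-1,-1), (1,-1,-1), (-1,-1,0), (-1,0,0), (0,0,0),
      (\<i>,\<i>,\<i>), (-\<i>,-\<i>,-\<i>), (-1+\<i>,\<i>,\<i>), (-1-\<i>,-\<i>,-\<i>)}"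
proof -
  have s: "star v b c d" "star v c d b" "star v d b c" using s0 star_rotate by blast+
  obtain x mx where x: "Re (tri v b c) = of_int x" "Im (tri v b c) = of_int mx" "gnorm (tri v b c) = nat (x\<^sup>2 + mx\<^sup>2)"
    by (rule gauss_ints_obtain[OF tri_gauss])
  obtain y my where y: "Re (tri v c d) = of_int y" "Im (tri v c d) = of_int my" "gnorm (tri v c d) = nat (y\<^sup>2 + my\<^sup>2)"
    by (rule gauss_ints_obtain[OF tri_gauss])
  obtain z mz where z: "Re (tri v d b) = of_int z" "Im (tri v d b) = of_int mz" "gnorm (tri v d b) = nat (z\<^sup>2 + mz\<^sup>2)"
    by (rule gauss_ints_obtain[OF tri_gauss])
  have diag: "\<exists>e. Re (a i i) = of_int e \<and> gnorm (a i i) = nat (e\<^sup>2)" for i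
  proof -
    obtain p q where "Re (a i i) = of_int p" "Im (a i i) = of_int q" "gnorm (a i i) = nat (p\<^sup>2 + q\<^sup>2)"
      by (rule gauss_ints_obtain[OF gauss])
    then show ?thesis using diag_real[of i] by auto
  qed
  obtain eb where eb: "Re (a b b) = of_int eb" "gnorm (a b b) = nat (eb\<^sup>2)" using diag by blast
  obtain ec where ec: "Re (a c c) = of_int ec" "gnorm (a c c) = nat (ec\<^sup>2)" using diag by blast
  obtain ed where ed: "Re (a d d) = of_int ed" "gnorm (a d d) = nat (ed\<^sup>2)" using diag by blast
  have cb: "a b b = - (1 + cnj (tri v b c) + tri v d b)" using star_charge[OF s(1)] v tri_cnj[of v c b] by simp
  have cc: "a c c = - (1 + cnj (tri v c d) + tri v b c)" using star_charge[OF s(2)] v tri_cnj[of v d c] by simp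
  have cd: "a d d = - (1 + cnj (tri v d b) + tri v c d)" using star_charge[OF s(3)] v tri_cnj[of v b d] by simp
  have "Im (a b b) = 0" "Im (a c c) = 0" "Im (a d d) = 0" by (rule diag_real)+
  then have ms: "mz = mx" "my = mx" unfolding cb cc cd by (simp_all add: x y z)
  have "real_of_int eb = of_int (- (1 + x + z))" "real_of_int ec = of_int (- (1 + y + x))" "real_of_int ed = of_int (- (1 + z + y))"
    using eb(1) ec(1) ed(1) unfolding cb cc cd by (simp_all add: x y z)
  then have e: "x + z = - (1 + eb)" "x + y = - (1 + ec)" "y + z = - (1 + ed)" unfolding of_int_eq_iff by linarith+
  have row: "gnorm (a p p) + gnorm (tri v p q) + gnorm (tri v r p) \<le> 3" if "star v p q r" for p q r
  proof -
    have "(\<Sum>k\<in>{p, v, q, r}. gnorm (a p k)) \<le> 4" using deg_ge[of "{p, v, q, r}" p] deg4[OF starD(2)[OF that]] by simp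
    then show ?thesis using that starD[OF that] gnorm_tri[of v p q] gnorm_tri[of v r p] gnorm_sym[of p r]
      by (auto simp: star_def)
  qed
  have "eb\<^sup>2 + (x\<^sup>2 + mx\<^sup>2) + (z\<^sup>2 + mx\<^sup>2) \<le> 3" using row[OF s(1)] unfolding eb(2) x(3) z(3) ms by simp
  moreover have "ec\<^sup>2 + (x\<^sup>2 + mx\<^sup>2) + (y\<^sup>2 + mx\<^sup>2) \<le> 3" using row[OF s(2)] unfolding ec(2) x(3) y(3) ms by simp
  moreover have "ed\<^sup>2 + (y\<^sup>2 + mx\<^sup>2) + (z\<^sup>2 + mx\<^sup>2) \<le> 3" using row[OF s(3)] unfolding ed(2) y(3) z(3) ms by simp
  ultimately have sol: "mx = 0 \<and> (x, y, z) \<in> {(-1,-1,-1), (1,-1,-1), (-1,1,-1), (-1,-1,1), (-1,-1,0), (-1,0,-1), (0,-1,-1),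
      (-1,0,0), (0,-1,0), (0,0,-1), (0,0,0)} \<or>
    (mx = 1 \<or> mx = -1) \<and> (x, y, z) \<in> {(0,0,0), (-1,0,0), (0,-1,0), (0,0,-1)}"
    by (rule star_triangle_arith[OF e])
  have t: "tri v b c = of_int x + \<i> * of_int mx" "tri v c d = of_int y + \<i> * of_int mx" "tri v d b = of_int z + \<i> * of_int mx"
    by (simp_all add: complex_eq_iff x y z ms)
  let ?T = "{(-1,-1,-1), (1,-1,-1), (-1,-1,0), (-1,0,0), (0,0,0),
      (\<i>,\<i>,\<i>), (-\<i>,-\<i>,-\<i>), (-1+\<i>,\<i>,\<i>), (-1-\<i>,-\<i>,-\<i>)}"
  have "(tri v b c, tri v c d, tri v d b) \<in> ?T \<or> (tri v c d, tri v d b, tri v b c) \<in> ?T \<or> (tri v d b, tri v b c, tri v c d) \<in> ?T"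
    unfolding t using sol by (elim disjE conjE insertE emptyE) simp_all
  then show thesis using that s by blast
qed

end

section \<open>Ladders\<close>

fun lw :: "ladder_vertex \<Rightarrow> ladder_vertex \<Rightarrow> complex" where
  "lw (Top i) (Top j) = (if j = Suc i \<or> i = Suc j \<or> (i = 1 \<and> j = 1) then 1 else 0)"
| "lw (Top i) (Bot j) = (if j = Suc i \<or> (i = 1 \<and> j = 1) then 1 else if i = Suc j then -1 else 0)"
| "lw (Bot i) (Top j) = (if j = Suc i then -1 else if i = Suc j \<or> (i = 1 \<and> j = 1) then 1 else 0)"
| "lw (Bot i) (Bot j) = (if j = Suc i \<or> i = Suc j then -1 else if i = 1 \<and> j = 1 then 1 else 0)"
| "lw _ _ = 0"

lemma lw_sym: "lw q p = lw p q"
  by (cases p; cases q) auto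

fun rung :: "ladder_vertex \<Rightarrow> nat" where
  "rung (Top i) = i" | "rung (Bot i) = i" | "rung Apex = 0"

definition rungs :: "nat \<Rightarrow> ladder_vertex set" where "rungs k = {p. 1 \<le> rung p \<and> rung p \<le> k}"

lemma set_ladder_vertices: "set (ladder_vertices k) = rungs k"
proof -
  have "p \<in> set (ladder_vertices k) \<longleftrightarrow> p \<in> rungs k" for p
    by (cases p) (auto simp: ladder_vertices_def rungs_def)
  then show ?thesis by blast
qed

lemma weight_C_pp:
  assumes "k \<ge> 2" "p \<in> rungs k" "q \<in> rungs k"
  shows "weight (snd (C_pp k)) p q = (if rung p = k \<and> rung q = k then (if p = q then 1 else -1) else lw p q)"
  using assms by (cases p; cases q) (auto simp: weight_def C_pp_def rungs_def)

lemma weight_C_pm: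
  assumes "k \<ge> 2" "p \<in> rungs k" "q \<in> rungs k"
  shows "weight (snd (C_pm k)) p q = (if rung p = k \<and> rung q = k then (if p = q then -1 else 1) else lw p q)"
  using assms by (cases p; cases q) (auto simp: weight_def C_pm_def rungs_def)

fun reflect :: "nat \<Rightarrow> ladder_vertex \<Rightarrow> ladder_vertex" where
  "reflect k (Top i) = Top (Suc k - i)" | "reflect k (Bot i) = Bot (Suc k - i)" | "reflect k Apex = Apex"

fun bot_sign :: "ladder_vertex \<Rightarrow> complex" where
  "bot_sign (Bot i) = -1" | "bot_sign _ = 1"

text \<open>Reading the ladder of \<open>C_odd k\<close> from the charged end negates the bottom rail.\<close>

lemma weight_C_odd:
  assumes "k \<ge> 2" "p \<in> rungs k" "q \<in> rungs k"
  shows "bot_sign p * weight (snd (C_odd k)) p q * cnj (bot_sign q) = lw (reflect k p) (reflect k q)"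
  using assms by (cases p; cases q) (auto simp: weight_def C_odd_def rungs_def)

lemma weight_C_odd_Apex:
  assumes "k \<ge> 2" "p \<in> rungs k"
  shows "weight (snd (C_odd k)) p Apex = (if rung p = 1 then 1 + \<i> else 0)"
    "weight (snd (C_odd k)) Apex p = (if rung p = 1 then 1 - \<i> else 0)"
    "weight (snd (C_odd k)) Apex Apex = 0"
  using assms by (cases p; auto simp: weight_def C_odd_def rungs_def complex_eq_iff)+

definition lad :: "nat \<Rightarrow> (nat \<Rightarrow> nat \<Rightarrow> complex) \<Rightarrow> nat \<Rightarrow> (ladder_vertex \<Rightarrow> nat) \<Rightarrow> bool" where
  "lad n a j f \<longleftrightarrow> inj_on f (rungs j) \<and> f ` rungs j \<subseteq> {..<n} \<and> (\<forall>p\<in>rungs j. \<forall>q\<in>rungs j. a (f p) (f q) = lw p q)"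

lemma lad_length: "lad n a j f \<Longrightarrow> j \<le> n"
proof -
  assume l: "lad n a j f"
  have mem: "Top i \<in> rungs j" if "i \<in> {1..j}" for i using that by (simp add: rungs_def)
  have "inj_on (\<lambda>i. f (Top i)) {1..j}"
  proof (rule inj_onI)
    fix x y assume "x \<in> {1..j}" "y \<in> {1..j}" "f (Top x) = f (Top y)"
    then have "Top x = Top y" using l mem unfolding lad_def by (meson inj_onD)
    then show "x = y" by simp
  qed
  moreover have "(\<lambda>i. f (Top i)) ` {1..j} \<subseteq> {..<n}" using l mem unfolding lad_def by blast
  ultimately have "card {1..j} \<le> card {..<n}" by (intro card_inj_on_le) auto
  then show ?thesis by simp
qed

context regular_graph
begin

lemma ladder_row:
  assumes l: "lad n a j f" and p: "p \<in> rungs j" "rung p < j" and m: "m \<notin> f ` rungs j"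
  shows "a (f p) m = 0"
proof -
  define i where "i = rung p"
  have i: "1 \<le> i" "i < j" using p by (auto simp: rungs_def i_def)
  have lwv: "a (f p) (f q) = lw p q" if "q \<in> rungs j" for q using l p that by (auto simp: lad_def)
  have pc: "p = Top i \<or> p = Bot i" using i by (cases p) (auto simp: i_def)
  have inj: "f q = f q' \<longleftrightarrow> q = q'" if "q \<in> rungs j" "q' \<in> rungs j" for q q'
    using l that by (auto simp: lad_def inj_on_def)
  define i' where "i' = (if i = 1 then 1 else i - 1)"
  have i'c: "i = 1 \<and> i' = 1 \<or> i = Suc i'" using i by (auto simp: i'_def)
  let ?Q = "{Top i', Bot i', Top (Suc i), Bot (Suc i)}"
  have Q: "?Q \<subseteq> rungs j" using i by (auto simp: rungs_def i'_def)
  have d: "distinct [f (Top i'), f (Bot i'), f (Top (Suc i)), f (Bot (Suc i))]"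
    using Q i by (auto simp: inj i'_def)
  have g: "gnorm (a (f p) (f q)) = 1" if "q \<in> ?Q" for q
  proof -
    have "lw p q = 1 \<or> lw p q = -1" using pc that i'c by (elim disjE conjE insertE emptyE) simp_all
    then have "unit (a (f p) (f q))" using lwv[of q] that Q by auto
    then show ?thesis by (rule gnorm_unit)
  qed
  show ?thesis
  proof (rule row_supp[of "f ` ?Q"])
    have "f p < n" using l p by (auto simp: lad_def)
    then show "deg (f p) \<le> (\<Sum>k\<in>f ` ?Q. gnorm (a (f p) k))" using d g by (simp add: deg4)
  qed (use m Q in auto)
qed

lemma realizes_ladder:
  assumes G: "fst G = ladder_vertices j" and l: "inj_on f (rungs j)" "f ` rungs j = {..<n}"
    and w: "\<And>p q. p \<in> rungs j \<Longrightarrow> q \<in> rungs j \<Longrightarrow> a (f p) (f q) = weight (snd G) p q"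
  shows "realizes n a G"
  by (rule realizesI[of f _ _ "\<lambda>_. 1"]) (use l w in \<open>auto simp: G set_ladder_vertices bij_betw_def\<close>)

lemma realizes_C_odd:
  assumes j: "j \<ge> 2" and l: "lad n a j f" and w: "w \<notin> f ` rungs j" "f ` rungs j \<union> {w} = {..<n}"
    and t: "a (f (Top j)) w = 1 + \<i>" "a (f (Bot j)) w = - (1 + \<i>)" "a w w = 0"
  shows "listed n a"
proof -
  define g where "g p = (if p = Apex then w else f (reflect j p))" for p
  have refl: "reflect j p \<in> rungs j" "p \<noteq> Apex" if "p \<in> rungs j" for p
    using that by (cases p; auto simp: rungs_def)+
  have reflinj: "reflect j p = reflect j q \<longleftrightarrow> p = q" if "p \<in> rungs j" "q \<in> rungs j" for p q
    using that by (cases p; cases q) (auto simp: rungs_def)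
  have reflsurj: "\<exists>p\<in>rungs j. reflect j p = q" if "q \<in> rungs j" for q
  proof
    show "reflect j (reflect j q) = q" using that by (cases q) (auto simp: rungs_def)
    show "reflect j q \<in> rungs j" by (rule refl(1)[OF that])
  qed
  have S: "set (fst (C_odd j)) = insert Apex (rungs j)" by (auto simp: C_odd_def set_ladder_vertices)
  have Ap: "Apex \<notin> rungs j" by (simp add: rungs_def)
  have apex: "a (f p) w = (if rung p = j then bot_sign p * (1 + \<i>) else 0)" if "p \<in> rungs j" for p
  proof (cases "rung p = j")
    case True
    then have "p = Top j \<or> p = Bot j" using that j by (cases p) auto
    then show ?thesis using t by auto
  next
    case False
    then have "rung p < j" using that by (simp add: rungs_def)
    then show ?thesis using ladder_row[OF l that _ w(1)] False by simp
  qed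
  have rr: "rung (reflect j p) = j \<longleftrightarrow> rung p = 1" "bot_sign (reflect j p) = bot_sign p" if "p \<in> rungs j" for p
    using that by (cases p; auto simp: rungs_def)+
  have bc: "cnj (bot_sign p) = bot_sign p" for p by (cases p) auto
  have key: "a (g p) (g q) = bot_sign p * weight (snd (C_odd j)) p q * cnj (bot_sign q)"
    if "p \<in> insert Apex (rungs j)" "q \<in> insert Apex (rungs j)" for p q
  proof (cases "p = Apex"; cases "q = Apex")
    assume "p = Apex" "q = Apex"
    then show ?thesis using t j weight_C_odd_Apex(3)[of j "Top 1"] by (simp add: g_def rungs_def)
  next
    assume p: "p = Apex" "q \<noteq> Apex"
    then have q: "q \<in> rungs j" using that by blast
    have "a w (f (reflect j q)) = cnj (a (f (reflect j q)) w)" by (rule herm)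
    also have "\<dots> = (if rung q = 1 then bot_sign q * (1 - \<i>) else 0)"
      using apex[OF refl(1)[OF q]] rr[OF q] by (simp add: bc)
    finally show ?thesis using p weight_C_odd_Apex(2)[OF j q] by (simp add: g_def bc)
  next
    assume p: "p \<noteq> Apex" "q = Apex"
    then have q: "p \<in> rungs j" using that by blast
    then show ?thesis using p weight_C_odd_Apex(1)[OF j q] apex[OF refl(1)[OF q]] rr[OF q]
      by (simp add: g_def)
  next
    assume "p \<noteq> Apex" "q \<noteq> Apex"
    then have pq: "p \<in> rungs j" "q \<in> rungs j" using that by blast+
    have "a (f (reflect j p)) (f (reflect j q)) = lw (reflect j p) (reflect j q)"
      using l refl(1)[OF pq(1)] refl(1)[OF pq(2)] by (simp add: lad_def)
    then show ?thesis using weight_C_odd[OF j pq] \<open>p \<noteq> Apex\<close> \<open>q \<noteq> Apex\<close> by (simp add: g_def)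
  qed
  have "realizes n a (C_odd j)"
  proof (rule realizesI[of g _ _ bot_sign])
    show "unit (bot_sign p)" for p by (cases p) auto
    have "g ` rungs j = f ` rungs j"
      using refl reflsurj by (force simp: g_def image_iff)
    moreover have "inj_on g (rungs j)"
    proof (rule inj_onI)
      fix p q assume pq: "p \<in> rungs j" "q \<in> rungs j" "g p = g q"
      then have "f (reflect j p) = f (reflect j q)" using refl(2) by (simp add: g_def)
      then have "reflect j p = reflect j q" using l refl(1) pq unfolding lad_def by (meson inj_onD)
      then show "p = q" using reflinj pq by blast
    qed
    ultimately show "bij_betw g (set (fst (C_odd j))) {..<n}"
      unfolding S bij_betw_def using w Ap by (auto simp: g_def)
  qed (use key S in auto)
  then show ?thesis unfolding listed_def using j by force
qed

lemma ladder_end: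
  assumes j: "j \<ge> 2" and l: "lad n a j f" and w: "w \<notin> f ` rungs j" "a (f (Top j)) w \<noteq> 0"
  shows "a (f (Bot j)) w = - a (f (Top j)) w"
proof -
  obtain i where i: "j = Suc i" "i \<ge> 1" using j by (cases j) auto
  have P: "Top i \<in> rungs j" "Bot i \<in> rungs j" "Top j \<in> rungs j" "Bot j \<in> rungs j" using i by (auto simp: rungs_def)
  have ne: "f (Top j) \<noteq> f (Bot j)" using l P by (auto simp: lad_def inj_on_def)
  have lwv: "a (f p) (f q) = lw p q" if "p \<in> rungs j" "q \<in> rungs j" for p q using l that by (auto simp: lad_def)
  have "sq (f (Top i)) w = (\<Sum>k\<in>{f (Top j), f (Bot j)}. a (f (Top i)) k * a k w)"
  proof (rule sq_supp)
    show "a (f (Top i)) k * a k w = 0" if k: "k \<notin> {f (Top j), f (Bot j)}" for k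
    proof (cases "k \<in> f ` rungs j")
      case True
      then obtain q where q: "q \<in> rungs j" "k = f q" by blast
      then have "rung q \<noteq> j" using k by (cases q) (auto simp: rungs_def)
      then have "rung q < j" using q by (simp add: rungs_def)
      then show ?thesis using ladder_row[OF l q(1) _ w(1)] q by simp
    next
      case False
      then show ?thesis using ladder_row[OF l P(1) _ False] i by simp
    qed
  qed simp
  moreover have "f (Top i) \<noteq> w" using w P by blast
  ultimately have "a (f (Top j)) w + a (f (Bot j)) w = 0"
    using orth[of "f (Top i)" w] ne lwv[OF P(1,3)] lwv[OF P(1,4)] i by simp
  then show ?thesis by (simp add: eq_neg_iff_add_eq_0 add.commute)
qed

end

lemma listed_if_ladder:
  assumes "regular_graph n a" "j \<ge> 2" "lad n a j f"
  shows "listed n a"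
  using assms
proof (induction "n - j" arbitrary: a j f rule: less_induct)
  case less
  interpret regular_graph n a by fact
  note j = less.prems(2) and l = less.prems(3)
  obtain i where i: "j = Suc i" "i \<ge> 1" using j by (cases j) auto
  define T where "T = f (Top j)"
  define B where "B = f (Bot j)"
  have P: "Top i \<in> rungs j" "Bot i \<in> rungs j" "Top j \<in> rungs j" "Bot j \<in> rungs j" using i by (auto simp: rungs_def)
  have inj: "f q = f q' \<longleftrightarrow> q = q'" if "q \<in> rungs j" "q' \<in> rungs j" for q q'
    using l that by (auto simp: lad_def inj_on_def)
  have lwv: "a (f p) (f q) = lw p q" if "p \<in> rungs j" "q \<in> rungs j" for p q using l that by (auto simp: lad_def)
  have less: "f p < n" if "p \<in> rungs j" for p using l that by (auto simp: lad_def)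
  define T' where "T' = f (Top i)"
  define B' where "B' = f (Bot i)"
  have prev: "a T T' = 1" "a T B' = -1" "a B T' = 1" "a B B' = -1" "a T T = 0" "a B B = 0" "a T B = 0"
    using lwv P i j by (simp_all add: T_def B_def T'_def B'_def)
  have dist: "distinct [T, B, T', B']" using P i by (auto simp: T_def B_def T'_def B'_def inj)
  have TB: "T < n" "B < n" "T \<in> f ` rungs j" "B \<in> f ` rungs j" "T' \<in> f ` rungs j" "B' \<in> f ` rungs j"
    using less P by (auto simp: T_def B_def T'_def B'_def)
  have g1: "gnorm (1 :: complex) = 1" "gnorm (-1 :: complex) = 1" by (simp_all add: gnorm_unit)
  have outside_ladder: "w \<notin> f ` rungs j" if w: "a T w \<noteq> 0" "w \<notin> {T', B'}" for w
  proof
    assume "w \<in> f ` rungs j"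
    then obtain q where q: "q \<in> rungs j" "w = f q" by blast
    have "lw (Top j) q \<noteq> 0" using w q lwv[OF P(3) q(1)] by (simp add: T_def)
    then have "q = Top i \<or> q = Bot i" using q(1) i by (cases q) (auto simp: rungs_def split: if_splits)
    then show False using w q by (auto simp: T'_def B'_def)
  qed
  obtain w where w: "w \<notin> {T', B'}" "a T w \<noteq> 0" "w < n"
    using pick_nbr[of "{T', B'}" T] deg4[OF TB(1)] prev dist g1 by auto
  have wo: "w \<notin> f ` rungs j" by (rule outside_ladder) (use w in auto)
  have wne: "w \<noteq> T" "w \<noteq> B" "w \<noteq> T'" "w \<noteq> B'" using wo TB by metis+
  have Bw: "a B w = - a T w" unfolding T_def B_def by (rule ladder_end[OF j l wo]) (use w in \<open>simp add: T_def\<close>)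
  have "gnorm (a T T') + gnorm (a T B') + gnorm (a T w) \<le> 4"
    using deg_ge[of "{T', B', w}" T] deg4[OF TB(1)] dist w by simp
  then have gw: "gnorm (a T w) = 1 \<or> gnorm (a T w) = 2" using prev g1 gnorm_pos[OF w(2)] by auto
  have rows: "a (f p) m = 0" if "p \<in> rungs j" "rung p < j" "m \<notin> f ` rungs j" for p m
    using ladder_row[OF l that] .
  have Pcases: "f p = T \<or> f p = B \<or> rung p < j" if "p \<in> rungs j" for p
    using that by (cases p) (auto simp: rungs_def T_def B_def)
  show ?case
  proof (cases "gnorm (a T w) = 2")
    case True
    have Ts: "a T m = 0" if "m \<notin> {T', B', w}" for m
      by (rule row_supp[of "{T', B', w}"]) (use deg4[OF TB(1)] prev dist w True g1 that in auto)
    have Bs: "a B m = 0" if "m \<notin> {T', B', w}" for m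
      by (rule row_supp[of "{T', B', w}"]) (use deg4[OF TB(2)] prev dist w True g1 Bw that in auto)
    have ws: "a w m = 0" if "m \<notin> {T, B}" for m
      by (rule row_supp[of "{T, B}"]) (use deg4[OF w(3)] dist True Bw gnorm_sym[of w T] gnorm_sym[of w B] that in auto)
    have V: "f ` rungs j \<union> {w} = {..<n}"
    proof (rule conn)
      show "m \<in> f ` rungs j \<union> {w}" if q: "q \<in> f ` rungs j \<union> {w}" "a q m \<noteq> 0" for q m
      proof (rule ccontr)
        assume m: "m \<notin> f ` rungs j \<union> {w}"
        then have "q \<noteq> w" using q ws TB by blast
        then obtain p where p: "p \<in> rungs j" "q = f p" using q by blast
        have "m \<notin> {T', B', w}" using m TB(5,6) by blast
        then have "a T m = 0" "a B m = 0" using Ts Bs by blast+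
        then show False using Pcases[OF p(1)] rows[OF p(1)] m q(2) p(2) by auto
      qed
    qed (use less w in auto)
    let ?E = "[(T, w, 1 + \<i>)]"
    have E: "tree_edges ?E" using wne by simp
    have "gnorm (1 + \<i>) = 2" using gnorm_of_ints[of "1 + \<i>" 1 1] by simp
    then have E': "t \<in> gauss_ints \<and> gnorm t \<in> {1, 2} \<and> gnorm (a p c) = gnorm t"
      if "(p, c, t) \<in> set ?E" for p c t using that True by auto
    show ?thesis
    proof (rule normalization[OF E E'])
    fix x assume x: "regular_graph n x" "\<And>i j. gnorm (x i j) = gnorm (a i j)" "\<And>i j. x i j = 0 \<longleftrightarrow> a i j = 0"
      "\<And>i. x i i = a i i" "\<And>i j k. x i j * x j k * x k i = a i j * a j k * a k i"
      "\<And>p c t. (p, c, t) \<in> set ?E \<Longrightarrow> x p c = t"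
      "\<And>i j. i \<notin> fst ` snd ` set ?E \<Longrightarrow> j \<notin> fst ` snd ` set ?E \<Longrightarrow> x i j = a i j"
      "listed n x \<Longrightarrow> listed n a"
    interpret x: regular_graph n x by fact
    have lx: "lad n x j f" unfolding lad_def
    proof (intro conjI ballI)
      fix p q assume "p \<in> rungs j" "q \<in> rungs j"
      then show "x (f p) (f q) = lw p q" using x(7)[of "f p" "f q"] wo lwv by auto
    qed (use l in \<open>auto simp: lad_def\<close>)
    have Tw: "x T w = 1 + \<i>" using x(6) by simp
    have xBw: "x B w = - (1 + \<i>)"
      using x.ladder_end[OF j lx wo] Tw by (simp add: T_def B_def complex_eq_iff)
    have "a w w = 0" using ws wne by auto
    then have "listed n x"
      using x.realizes_C_odd[OF j lx wo V] Tw xBw x(4) by (simp add: T_def B_def)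
    then show ?thesis by (rule x(8))
    qed
  next
    case False
    then have gw1: "gnorm (a T w) = 1" using gw by blast
    obtain w' where w': "w' \<notin> {T', B', w}" "a T w' \<noteq> 0" "w' < n"
      using pick_nbr[of "{T', B', w}" T] deg4[OF TB(1)] prev dist w gw1 g1 by auto
    have w'o: "w' \<notin> f ` rungs j" by (rule outside_ladder) (use w' in auto)
    have w'ne: "w' \<noteq> T" "w' \<noteq> B" "w \<noteq> w'" "w' \<noteq> T'" "w' \<noteq> B'" using w'o TB(3-6) w'(1) by (metis insertCI)+
    have D: "distinct [T', B', w, w']" using dist wne w'ne by auto
    have "gnorm (a T T') + gnorm (a T B') + gnorm (a T w) + gnorm (a T w') \<le> 4"
      using deg_ge[of "{T', B', w, w'}" T] deg4[OF TB(1)] D by simp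
    then have gw': "gnorm (a T w') = 1" using prev g1 gw1 gnorm_pos[OF w'(2)] by auto
    let ?E = "[(T, w, 1), (T, w', 1)]"
    have E: "tree_edges ?E" using wne w'ne by simp
    have E': "t \<in> gauss_ints \<and> gnorm t \<in> {1, 2} \<and> gnorm (a p c) = gnorm t"
      if "(p, c, t) \<in> set ?E" for p c t using that gw1 gw' g1 by auto
    show ?thesis
    proof (rule normalization[OF E E'])
    fix x assume x: "regular_graph n x" "\<And>i j. gnorm (x i j) = gnorm (a i j)" "\<And>i j. x i j = 0 \<longleftrightarrow> a i j = 0"
      "\<And>i. x i i = a i i" "\<And>i j k. x i j * x j k * x k i = a i j * a j k * a k i"
      "\<And>p c t. (p, c, t) \<in> set ?E \<Longrightarrow> x p c = t"
      "\<And>i j. i \<notin> fst ` snd ` set ?E \<Longrightarrow> j \<notin> fst ` snd ` set ?E \<Longrightarrow> x i j = a i j"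
      "listed n x \<Longrightarrow> listed n a"
    interpret x: regular_graph n x by fact
    have lx: "lad n x j f" unfolding lad_def
    proof (intro conjI ballI)
      fix p q assume "p \<in> rungs j" "q \<in> rungs j"
      then show "x (f p) (f q) = lw p q" using x(7)[of "f p" "f q"] wo w'o lwv by auto
    qed (use l in \<open>auto simp: lad_def\<close>)
    have Tw: "x T w = 1" "x T w' = 1" using x(6) by auto
    have xB: "x B w = -1" "x B w' = -1"
      using x.ladder_end[OF j lx wo] x.ladder_end[OF j lx w'o] Tw by (simp_all add: T_def B_def)
    have xp: "x T T' = 1" "x T B' = -1" "x B T' = 1" "x B B' = -1"
      using x(7) prev wne w'ne by auto
    have Ts: "x T m = 0" if "m \<notin> {T', B', w, w'}" for m
      by (rule x.row_supp[of "{T', B', w, w'}"]) (use x.deg4[OF TB(1)] xp dist w w' Tw g1 that in auto)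
    have Bs: "x B m = 0" if "m \<notin> {T', B', w, w'}" for m
      by (rule x.row_supp[of "{T', B', w, w'}"]) (use x.deg4[OF TB(2)] xp dist w w' xB g1 that in auto)
    have xrow: "x (f p) m = 0" if "p \<in> rungs j" "rung p < j" "m \<notin> f ` rungs j" for p m
      using x.ladder_row[OF lx that] .
    have T'w: "x T' m = 0" "x B' m = 0" if "m \<in> {w, w'}" for m
      using xrow[OF P(1)] xrow[OF P(2)] i wo w'o that by (auto simp: T'_def B'_def)
    have sqT: "x.sq T m = x T w * x w m + x T w' * x w' m" if "m \<in> {w, w'}" for m
      using x.sq_row4[of T' B' w w' T m] Ts dist w w' T'w[OF that] by auto
    have ww: "x w' w = - x w w" "x w w' = - x w' w'"
      using sqT[of w] sqT[of w'] x.orth[of T w] x.orth[of T w'] wne w'ne Tw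
      by (auto simp: eq_neg_iff_add_eq_0 add.commute)
    have "x w w' = cnj (x w' w)" by (rule x.herm)
    moreover have "cnj (x w w) = x w w" using x.diag_real[of w] by (simp add: complex_eq_iff)
    ultimately have w'w': "x w' w' = x w w" using ww by simp
    have wT: "gnorm (x w T) = 1" "gnorm (x w B) = 1" "gnorm (x w' T) = 1" "gnorm (x w' B) = 1"
      using Tw xB x.gnorm_sym[of w T] x.gnorm_sym[of w B] x.gnorm_sym[of w' T] x.gnorm_sym[of w' B] g1 by auto
    have "gnorm (x w T) + gnorm (x w B) + gnorm (x w w) + gnorm (x w w') \<le> 4"
      using x.deg_ge[of "{T, B, w, w'}" w] x.deg4[OF w(3)] dist wne w'ne by simp
    then have "x w w = 0 \<or> x w w = 1 \<or> x w w = -1" using x.diag_cases[of w] wT by auto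
    define f' where "f' = f(Top (Suc j) := w, Bot (Suc j) := w')"
    have f': "f' (Top (Suc j)) = w" "f' (Bot (Suc j)) = w'" by (simp_all add: f'_def)
    have f'_old: "f' p = f p" if "p \<in> rungs j" for p
      using that by (auto simp: f'_def rungs_def)
    have rungs_Suc: "rungs (Suc j) = rungs j \<union> {Top (Suc j), Bot (Suc j)}" 
    proof -
      have "p \<in> rungs (Suc j) \<longleftrightarrow> p \<in> rungs j \<union> {Top (Suc j), Bot (Suc j)}" for p
        by (cases p) (auto simp: rungs_def)
      then show ?thesis by blast
    qed
    have img: "f' ` rungs (Suc j) = f ` rungs j \<union> {w, w'}"
      unfolding rungs_Suc image_Un using f'_old f' by simp
    have f'inj: "inj_on f' (rungs (Suc j))"
    proof -
      have img: "f' ` rungs j = f ` rungs j" using f'_old by simp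
      have "inj_on f' (rungs j)" using l f'_old inj_on_cong[of "rungs j" f' f] by (simp add: lad_def)
      moreover have "f' (Bot (Suc j)) \<notin> f' ` (rungs j - {Bot (Suc j)})" using w'o img f' by blast
      ultimately have "inj_on f' (insert (Bot (Suc j)) (rungs j))" by (simp only: inj_on_insert) simp
      moreover have "f' ` (insert (Bot (Suc j)) (rungs j) - {Top (Suc j)}) \<subseteq> insert w' (f ` rungs j)"
        using f'(2) img by blast
      then have "f' (Top (Suc j)) \<notin> f' ` (insert (Bot (Suc j)) (rungs j) - {Top (Suc j)})"
        using wo w'ne(3) f'(1) by blast
      ultimately have "inj_on f' (insert (Top (Suc j)) (insert (Bot (Suc j)) (rungs j)))"
        by (simp only: inj_on_insert) simp
      moreover have "rungs (Suc j) = insert (Top (Suc j)) (insert (Bot (Suc j)) (rungs j))"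
        using rungs_Suc by blast
      ultimately show ?thesis by simp
    qed
    have old_new: "x (f p) w = lw p (Top (Suc j))" "x (f p) w' = lw p (Bot (Suc j))" if p: "p \<in> rungs j" for p
    proof -
      show "x (f p) w = lw p (Top (Suc j))"
      proof (cases "rung p < j")
        case True
        then show ?thesis using xrow[OF p True wo] p by (cases p) (auto simp: rungs_def)
      next
        case False
        then have "p = Top j \<or> p = Bot j" using p by (cases p) (auto simp: rungs_def)
        then show ?thesis using Tw xB by (auto simp: T_def B_def)
      qed
      show "x (f p) w' = lw p (Bot (Suc j))"
      proof (cases "rung p < j")
        case True
        then show ?thesis using xrow[OF p True w'o] p by (cases p) (auto simp: rungs_def)
      next
        case False
        then have "p = Top j \<or> p = Bot j" using p by (cases p) (auto simp: rungs_def)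
        then show ?thesis using Tw xB by (auto simp: T_def B_def)
      qed
    qed
    have real: "cnj (lw p q) = lw p q" for p q by (cases p; cases q) auto
    have new_old: "x w (f p) = lw (Top (Suc j)) p" "x w' (f p) = lw (Bot (Suc j)) p" if p: "p \<in> rungs j" for p
      using x.herm[of w "f p"] x.herm[of w' "f p"] old_new[OF p] lw_sym[of p] by (simp_all add: real)
    have mat: "x (f' p) (f' q) = (if rung p = Suc j \<and> rung q = Suc j then (if p = q then x w w else - x w w) else lw p q)"
      if pq: "p \<in> rungs (Suc j)" "q \<in> rungs (Suc j)" for p q
    proof -
      have r: "rung p \<noteq> Suc j" if "p \<in> rungs j" for p using that by (simp add: rungs_def)
      consider "p \<in> rungs j" "q \<in> rungs j" | "p \<in> rungs j" "q = Top (Suc j) \<or> q = Bot (Suc j)"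
        | "q \<in> rungs j" "p = Top (Suc j) \<or> p = Bot (Suc j)"
        | "p = Top (Suc j) \<or> p = Bot (Suc j)" "q = Top (Suc j) \<or> q = Bot (Suc j)"
        using pq unfolding rungs_Suc by blast
      then show ?thesis
      proof cases
        case 1
        then show ?thesis using r[OF 1(1)] f'_old lx by (simp add: lad_def)
      next
        case 2
        then show ?thesis using r[OF 2(1)] f'_old[OF 2(1)] old_new[OF 2(1)] f' by auto
      next
        case 3
        then show ?thesis using r[OF 3(1)] f'_old[OF 3(1)] new_old[OF 3(1)] f' by auto
      next
        case 4
        then show ?thesis using f' ww w'w' by auto
      qed
    qed
    have full: "f' ` rungs (Suc j) = {..<n}" if e: "gnorm (x w w) = 1"
    proof -
      have g: "gnorm (x w w') = 1" "gnorm (x w' w) = 1" "gnorm (x w' w') = 1" using ww w'w' e by auto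
      have ws: "x w m = 0" if "m \<notin> {T, B, w, w'}" for m
        by (rule x.row_supp[of "{T, B, w, w'}"]) (use x.deg4[OF w(3)] dist wne w'ne wT g e that in auto)
      have w's: "x w' m = 0" if "m \<notin> {T, B, w, w'}" for m
        by (rule x.row_supp[of "{T, B, w, w'}"]) (use x.deg4[OF w'(3)] dist wne w'ne wT g that in auto)
      have "f ` rungs j \<union> {w, w'} = {..<n}"
      proof (rule x.conn)
        show "m \<in> f ` rungs j \<union> {w, w'}" if q: "q \<in> f ` rungs j \<union> {w, w'}" "x q m \<noteq> 0" for q m
        proof (rule ccontr)
          assume m: "m \<notin> f ` rungs j \<union> {w, w'}"
          then have "m \<notin> {T, B, w, w'}" using TB(3,4) by blast
          then have "x w m = 0" "x w' m = 0" using ws w's by blast+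
          then have "q \<noteq> w" "q \<noteq> w'" using q(2) by auto
          then obtain p where p: "p \<in> rungs j" "q = f p" using q by blast
          have "m \<notin> {T', B', w, w'}" using m TB(5,6) by blast
          then have "x T m = 0" "x B m = 0" using Ts Bs by blast+
          then show False using Pcases[OF p(1)] xrow[OF p(1)] m q(2) p(2) by auto
        qed
      qed (use less w w' in auto)
      then show ?thesis using img by simp
    qed
    have "listed n x"
      using \<open>x w w = 0 \<or> x w w = 1 \<or> x w w = -1\<close>
    proof (elim disjE)
      assume 0: "x w w = 0"
      have "lw p q = 0" if "rung p = Suc j" "rung q = Suc j" for p q
        using that j by (cases p; cases q) auto
      then have "lad n x (Suc j) f'"
        unfolding lad_def using f'inj img mat 0 less w(3) w'(3) by auto
      then show "listed n x"
        using less.hyps[of "Suc j" x f'] lad_length[of n x "Suc j" f'] x(1) j by auto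
    next
      assume 1: "x w w = 1"
      have "realizes n x (C_pp (Suc j))"
        by (rule x.realizes_ladder[OF _ f'inj full]) (use 1 mat weight_C_pp[of "Suc j"] j g1 in \<open>auto simp: C_pp_def\<close>)
      then show "listed n x" unfolding listed_def using j by (metis le_SucI)
    next
      assume 1: "x w w = -1"
      have "realizes n x (C_pm (Suc j))"
        by (rule x.realizes_ladder[OF _ f'inj full]) (use 1 mat weight_C_pm[of "Suc j"] j g1 in \<open>auto simp: C_pm_def\<close>)
      then show "listed n x" unfolding listed_def using j by (metis le_SucI)
    qed
    then show ?thesis by (rule x(8))
    qed
  qed
qed

section \<open>The sporadic graphs on seven and eight vertices\<close>

context regular_graph
begin

lemma S_7_normalized:
  assumes V: "{..<n} = {va, vb, vc, vd, ve, vf, vg}" "distinct [va, vb, vc, vd, ve, vf, vg]"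
    and diag: "a va va = 1" "a vb vb = 0" "a vc vc = 0" "a vd vd = -1" "a ve ve = 1" "a vf vf = 1" "a vg vg = 0"
    and zero: "a va ve = 0" "a va vf = 0" "a va vg = 0" "a vb vd = 0" "a vb vf = 0" "a vc vd = 0" "a vc ve = 0"
      "a vd vg = 0" "a ve vf = 0"
    and tree: "a va vd = 1" "a vd ve = 1" "a vd vf = 1" "a va vb = 1" "a va vc = -1" "a ve vg = 1"
  shows "listed n a"
proof -
  note lower = herm[of vb va] herm[of vc va] herm[of vd va] herm[of ve va] herm[of vf va] herm[of vg va]
      herm[of vc vb] herm[of vd vb] herm[of ve vb] herm[of vf vb] herm[of vg vb] herm[of vd vc]
      herm[of ve vc] herm[of vf vc] herm[of vg vc] herm[of ve vd] herm[of vf vd] herm[of vg vd]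
      herm[of vf ve] herm[of vg ve] herm[of vg vf]
  have sq: "sq i j = a i va * a va j + a i vb * a vb j + a i vc * a vc j + a i vd * a vd j + a i ve * a ve j + a i vf * a vf j + a i vg * a vg j" for i j
    unfolding sq_def V(1) using V(2) by simp
  have w0: "a vb ve = -1"
    using orth[of vb vd] V(2) by (simp add: sq diag zero tree lower complex_eq_iff add_eq_0_iff)
  have w1: "a vc vf = 1"
    using orth[of vc vd] V(2) by (simp add: sq diag zero tree w0 lower complex_eq_iff add_eq_0_iff)
  have w2: "a vf vg = -1"
    using orth[of vd vg] V(2) by (simp add: sq diag zero tree w0 w1 lower complex_eq_iff add_eq_0_iff)
  have w3: "a vb vc = 1"
    using orth[of va vb] V(2) by (simp add: sq diag zero tree w0 w1 w2 lower complex_eq_iff add_eq_0_iff)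
  have w4: "a vb vg = 1"
    using orth[of vb ve] V(2) by (simp add: sq diag zero tree w0 w1 w2 w3 lower complex_eq_iff add_eq_0_iff)
  have w5: "a vc vg = 1"
    using orth[of vc vf] V(2) by (simp add: sq diag zero tree w0 w1 w2 w3 w4 lower complex_eq_iff add_eq_0_iff)
  define g where "g p = (case p of Va \<Rightarrow> va | Vb \<Rightarrow> vb | Vc \<Rightarrow> vc | Vd \<Rightarrow> vd | Ve \<Rightarrow> ve | Vf \<Rightarrow> vf | _ \<Rightarrow> vg)" for p
  have S: "fst S_7 = [Va, Vb, Vc, Vd, Ve, Vf, Vg]" by (simp add: S_7_def)
  have "realizes n a S_7"
  proof (rule realizes_by_upper_triangle[OF _ weight_S_hermitian(3)])
    show "bij_betw g (set (fst S_7)) {..<n}"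
      unfolding S V(1) using V(2) by (auto simp: bij_betw_def g_def)
    show "upper_triangle (\<lambda>p q. a (g p) (g q) = weight (snd S_7) p q) (fst S_7)"
      unfolding S by (simp add: g_def S_7_def weight_def diag zero tree w0 w1 w2 w3 w4 w5)
  qed
  then show ?thesis unfolding listed_def by blast
qed

lemma S_7_listed:
  assumes V: "{..<n} = {va, vb, vc, vd, ve, vf, vg}" "distinct [va, vb, vc, vd, ve, vf, vg]"
    and ch: "gnorm (a vd vd) = 1" "a va va = - a vd vd" "a vb vb = 0" "a vc vc = 0" "a ve ve = - a vd vd" "a vf vf = - a vd vd" "a vg vg = 0"
    and zero: "a va ve = 0" "a va vf = 0" "a va vg = 0" "a vb vd = 0" "a vb vf = 0" "a vc vd = 0" "a vc ve = 0"
      "a vd vg = 0" "a ve vf = 0"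
    and tree: "gnorm (a vd va) = 1" "gnorm (a vd ve) = 1" "gnorm (a vd vf) = 1" "gnorm (a va vb) = 1" "gnorm (a va vc) = 1"
      "gnorm (a ve vg) = 1"
  shows "listed n a"
proof -
  have g1: "gnorm (1 :: complex) = 1" "gnorm (-1 :: complex) = 1" by (simp_all add: gnorm_unit)
  let ?T = "[(ve, vg, 1), (va, vc, -1), (va, vb, 1), (vd, vf, 1), (vd, ve, 1), (vd, va, 1)]"
  have key: "listed n x" if reg: "regular_graph n x" and c: "x vd vd = -1"
    and xch: "x va va = 1" "x vb vb = 0" "x vc vc = 0" "x ve ve = 1" "x vf vf = 1" "x vg vg = 0"
    and x0: "\<And>i j. x i j = 0 \<longleftrightarrow> a i j = 0" and xg: "\<And>i j. gnorm (x i j) = gnorm (a i j)" for x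
  proof -
    interpret x: regular_graph n x by (rule reg)
    show ?thesis
    proof (rule x.wlog_normalized[of ?T])
      show "tree_edges ?T" using V(2) by auto
      show "t \<in> gauss_ints \<and> gnorm t \<in> {1, 2} \<and> gnorm (x p q) = gnorm t" if "(p, q, t) \<in> set ?T" for p q t
        using that g1 tree by (auto simp: xg)
      fix y assume "regular_graph n y" and d: "\<And>i. y i i = x i i" and z: "\<And>i j. y i j = 0 \<longleftrightarrow> x i j = 0"
        and t: "\<And>p q t. (p, q, t) \<in> set ?T \<Longrightarrow> y p q = t"
      interpret y: regular_graph n y by fact
      have t': "y vd va = 1" "y vd ve = 1" "y vd vf = 1" "y va vb = 1" "y va vc = -1" "y ve vg = 1" using t by simp_all
      have t'': "y va vd = 1"
        using t' y.herm[of va vd] by simp_all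
      show "listed n y"
        by (rule y.S_7_normalized[OF V]) (simp_all only: d z x0 zero c xch t' t'')
    qed
  qed
  have "a vd vd = -1 \<or> a vd vd = 1" using ch(1) diag_cases[of vd] by auto
  then show ?thesis
  proof
    assume c: "a vd vd = -1"
    show ?thesis by (rule key[OF regular_graph_axioms c]) (simp_all add: ch c)
  next
    assume c: "a vd vd = 1"
    have "listed n (\<lambda>i j. - a i j)" by (rule key[OF regular_uminus]) (simp_all add: ch c)
    then show ?thesis by (rule listed_uminus)
  qed
qed

lemma S_8_normalized:
  assumes V: "{..<n} = {va, vb, vc, vd, ve, vf, vg, vh}" "distinct [va, vb, vc, vd, ve, vf, vg, vh]"
    and diag: "a va va = -1" "a vb vb = 1" "a vc vc = 1" "a vd vd = -1" "a ve ve = 1" "a vf vf = -1" "a vg vg = -1"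
      "a vh vh = 1"
    and zero: "a va vd = 0" "a va vf = 0" "a va vg = 0" "a va vh = 0" "a vb vc = 0" "a vb ve = 0" "a vb vg = 0"
      "a vb vh = 0" "a vc ve = 0" "a vc vf = 0" "a vc vh = 0" "a vd ve = 0" "a vd vf = 0" "a vd vg = 0"
      "a ve vh = 0" "a vf vg = 0"
    and tree: "a va vb = 1" "a vb vd = 1" "a vb vf = -1" "a va vc = -1" "a va ve = 1" "a vd vh = 1" "a vc vg = 1"
  shows "listed n a"
proof -
  note lower = herm[of vb va] herm[of vc va] herm[of vd va] herm[of ve va] herm[of vf va] herm[of vg va]
      herm[of vh va] herm[of vc vb] herm[of vd vb] herm[of ve vb] herm[of vf vb] herm[of vg vb]
      herm[of vh vb] herm[of vd vc] herm[of ve vc] herm[of vf vc] herm[of vg vc] herm[of vh vc]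
      herm[of ve vd] herm[of vf vd] herm[of vg vd] herm[of vh vd] herm[of vf ve] herm[of vg ve]
      herm[of vh ve] herm[of vg vf] herm[of vh vf] herm[of vh vg]
  have sq: "sq i j = a i va * a va j + a i vb * a vb j + a i vc * a vc j + a i vd * a vd j + a i ve * a ve j + a i vf * a vf j + a i vg * a vg j + a i vh * a vh j" for i j
    unfolding sq_def V(1) using V(2) by simp
  have w0: "a vc vd = 1"
    using orth[of vb vc] V(2) by (simp add: sq diag zero tree lower complex_eq_iff add_eq_0_iff)
  have w1: "a ve vf = 1"
    using orth[of vb ve] V(2) by (simp add: sq diag zero tree w0 lower complex_eq_iff add_eq_0_iff)
  have w2: "a vf vh = 1"
    using orth[of vb vh] V(2) by (simp add: sq diag zero tree w0 w1 lower complex_eq_iff add_eq_0_iff)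
  have w3: "a ve vg = 1"
    using orth[of va vg] V(2) by (simp add: sq diag zero tree w0 w1 w2 lower complex_eq_iff add_eq_0_iff)
  have w4: "a vg vh = -1"
    using orth[of vd vg] V(2) by (simp add: sq diag zero tree w0 w1 w2 w3 lower complex_eq_iff add_eq_0_iff)
  define g where "g p = (case p of Va \<Rightarrow> va | Vb \<Rightarrow> vb | Vc \<Rightarrow> vc | Vd \<Rightarrow> vd | Ve \<Rightarrow> ve | Vf \<Rightarrow> vf | Vg \<Rightarrow> vg | _ \<Rightarrow> vh)" for p
  have S: "fst S_8 = [Va, Vb, Vc, Vd, Ve, Vf, Vg, Vh]" by (simp add: S_8_def)
  have "realizes n a S_8"
  proof (rule realizes_by_upper_triangle[OF _ weight_S_hermitian(4)])
    show "bij_betw g (set (fst S_8)) {..<n}"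
      unfolding S V(1) using V(2) by (auto simp: bij_betw_def g_def)
    show "upper_triangle (\<lambda>p q. a (g p) (g q) = weight (snd S_8) p q) (fst S_8)"
      unfolding S by (simp add: g_def S_8_def weight_def diag zero tree w0 w1 w2 w3 w4)
  qed
  then show ?thesis unfolding listed_def by blast
qed

lemma S_8_listed:
  assumes V: "{..<n} = {va, vb, vc, vd, ve, vf, vg, vh}" "distinct [va, vb, vc, vd, ve, vf, vg, vh]"
    and ch: "gnorm (a vb vb) = 1" "a va va = - a vb vb" "a vc vc = a vb vb" "a vd vd = - a vb vb" "a ve ve = a vb vb" "a vf vf = - a vb vb" "a vg vg = - a vb vb" "a vh vh = a vb vb"
    and zero: "a va vd = 0" "a va vf = 0" "a va vg = 0" "a va vh = 0" "a vb vc = 0" "a vb ve = 0" "a vb vg = 0"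
      "a vb vh = 0" "a vc ve = 0" "a vc vf = 0" "a vc vh = 0" "a vd ve = 0" "a vd vf = 0" "a vd vg = 0"
      "a ve vh = 0" "a vf vg = 0"
    and tree: "gnorm (a vb va) = 1" "gnorm (a vb vd) = 1" "gnorm (a vb vf) = 1" "gnorm (a va vc) = 1" "gnorm (a va ve) = 1"
      "gnorm (a vd vh) = 1" "gnorm (a vc vg) = 1"
  shows "listed n a"
proof -
  have g1: "gnorm (1 :: complex) = 1" "gnorm (-1 :: complex) = 1" by (simp_all add: gnorm_unit)
  let ?T = "[(vc, vg, 1), (vd, vh, 1), (va, ve, 1), (va, vc, -1), (vb, vf, -1), (vb, vd, 1), (vb, va, 1)]"
  have key: "listed n x" if reg: "regular_graph n x" and c: "x vb vb = 1"
    and xch: "x va va = -1" "x vc vc = 1" "x vd vd = -1" "x ve ve = 1" "x vf vf = -1" "x vg vg = -1" "x vh vh = 1"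
    and x0: "\<And>i j. x i j = 0 \<longleftrightarrow> a i j = 0" and xg: "\<And>i j. gnorm (x i j) = gnorm (a i j)" for x
  proof -
    interpret x: regular_graph n x by (rule reg)
    show ?thesis
    proof (rule x.wlog_normalized[of ?T])
      show "tree_edges ?T" using V(2) by auto
      show "t \<in> gauss_ints \<and> gnorm t \<in> {1, 2} \<and> gnorm (x p q) = gnorm t" if "(p, q, t) \<in> set ?T" for p q t
        using that g1 tree by (auto simp: xg)
      fix y assume "regular_graph n y" and d: "\<And>i. y i i = x i i" and z: "\<And>i j. y i j = 0 \<longleftrightarrow> x i j = 0"
        and t: "\<And>p q t. (p, q, t) \<in> set ?T \<Longrightarrow> y p q = t"
      interpret y: regular_graph n y by fact
      have t': "y vb va = 1" "y vb vd = 1" "y vb vf = -1" "y va vc = -1" "y va ve = 1" "y vd vh = 1" "y vc vg = 1" using t by simp_all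
      have t'': "y va vb = 1"
        using t' y.herm[of va vb] by simp_all
      show "listed n y"
        by (rule y.S_8_normalized[OF V]) (simp_all only: d z x0 zero c xch t' t'')
    qed
  qed
  have "a vb vb = 1 \<or> a vb vb = -1" using ch(1) diag_cases[of vb] by auto
  then show ?thesis
  proof
    assume c: "a vb vb = 1"
    show ?thesis by (rule key[OF regular_graph_axioms c]) (simp_all add: ch c)
  next
    assume c: "a vb vb = -1"
    have "listed n (\<lambda>i j. - a i j)" by (rule key[OF regular_uminus]) (simp_all add: ch c)
    then show ?thesis by (rule listed_uminus)
  qed
qed

lemma S_8_prime_normalized:
  assumes V: "{..<n} = {va, vb, vc, vd, ve, vf, vg, vh}" "distinct [va, vb, vc, vd, ve, vf, vg, vh]"
    and diag: "a va va = -1" "a vb vb = 1" "a vc vc = 0" "a vd vd = 0" "a ve ve = 0" "a vf vf = 0"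
    and zero: "a va vd = 0" "a va vf = 0" "a va vg = 0" "a va vh = 0" "a vb vc = 0" "a vb ve = 0" "a vb vg = 0"
      "a vb vh = 0" "a vc vf = 0" "a vc vh = 0" "a vd ve = 0" "a vd vg = 0" "a ve vh = 0" "a vf vg = 0"
    and tree: "a va vc = 1" "a va ve = 1" "a va vb = 1" "a vb vd = 1" "a vb vf = -1" "a vc vg = 1" "a vd vh = 1"
  shows "listed n a"
proof -
  note lower = herm[of vb va] herm[of vc va] herm[of vd va] herm[of ve va] herm[of vf va] herm[of vg va]
      herm[of vh va] herm[of vc vb] herm[of vd vb] herm[of ve vb] herm[of vf vb] herm[of vg vb]
      herm[of vh vb] herm[of vd vc] herm[of ve vc] herm[of vf vc] herm[of vg vc] herm[of vh vc]
      herm[of ve vd] herm[of vf vd] herm[of vg vd] herm[of vh vd] herm[of vf ve] herm[of vg ve]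
      herm[of vh ve] herm[of vg vf] herm[of vh vf] herm[of vh vg]
  have sq: "sq i j = a i va * a va j + a i vb * a vb j + a i vc * a vc j + a i vd * a vd j + a i ve * a ve j + a i vf * a vf j + a i vg * a vg j + a i vh * a vh j" for i j
    unfolding sq_def V(1) using V(2) by simp
  have w0: "a vc ve = 1"
    using orth[of va vc] V(2) by (simp add: sq diag zero tree lower complex_eq_iff add_eq_0_iff)
  have w1: "a vd vf = 1"
    using orth[of vb vd] V(2) by (simp add: sq diag zero tree w0 lower complex_eq_iff add_eq_0_iff)
  have w2: "a vc vd = -1"
    using orth[of va vd] V(2) by (simp add: sq diag zero tree w0 w1 lower complex_eq_iff add_eq_0_iff)
  have w3: "a ve vf = 1"
    using orth[of va vf] V(2) by (simp add: sq diag zero tree w0 w1 w2 lower complex_eq_iff add_eq_0_iff)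
  have w4: "a ve vg = -1"
    using orth[of vc ve] V(2) by (simp add: sq diag zero tree w0 w1 w2 w3 lower complex_eq_iff add_eq_0_iff)
  have w5: "a vf vh = 1"
    using orth[of vd vf] V(2) by (simp add: sq diag zero tree w0 w1 w2 w3 w4 lower complex_eq_iff add_eq_0_iff)
  have w6: "a vg vh = 1"
    using orth[of vc vh] V(2) by (simp add: sq diag zero tree w0 w1 w2 w3 w4 w5 lower complex_eq_iff add_eq_0_iff)
  have w7: "a vg vg = 1"
    using orth[of vc vg] V(2) by (simp add: sq diag zero tree w0 w1 w2 w3 w4 w5 w6 lower complex_eq_iff add_eq_0_iff)
  have w8: "a vh vh = -1"
    using orth[of vd vh] V(2) by (simp add: sq diag zero tree w0 w1 w2 w3 w4 w5 w6 w7 lower complex_eq_iff add_eq_0_iff)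
  define g where "g p = (case p of Va \<Rightarrow> va | Vb \<Rightarrow> vb | Vc \<Rightarrow> vc | Vd \<Rightarrow> vd | Ve \<Rightarrow> ve | Vf \<Rightarrow> vf | Vg \<Rightarrow> vg | _ \<Rightarrow> vh)" for p
  have S: "fst S_8' = [Va, Vb, Vc, Vd, Ve, Vf, Vg, Vh]" by (simp add: S_8'_def)
  have "realizes n a S_8'"
  proof (rule realizes_by_upper_triangle[OF _ weight_S_hermitian(5)])
    show "bij_betw g (set (fst S_8')) {..<n}"
      unfolding S V(1) using V(2) by (auto simp: bij_betw_def g_def)
    show "upper_triangle (\<lambda>p q. a (g p) (g q) = weight (snd S_8') p q) (fst S_8')"
      unfolding S by (simp add: g_def S_8'_def weight_def diag zero tree w0 w1 w2 w3 w4 w5 w6 w7 w8)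
  qed
  then show ?thesis unfolding listed_def by blast
qed

lemma S_8_prime_listed:
  assumes V: "{..<n} = {va, vb, vc, vd, ve, vf, vg, vh}" "distinct [va, vb, vc, vd, ve, vf, vg, vh]"
    and ch: "gnorm (a va va) = 1" "a vb vb = - a va va" "a vc vc = 0" "a vd vd = 0" "a ve ve = 0" "a vf vf = 0"
    and zero: "a va vd = 0" "a va vf = 0" "a va vg = 0" "a va vh = 0" "a vb vc = 0" "a vb ve = 0" "a vb vg = 0"
      "a vb vh = 0" "a vc vf = 0" "a vc vh = 0" "a vd ve = 0" "a vd vg = 0" "a ve vh = 0" "a vf vg = 0"
    and tree: "gnorm (a va vc) = 1" "gnorm (a va ve) = 1" "gnorm (a va vb) = 1" "gnorm (a vb vd) = 1" "gnorm (a vb vf) = 1"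
      "gnorm (a vc vg) = 1" "gnorm (a vd vh) = 1"
  shows "listed n a"
proof -
  have g1: "gnorm (1 :: complex) = 1" "gnorm (-1 :: complex) = 1" by (simp_all add: gnorm_unit)
  let ?T = "[(vd, vh, 1), (vc, vg, 1), (vb, vf, -1), (vb, vd, 1), (va, vb, 1), (va, ve, 1), (va, vc, 1)]"
  have key: "listed n x" if reg: "regular_graph n x" and c: "x va va = -1"
    and xch: "x vb vb = 1" "x vc vc = 0" "x vd vd = 0" "x ve ve = 0" "x vf vf = 0"
    and x0: "\<And>i j. x i j = 0 \<longleftrightarrow> a i j = 0" and xg: "\<And>i j. gnorm (x i j) = gnorm (a i j)" for x
  proof -
    interpret x: regular_graph n x by (rule reg)
    show ?thesis
    proof (rule x.wlog_normalized[of ?T])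
      show "tree_edges ?T" using V(2) by auto
      show "t \<in> gauss_ints \<and> gnorm t \<in> {1, 2} \<and> gnorm (x p q) = gnorm t" if "(p, q, t) \<in> set ?T" for p q t
        using that g1 tree by (auto simp: xg)
      fix y assume "regular_graph n y" and d: "\<And>i. y i i = x i i" and z: "\<And>i j. y i j = 0 \<longleftrightarrow> x i j = 0"
        and t: "\<And>p q t. (p, q, t) \<in> set ?T \<Longrightarrow> y p q = t"
      interpret y: regular_graph n y by fact
      have t': "y va vc = 1" "y va ve = 1" "y va vb = 1" "y vb vd = 1" "y vb vf = -1" "y vc vg = 1" "y vd vh = 1" using t by simp_all
      show "listed n y"
        by (rule y.S_8_prime_normalized[OF V]) (simp_all only: d z x0 zero c xch t')
    qed
  qed
  have "a va va = -1 \<or> a va va = 1" using ch(1) diag_cases[of va] by auto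
  then show ?thesis
  proof
    assume c: "a va va = -1"
    show ?thesis by (rule key[OF regular_graph_axioms c]) (simp_all add: ch c)
  next
    assume c: "a va va = 1"
    have "listed n (\<lambda>i j. - a i j)" by (rule key[OF regular_uminus]) (simp_all add: ch c)
    then show ?thesis by (rule listed_uminus)
  qed
qed

end

context regular_graph
begin

lemma C4_final:
  assumes V: "{..<n} = {v, b, c, d}" "distinct [v, b, c, d]" and e: "e = 1 \<or> e = -1"
    and ch: "a v v = 1" "a b b = 1" "a c c = e" "a d d = e"
    and w: "a v b = 1" "a v c = 1" "a v d = 1" "a b c = -1" "a b d = -1" "a c d = - e"
  shows "listed n a"
proof -
  have low: "a b v = 1" "a c v = 1" "a d v = 1" "a c b = -1" "a d b = -1" "a d c = - e"
    using herm[of b v] herm[of c v] herm[of d v] herm[of c b] herm[of d b] herm[of d c] w e by auto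
  define f where "f p = (case p of Top i \<Rightarrow> if i = 1 then v else c | Bot i \<Rightarrow> if i = 1 then b else d | Apex \<Rightarrow> v)" for p
  have R: "rungs 2 = {Top 1, Bot 1, Top 2, Bot 2}"
    using set_ladder_vertices[of 2] by (simp add: ladder_vertices_small)
  have f: "f (Top 1) = v" "f (Bot 1) = b" "f (Top 2) = c" "f (Bot 2) = d" by (simp_all add: f_def)
  have inj: "inj_on f (rungs 2)" and img: "f ` rungs 2 = {..<n}"
    unfolding R V(1) using V(2) f by (auto simp: inj_on_def)
  have val: "a (f p) (f q) = (if rung p = 2 \<and> rung q = 2 then (if p = q then e else - e) else lw p q)"
    if "p \<in> rungs 2" "q \<in> rungs 2" for p q
    using that unfolding R by (elim insertE emptyE; simp add: f[simplified] ch w low)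
  from e show ?thesis
  proof
    assume "e = 1"
    then have "realizes n a (C_pp 2)"
      using realizes_ladder[OF _ inj img, of "C_pp 2"] val weight_C_pp[of 2] by (simp add: C_pp_def)
    then show ?thesis unfolding listed_def by blast
  next
    assume "e = -1"
    then have "realizes n a (C_pm 2)"
      using realizes_ladder[OF _ inj img, of "C_pm 2"] val weight_C_pm[of 2] by (simp add: C_pm_def)
    then show ?thesis unfolding listed_def by blast
  qed
qed

lemma S_4_dagger_final:
  assumes V: "{..<n} = {v, b, c, d}" "distinct [v, b, c, d]"
    and ch: "a v v = 1" "a b b = 0" "a c c = 0" "a d d = -1"
    and w: "a v b = 1" "a v c = 1" "a v d = 1" "a b c = -1 + \<i>" "a c d = \<i>" "a d b = \<i>"
  shows "listed n a"
proof -
  have low: "a b v = 1" "a c v = 1" "a d v = 1" "a c b = -1 - \<i>" "a d c = - \<i>" "a b d = - \<i>"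
    using herm[of b v] herm[of c v] herm[of d v] herm[of c b] herm[of d c] herm[of b d] w by (simp_all add: complex_eq_iff)
  define g where "g p = (case p of Va \<Rightarrow> v | Vb \<Rightarrow> c | Vc \<Rightarrow> d | _ \<Rightarrow> b)" for p
  define u where "u p = (case p of Vc \<Rightarrow> - \<i> | Vd \<Rightarrow> -1 | _ \<Rightarrow> 1)" for p
  have S: "fst S_4_dagger = [Va, Vb, Vc, Vd]" by (simp add: S_4_dagger_def)
  have "realizes n a S_4_dagger"
  proof (rule realizesI[of g _ _ u])
    show "bij_betw g (set (fst S_4_dagger)) {..<n}"
      unfolding S V(1) using V(2) by (auto simp: bij_betw_def g_def)
    show "unit (u p)" for p by (cases p) (simp_all add: u_def)
    fix p q assume "p \<in> set (fst S_4_dagger)" "q \<in> set (fst S_4_dagger)"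
    then have "p = Va \<or> p = Vb \<or> p = Vc \<or> p = Vd" "q = Va \<or> q = Vb \<or> q = Vc \<or> q = Vd" unfolding S by auto
    then show "a (g p) (g q) = u p * weight (snd S_4_dagger) p q * cnj (u q)"
      by (elim disjE; simp add: g_def u_def S_4_dagger_def weight_def ch w low complex_eq_iff)
  qed
  then show ?thesis unfolding listed_def by blast
qed

lemma star_orth:
  assumes "star v b c d" "j \<noteq> v"
  shows "a v v * a v j + a v b * a b j + a v c * a c j + a v d * a d j = 0"
  using sq_row4[of v b c d v j] orth[of v j] assms by (auto simp: star_def)

lemma star_row_full:
  assumes s: "star v p q r" and f: "gnorm (a p p) + gnorm (tri v p q) + gnorm (tri v r p) = 3" and m: "m \<notin> {v, p, q, r}"
  shows "a p m = 0"
proof (rule row_supp[of "{p, v, q, r}"])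
  show "deg p \<le> (\<Sum>k\<in>{p, v, q, r}. gnorm (a p k))"
    using s f deg4[of p] starD[OF s] gnorm_tri[of v p q] gnorm_tri[of v r p] gnorm_sym[of p r] by (auto simp: star_def)
qed (use m in auto)

lemma star_closed:
  assumes s: "star v b c d" and f: "gnorm (a b b) + gnorm (tri v b c) + gnorm (tri v d b) = 3"
   "gnorm (a c c) + gnorm (tri v c d) + gnorm (tri v b c) = 3" "gnorm (a d d) + gnorm (tri v d b) + gnorm (tri v c d) = 3"
  shows "{..<n} = {v, b, c, d}"
proof -
  have s': "star v c d b" "star v d b c" using s star_rotate by blast+
  have "{v, b, c, d} = {..<n}"
  proof (rule conn)
    show "{v, b, c, d} \<subseteq> {..<n}" using starD[OF s] by auto
    show "j \<in> {v, b, c, d}" if i: "i \<in> {v, b, c, d}" "a i j \<noteq> 0" for i j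
    proof (rule ccontr)
      assume j: "j \<notin> {v, b, c, d}"
      then have "a v j = 0" using s by (auto simp: star_def)
      moreover have "a b j = 0" by (rule star_row_full[OF s f(1)]) (use j in auto)
      moreover have "a c j = 0" by (rule star_row_full[OF s'(1) f(2)]) (use j in auto)
      moreover have "a d j = 0" by (rule star_row_full[OF s'(2) f(3)]) (use j in auto)
      ultimately show False using i by auto
    qed
  qed simp
  then show ?thesis by simp
qed

lemma star_normalized:
  assumes s: "star v b c d"
    and step: "\<And>x. regular_graph n x \<Longrightarrow> (\<And>i. x i i = a i i) \<Longrightarrow> (\<And>i j. x i j = 0 \<longleftrightarrow> a i j = 0) \<Longrightarrow>
      x v b = 1 \<Longrightarrow> x v c = 1 \<Longrightarrow> x v d = 1 \<Longrightarrow>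
      x b c = tri v b c \<Longrightarrow> x c d = tri v c d \<Longrightarrow> x d b = tri v d b \<Longrightarrow> listed n x"
  shows "listed n a"
proof (rule wlog_normalized[of "[(v, b, 1), (v, c, 1), (v, d, 1)]"])
  have g1: "gnorm (1 :: complex) = 1" by (simp add: gnorm_unit)
  show "tree_edges [(v, b, 1), (v, c, 1), (v, d, 1)]" using s by (auto simp: star_def)
  show "t \<in> gauss_ints \<and> gnorm t \<in> {1, 2} \<and> gnorm (a p q) = gnorm t"
    if "(p, q, t) \<in> set [(v, b, 1), (v, c, 1), (v, d, 1)]" for p q t
    using that s g1 by (auto simp: star_def)
  fix x assume "regular_graph n x" and z: "\<And>i j. x i j = 0 \<longleftrightarrow> a i j = 0" and d: "\<And>i. x i i = a i i"
    and tr: "\<And>i j k. x i j * x j k * x k i = a i j * a j k * a k i"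
    and t: "\<And>p c' t. (p, c', t) \<in> set [(v, b, 1), (v, c, 1), (v, d, 1)] \<Longrightarrow> x p c' = t"
  interpret x: regular_graph n x by fact
  have t': "x v b = 1" "x v c = 1" "x v d = 1" using t by auto
  then have "x b v = 1" "x c v = 1" "x d v = 1" using x.herm[of b v] x.herm[of c v] x.herm[of d v] by simp_all
  then show "listed n x"
    using step[of x] x.regular_graph_axioms d z t' tr[of v b c] tr[of v c d] tr[of v d b] by (simp add: tri_def)
qed

lemma listed_or_branching:
  assumes v: "a v v = 1" and s: "star v b c d"
    and T: "(tri v b c, tri v c d, tri v d b) \<in> {(-1,-1,-1), (1,-1,-1), (-1,-1,0),
      (\<i>,\<i>,\<i>), (-1+\<i>,\<i>,\<i>)}"
  shows "listed n a"
proof -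
  have "gnorm (\<i> - 1) = 2" using gnorm_of_ints[of "\<i> - 1" "-1" 1] by simp
  then have g: "gnorm (1 :: complex) = 1" "gnorm (-1 :: complex) = 1" "gnorm \<i> = 1" "gnorm (\<i> - 1) = 2"
    by (simp_all add: gnorm_unit)
  have dist: "distinct [v, b, c, d]" using s by (simp add: star_def)
  have s': "star v c d b" "star v d b c" using s star_rotate by blast+
  have ch: "a b b = - (1 + cnj (tri v b c) + tri v d b)" "a c c = - (1 + cnj (tri v c d) + tri v b c)"
    "a d d = - (1 + cnj (tri v d b) + tri v c d)"
    using star_charge[OF s] star_charge[OF s'(1)] star_charge[OF s'(2)] v tri_cnj[of v c b] tri_cnj[of v d c] tri_cnj[of v b d]
    by simp_all
  consider (A) "tri v b c = -1" "tri v c d = -1" "tri v d b = -1" | (B) "tri v b c = 1" "tri v c d = -1" "tri v d b = -1"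
    | (C) "tri v b c = -1" "tri v c d = -1" "tri v d b = 0" | (E) "tri v b c = \<i>" "tri v c d = \<i>" "tri v d b = \<i>"
    | (F) "tri v b c = -1 + \<i>" "tri v c d = \<i>" "tri v d b = \<i>"
    using T by auto
  then show ?thesis
  proof cases
    case A
    then have ch': "a b b = 1" "a c c = 1" "a d d = 1" unfolding ch by simp_all
    have V: "{..<n} = {v, b, c, d}" by (rule star_closed[OF s]) (simp_all add: A ch' g)
    show ?thesis
    proof (rule star_normalized[OF s])
      fix x assume "regular_graph n x" and d: "\<And>i. x i i = a i i" and w: "x v b = 1" "x v c = 1" "x v d = 1"
        "x b c = tri v b c" "x c d = tri v c d" "x d b = tri v d b"
      interpret x: regular_graph n x by fact
      show "listed n x"
        by (rule x.C4_final[OF V dist, of 1]) (use w A d ch' v x.herm[of b d] in auto)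
    qed
  next
    case B
    then have ch': "a b b = -1" "a c c = -1" "a d d = 1" unfolding ch by simp_all
    have V: "{..<n} = {v, b, c, d}" by (rule star_closed[OF s]) (simp_all add: B ch' g)
    have V': "{..<n} = {v, d, b, c}" "distinct [v, d, b, c]" using V dist by auto
    show ?thesis
    proof (rule star_normalized[OF s])
      fix x assume "regular_graph n x" and d: "\<And>i. x i i = a i i" and w: "x v b = 1" "x v c = 1" "x v d = 1"
        "x b c = tri v b c" "x c d = tri v c d" "x d b = tri v d b"
      interpret x: regular_graph n x by fact
      show "listed n x"
        by (rule x.C4_final[OF V', of "-1"]) (use w B d ch' v x.herm[of d c] in auto)
    qed
  next
    case C
    then have ch': "a b b = 0" "a c c = 1" "a d d = 0" unfolding ch by simp_all
    show ?thesis
    proof (rule star_normalized[OF s])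
      fix x assume "regular_graph n x" and d: "\<And>i. x i i = a i i" and w: "x v b = 1" "x v c = 1" "x v d = 1"
        "x b c = tri v b c" "x c d = tri v c d" "x d b = tri v d b"
      interpret x: regular_graph n x by fact
      have low: "x b v = 1" "x c v = 1" "x d v = 1" "x c b = -1" "x d c = -1" "x b d = 0"
        using x.herm[of b v] x.herm[of c v] x.herm[of d v] x.herm[of c b] x.herm[of d c] x.herm[of b d] w C by simp_all
      define f where "f p = (case p of Top i \<Rightarrow> if i = 1 then v else b | Bot i \<Rightarrow> if i = 1 then c else d | Apex \<Rightarrow> v)" for p
      have R: "rungs 2 = {Top 1, Bot 1, Top 2, Bot 2}"
        using set_ladder_vertices[of 2] by (simp add: ladder_vertices_small)
      have f: "f (Top 1) = v" "f (Bot 1) = c" "f (Top 2) = b" "f (Bot 2) = d" by (simp_all add: f_def)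
      have "lad n x 2 f" unfolding lad_def
      proof (intro conjI ballI)
        show "inj_on f (rungs 2)" unfolding R using dist f by (auto simp: inj_on_def)
        show "f ` rungs 2 \<subseteq> {..<n}" unfolding R using starD[OF s] f by auto
        fix p q assume "p \<in> rungs 2" "q \<in> rungs 2"
        then show "x (f p) (f q) = lw p q" unfolding R
          by (elim insertE emptyE; simp add: f[simplified] w low C d ch' v)
      qed
      then show "listed n x" using listed_if_ladder x.regular_graph_axioms by blast
    qed
  next
    case E
    then have ch': "a b b = -1" "a c c = -1" "a d d = -1" unfolding ch by simp_all
    have V: "{..<n} = {v, b, c, d}" by (rule star_closed[OF s]) (simp_all add: E ch' g)
    show ?thesis
    proof (rule star_normalized[OF s])
      fix x assume "regular_graph n x" and d: "\<And>i. x i i = a i i" and w: "x v b = 1" "x v c = 1" "x v d = 1"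
        "x b c = tri v b c" "x c d = tri v c d" "x d b = tri v d b"
      interpret x: regular_graph n x by fact
      have low: "x b v = 1" "x d c = - \<i>" "x b d = - \<i>"
        using x.herm[of b v] x.herm[of d c] x.herm[of b d] w E by simp_all
      have "x.sq b c = x b v * x v c + x b b * x b c + x b c * x c c + x b d * x d c"
        unfolding x.sq_def V using dist by simp
      then have "x b v * x v c + x b b * x b c + x b c * x c c + x b d * x d c = 0"
        using x.orth[of b c] dist by simp
      then show "listed n x" using low w E d ch' by (simp add: complex_eq_iff)
    qed
  next
    case F
    then have ch': "a b b = 0" "a c c = 0" "a d d = -1" unfolding ch by (simp_all add: complex_eq_iff)
    have V: "{..<n} = {v, b, c, d}" by (rule star_closed[OF s]) (simp_all add: F ch' g)
    show ?thesis
    proof (rule star_normalized[OF s])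
      fix x assume "regular_graph n x" and d: "\<And>i. x i i = a i i" and w: "x v b = 1" "x v c = 1" "x v d = 1"
        "x b c = tri v b c" "x c d = tri v c d" "x d b = tri v d b"
      interpret x: regular_graph n x by fact
      show "listed n x"
        by (rule x.S_4_dagger_final[OF V dist]) (simp_all add: w F d ch' v)
    qed
  qed
qed

end

context gauss_form
begin

definition star3 :: "nat \<Rightarrow> nat \<Rightarrow> nat \<Rightarrow> nat \<Rightarrow> bool" where
  "star3 v b c d \<longleftrightarrow> star v b c d \<and> gnorm (a v v) = 1 \<and> a b b = - a v v \<and> a c c = - a v v \<and> a d d = - a v v \<and>
     a b c = 0 \<and> a c d = 0 \<and> a d b = 0"

definition star4 :: "nat \<Rightarrow> nat \<Rightarrow> nat \<Rightarrow> nat \<Rightarrow> bool" where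
  "star4 v b c d \<longleftrightarrow> star v b c d \<and> gnorm (a v v) = 1 \<and> a b b = 0 \<and> a c c = 0 \<and> a d d = - a v v \<and>
     gnorm (a b c) = 1 \<and> a c d = 0 \<and> a d b = 0"

lemma star_swap: "star v b c d \<Longrightarrow> star v c b d"
  by (auto simp: star_def)

lemma star3_permute: "star3 v b c d \<Longrightarrow> star3 v c d b" "star3 v b c d \<Longrightarrow> star3 v c b d"
  unfolding star3_def using star_rotate star_swap nonzero_sym by blast+

lemma star4_swap: "star4 v b c d \<Longrightarrow> star4 v c b d"
  unfolding star4_def using star_swap gnorm_sym nonzero_sym by metis

end

lemma three_units_sum: "unit p \<Longrightarrow> unit q \<Longrightarrow> unit r \<Longrightarrow> p + q + r \<noteq> 0"
proof
  assume u: "unit p" "unit q" "unit r" and s: "p + q + r = 0"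
  have v: "z = 1 \<or> z = -1 \<or> z = \<i> \<or> z = - \<i>" if "unit z" for z
    using that gnorm_cases[of z] gnorm_unit[of z] by (auto simp: unit_def)
  show False using v[OF u(1)] v[OF u(2)] v[OF u(3)] s
    by (elim disjE; simp add: complex_eq_iff)
qed

lemma sum_with_unit:
  assumes s: "x + y + z = 0" and g: "x \<in> gauss_ints" "y \<in> gauss_ints" "z \<in> gauss_ints"
    and z: "gnorm z = 1" and n: "gnorm x + gnorm y \<le> 2"
  shows "gnorm x = 1 \<and> y = 0 \<or> x = 0 \<and> gnorm y = 1"
proof -
  consider "x = 0" | "y = 0" | "gnorm x = 1" "gnorm y = 1"
    using n gnorm_eq_0[OF g(1)] gnorm_eq_0[OF g(2)] by linarith
  then show ?thesis
  proof cases
    case 1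
    then have "y = - z" using s by (simp add: eq_neg_iff_add_eq_0)
    then show ?thesis using 1 z by simp
  next
    case 2
    then have "x = - z" using s by (simp add: eq_neg_iff_add_eq_0)
    then show ?thesis using 2 z by simp
  next
    case 3
    then show ?thesis using three_units_sum[of x y z] s g z by (simp add: unit_iff_gnorm)
  qed
qed

context regular_graph
begin

lemma charged_unit_cases:
  assumes nl: "\<not> listed n a" and v: "a v v = 1"
  obtains b c d where "star3 v b c d \<or> star4 v b c d"
proof -
  have g1: "gnorm (1 :: complex) = 1" "gnorm (-1 :: complex) = 1" by (simp_all add: gnorm_unit)
  have vn: "v < n" using less_n[of v v] v by simp
  have deg: "(\<Sum>k\<in>S. gnorm (a v k)) \<le> 4" if "finite S" for S
    using deg_ge[OF that, of v] deg4[OF vn] by simp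
  have n2: "gnorm (a v m) \<noteq> 2" for m using listed_if_norm_two_neighbour[OF v, of m] nl by blast
  obtain b where b: "b \<notin> {v}" "a v b \<noteq> 0" using pick_nbr[of "{v}" v] deg4[OF vn] v g1 by auto
  have "gnorm (a v b) \<le> 3" using deg[of "{v, b}"] v b g1 by simp
  then have gb: "gnorm (a v b) = 1" using n2[of b] gnorm_not_3[of v b] gnorm_pos[OF b(2)] by linarith
  obtain c where c: "c \<notin> {v, b}" "a v c \<noteq> 0" using pick_nbr[of "{v, b}" v] deg4[OF vn] v b gb g1 by auto
  have "gnorm (a v c) \<le> 2" using deg[of "{v, b, c}"] v b c gb g1 by simp
  then have gc: "gnorm (a v c) = 1" using n2[of c] gnorm_pos[OF c(2)] by linarith
  obtain d where d: "d \<notin> {v, b, c}" "a v d \<noteq> 0" using pick_nbr[of "{v, b, c}" v] deg4[OF vn] v b c gb gc g1 by auto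
  have "gnorm (a v d) \<le> 1" using deg[of "{v, b, c, d}"] v b c d gb gc g1 by simp
  then have gd: "gnorm (a v d) = 1" using gnorm_pos[OF d(2)] by linarith
  have "a v m = 0" if "m \<notin> {v, b, c, d}" for m
    by (rule row_supp[of "{v, b, c, d}"]) (use deg4[OF vn] v b c d gb gc gd g1 that in auto)
  then have "star v b c d" using b c d gb gc gd by (auto simp: star_def)
  then obtain b c d where s: "star v b c d"
    "(tri v b c, tri v c d, tri v d b) \<in> {(-1,-1,-1), (1,-1,-1), (-1,-1,0), (-1,0,0), (0,0,0),
      (\<i>,\<i>,\<i>), (-\<i>,-\<i>,-\<i>), (-1+\<i>,\<i>,\<i>), (-1-\<i>,-\<i>,-\<i>)}"
    using star_types[OF v] by metis
  have s': "star v c d b" "star v d b c" using s(1) star_rotate by blast+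
  have not1: "(tri v b c, tri v c d, tri v d b) \<notin> {(-1,-1,-1), (1,-1,-1), (-1,-1,0), (\<i>,\<i>,\<i>), (-1+\<i>,\<i>,\<i>)}"
    using listed_or_branching[OF v s(1)] nl by blast
  have not2: "(cnj (tri v b c), cnj (tri v c d), cnj (tri v d b)) \<notin> {(-1,-1,-1), (1,-1,-1), (-1,-1,0), (\<i>,\<i>,\<i>), (-1+\<i>,\<i>,\<i>)}"
  proof
    assume A: "(cnj (tri v b c), cnj (tri v c d), cnj (tri v d b)) \<in> {(-1,-1,-1), (1,-1,-1), (-1,-1,0), (\<i>,\<i>,\<i>), (-1+\<i>,\<i>,\<i>)}"
    interpret c: regular_graph n "\<lambda>i j. cnj (a i j)" by (rule regular_cnj)
    have "c.star v b c d" using s(1) by (simp add: c.star_def star_def)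
    moreover have "c.tri v p q = cnj (tri v p q)" for p q by (simp add: c.tri_def tri_def)
    ultimately have "listed n (\<lambda>i j. cnj (a i j))"
      using c.listed_or_branching[of v b c d] v A by simp
    then show False using listed_cnj nl by blast
  qed
  have T: "(tri v b c, tri v c d, tri v d b) \<in> {(-1,0,0), (0,0,0)}"
    using s(2) by (elim insertE emptyE) (use not1 not2 in simp_all)
  have ch: "a b b = - (1 + cnj (tri v b c) + tri v d b)" "a c c = - (1 + cnj (tri v c d) + tri v b c)"
    "a d d = - (1 + cnj (tri v d b) + tri v c d)"
    using star_charge[OF s(1)] star_charge[OF s'(1)] star_charge[OF s'(2)] v tri_cnj[of v c b] tri_cnj[of v d c] tri_cnj[of v b d]
    by simp_all
  have gu: "gnorm (a v b) = 1" "gnorm (a v c) = 1" "gnorm (a v d) = 1" using s(1) by (auto simp: star_def)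
  have z: "tri v b c = 0 \<longleftrightarrow> a b c = 0" "tri v c d = 0 \<longleftrightarrow> a c d = 0" "tri v d b = 0 \<longleftrightarrow> a d b = 0"
    using gu by (simp_all add: tri_eq_0_iff)
  from T consider "tri v b c = -1" "tri v c d = 0" "tri v d b = 0" | "tri v b c = 0" "tri v c d = 0" "tri v d b = 0" by auto
  then have "star3 v b c d \<or> star4 v b c d"
  proof cases
    case 1
    have "gnorm (a b c) = 1" using gnorm_tri[OF gu(1,2)] 1 g1 by simp
    then show ?thesis using s(1) 1 z v g1 unfolding star4_def ch by simp
  next
    case 2
    then show ?thesis using s(1) z v g1 unfolding star3_def ch by simp
  qed
  then show thesis by (rule that)
qed

lemma listed_if_charge_2:
  assumes i: "i < n" "a i i \<noteq> 0" "gnorm (a i i) \<noteq> 1"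
  shows "listed n a"
proof -
  have "gnorm (1 :: complex) = 1" "gnorm (-1 :: complex) = 1" by (simp_all add: gnorm_unit)
  then have g: "gnorm (a i i) \<ge> 4" using diag_cases[of i] i by auto
  have "a i m = 0" if "m \<noteq> i" for m
    by (rule row_supp[of "{i}"]) (use deg4[OF i(1)] g that in auto)
  then have "realizes n a S_1" by (rule S_1_if_isolated[OF i(1)])
  then show ?thesis unfolding listed_def by blast
qed

end

locale unlisted_graph = regular_graph +
  assumes unlisted: "\<not> listed n a"
begin

lemma charged_cases:
  assumes v: "gnorm (a v v) = 1"
  obtains b c d where "star3 v b c d" | b c d where "star4 v b c d"
proof (cases "a v v = 1")
  case True
  obtain b c d where "star3 v b c d \<or> star4 v b c d" by (rule charged_unit_cases[OF unlisted True])
  then show thesis using that(1)[of b c d] that(2)[of b c d] by argo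
next
  case False
  then have m: "a v v = -1" using diag_cases[of v] v by auto
  interpret m: regular_graph n "\<lambda>i j. - a i j" by (rule regular_uminus)
  have nl: "\<not> listed n (\<lambda>i j. - a i j)" using listed_uminus unlisted by blast
  have mv: "- a v v = 1" using m by simp
  obtain b c d where "m.star3 v b c d \<or> m.star4 v b c d" by (rule m.charged_unit_cases[OF nl mv])
  moreover have st: "m.star v b c d \<longleftrightarrow> star v b c d" by (simp add: m.star_def star_def)
  have "m.star3 v b c d \<longleftrightarrow> star3 v b c d" by (simp add: m.star3_def star3_def st m)
  moreover have "m.star4 v b c d \<longleftrightarrow> star4 v b c d"
    by (simp add: m.star4_def star4_def st m)
  ultimately show thesis using that(1)[of b c d] that(2)[of b c d] by argo
qed

lemma charged_star:
  assumes "gnorm (a v v) = 1"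
  obtains b c d where "star v b c d"
  using assms
proof (cases rule: charged_cases)
  case (1 b c d)
  then show thesis using that[of b c d] by (simp add: star3_def)
next
  case (2 b c d)
  then show thesis using that[of b c d] by (simp add: star4_def)
qed

lemma charged_weight:
  assumes v: "gnorm (a v v) = 1" and m: "m \<noteq> v"
  shows "a v m = 0 \<or> gnorm (a v m) = 1" "a m v = 0 \<or> gnorm (a m v) = 1"
proof -
  obtain b c d where "star v b c d" using charged_star[OF v] .
  then show "a v m = 0 \<or> gnorm (a v m) = 1" using m by (auto simp: star_def)
  then show "a m v = 0 \<or> gnorm (a m v) = 1" using nonzero_sym gnorm_sym by metis
qed

lemma star_row: "star v b c d \<Longrightarrow> m \<notin> {v, b, c, d} \<Longrightarrow> a v m = 0"
  by (simp add: star_def)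

lemma star_exactly_one:
  assumes s: "star v b c d" and j: "j \<notin> {v, b, c, d}" and g: "gnorm (a d j) = 1" and n: "gnorm (a b j) + gnorm (a c j) \<le> 2"
  shows "gnorm (a b j) = 1 \<and> a c j = 0 \<or> a b j = 0 \<and> gnorm (a c j) = 1"
proof -
  have sum: "a v b * a b j + a v c * a c j + a v d * a d j = 0"
    using star_orth[OF s, of j] star_row[OF s j] j by simp
  have u: "gnorm (a v b) = 1" "gnorm (a v c) = 1" "gnorm (a v d) = 1" using s by (auto simp: star_def)
  have G: "gnorm (a v b * a b j) = gnorm (a b j)" "gnorm (a v c * a c j) = gnorm (a c j)" "gnorm (a v d * a d j) = 1"
    using u g by (simp_all add: gnorm_mult gauss)
  have "gnorm (a v b * a b j) = 1 \<and> a v c * a c j = 0 \<or> a v b * a b j = 0 \<and> gnorm (a v c * a c j) = 1"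
    by (rule sum_with_unit[OF sum]) (use G n in \<open>auto simp: gauss gauss_ints_closed\<close>)
  then show ?thesis using G starD[OF s] by auto
qed

text \<open>At a charged vertex all edges are units, so the norm hypothesis of \<open>star_exactly_one\<close> is automatic.\<close>

lemma star_exactly_one':
  assumes s: "star v b c d" and j: "j \<notin> {v, b, c, d}" and nz: "a d j \<noteq> 0"
    and ch: "gnorm (a j j) = 1 \<or> gnorm (a b b) = 1 \<and> gnorm (a c c) = 1 \<and> gnorm (a d d) = 1"
  shows "a b j \<noteq> 0 \<and> a c j = 0 \<or> a b j = 0 \<and> a c j \<noteq> 0"
proof -
  have ne: "j \<noteq> b" "j \<noteq> c" "j \<noteq> d" using j by auto
  have u: "a p j = 0 \<or> gnorm (a p j) = 1" if "p \<in> {b, c, d}" for p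
    using ch charged_weight(2)[of j p] charged_weight(1)[of p j] ne that by auto
  have "gnorm (a b j) \<le> 1" "gnorm (a c j) \<le> 1" "gnorm (a d j) = 1" using u nz by force+
  then show ?thesis using star_exactly_one[OF s j] by auto
qed

lemma star3_if_two_charged:
  assumes v: "gnorm (a v v) = 1" and p: "a v p \<noteq> 0" "a p p \<noteq> 0" "p \<noteq> v" and q: "a v q \<noteq> 0" "a q q \<noteq> 0" "q \<noteq> v" and pq: "p \<noteq> q"
  obtains r where "star3 v p q r"
  using v
proof (cases rule: charged_cases)
  case (1 b c d)
  then have "p \<in> {b, c, d}" "q \<in> {b, c, d}" using p q star_row[of v b c d] by (auto simp: star3_def)
  then show thesis using 1 pq that star3_permute by (elim insertE emptyE) blast+
next
  case (2 b c d)
  then have "p \<in> {b, c, d}" "q \<in> {b, c, d}" "a b b = 0" "a c c = 0" using p q star_row[of v b c d] by (auto simp: star4_def)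
  then show thesis using p q pq by auto
qed

lemma star3_exchange:
  assumes "star3 v b c d" "a v p \<noteq> 0" "p \<noteq> v"
  obtains q r where "star3 v p q r"
proof -
  have "p \<in> {b, c, d}" using assms star_row[of v b c d] by (auto simp: star3_def)
  then show thesis using assms(1) that star3_permute by (elim insertE emptyE) blast+
qed

lemma star4_exchange:
  assumes "star4 v b c d" "a v p \<noteq> 0" "p \<noteq> v" "a p p = 0"
  obtains q where "star4 v p q d"
proof -
  have "p \<in> {b, c, d}" "a d d \<noteq> 0" using assms star_row[of v b c d] by (auto simp: star4_def)
  then have "p = b \<or> p = c" using assms by auto
  then show thesis using assms(1) that star4_swap by blast
qed

lemma star4_charged:
  assumes "star4 v b c d" "a v p \<noteq> 0" "p \<noteq> v" "a p p \<noteq> 0"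
  shows "p = d"
  using assms star_row[of v b c d] by (auto simp: star4_def)

text \<open>Two adjacent centres of \<open>star3\<close> would generate the cube \<open>S_8\<close>.\<close>

lemma no_star3_star3_aux:
  assumes v: "star3 v b c d" and b: "star3 b v e f" and ce: "a c e \<noteq> 0"
  shows False
proof -
  have sv: "star v b c d" and sb: "star b v e f" using v b by (auto simp: star3_def)
  define \<epsilon> where "\<epsilon> = a v v"
  have eps: "gnorm \<epsilon> = 1" "\<epsilon> \<noteq> 0" using v by (auto simp: star3_def \<epsilon>_def)
  have ch: "a v v = \<epsilon>" "a b b = - \<epsilon>" "a c c = - \<epsilon>" "a d d = - \<epsilon>" "a e e = \<epsilon>" "a f f = \<epsilon>"
    using v b by (auto simp: star3_def \<epsilon>_def)
  have diff: "p \<noteq> q" "q \<noteq> p" if "a p p = \<epsilon>" "a q q = - \<epsilon>" for p q using that eps by auto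
  have dv: "distinct [v, b, c, d]" and db: "distinct [b, v, e, f]" using sv sb by (auto simp: star_def)
  have ene: "e \<notin> {v, b, c, d}" and fne: "f \<notin> {v, b, c, d}" using db diff ch by auto
  have cne: "c \<notin> {b, v, e, f}" and dne: "d \<notin> {b, v, e, f}" using dv diff ch by auto
  have charged: "gnorm (a p p) = 1" if "p \<in> {v, b, c, d, e, f}" for p using that ch eps by auto
  have svr: "star v c d b" "star v d b c" using sv star_rotate by blast+
  have sbr: "star b e f v" "star b f v e" using sb star_rotate by blast+
  have be: "a b e \<noteq> 0" "a b f \<noteq> 0" using starD[OF sb] by auto
  have "a c e \<noteq> 0 \<and> a d e = 0 \<or> a c e = 0 \<and> a d e \<noteq> 0"
    by (rule star_exactly_one'[OF svr(1)]) (use ene be charged in auto)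
  then have de: "a d e = 0" using ce by blast
  have "a e c \<noteq> 0 \<and> a f c = 0 \<or> a e c = 0 \<and> a f c \<noteq> 0"
    by (rule star_exactly_one'[OF sbr(1)]) (use cne starD[OF sv] charged in auto)
  then have cf: "a c f = 0" using ce nonzero_sym by blast
  have "a c f \<noteq> 0 \<and> a d f = 0 \<or> a c f = 0 \<and> a d f \<noteq> 0"
    by (rule star_exactly_one'[OF svr(1)]) (use fne be charged in auto)
  then have df: "a d f \<noteq> 0" using cf by blast
  have nz: "a v v \<noteq> 0" "a b b \<noteq> 0" "a c c \<noteq> 0" "a d d \<noteq> 0" "a e e \<noteq> 0" "a f f \<noteq> 0" using ch eps by auto
  obtain g where g: "star3 c v e g"
    by (rule star3_if_two_charged[of c v e]) (use charged nz starD[OF sv] ce ene cne db dv in auto)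
  obtain g' where g': "star3 d v f g'"
    by (rule star3_if_two_charged[of d v f]) (use charged nz starD[OF sv] df fne dne db dv in auto)
  have sc: "star c v e g" and sd: "star d v f g'" using g g' by (auto simp: star3_def)
  have cg: "a c g \<noteq> 0" "a g g = \<epsilon>" using starD[OF sc] g ch by (auto simp: star3_def)
  have dc: "distinct [c, v, e, g]" using sc by (simp add: star_def)
  have gne: "g \<notin> {v, b, c, d}" using dc diff ch cg by auto
  have gf: "g \<noteq> f" using cg cf by auto
  have bg: "a b g = 0" by (rule star_row[OF sb]) (use gne gf dc in auto)
  have "a d g \<noteq> 0 \<and> a b g = 0 \<or> a d g = 0 \<and> a b g \<noteq> 0"
    by (rule star_exactly_one'[OF svr(2)])
      (use gne cg charged in auto)
  then have dg: "a d g \<noteq> 0" using bg by blast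
  then have gg': "g' = g" using star_row[OF sd, of g] gne gf by auto
  obtain h where h: "star3 e b c h"
    by (rule star3_if_two_charged[of e b c]) (use charged nz be ce nonzero_sym[of e b] nonzero_sym[of e c] ene dv in auto)
  have se: "star e b c h" using h by (auto simp: star3_def)
  have eh: "a e h \<noteq> 0" "a h h = - \<epsilon>" using starD[OF se] h ch by (auto simp: star3_def)
  have hd: "h \<noteq> d" using eh de nonzero_sym[of e d] by auto
  have dise: "distinct [e, b, c, h]" using se by (simp add: star_def)
  have hne: "h \<noteq> v" "h \<noteq> e" "h \<noteq> f" "h \<noteq> g" "h \<noteq> b" "h \<noteq> c" using diff ch cg eh dise by auto
  have vh: "a v h = 0" by (rule star_row[OF sv]) (use hne hd in auto)
  have hc: "gnorm (a h h) = 1" "gnorm (a g g) = 1" using eh cg eps by auto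
  have "a f h \<noteq> 0 \<and> a v h = 0 \<or> a f h = 0 \<and> a v h \<noteq> 0"
    by (rule star_exactly_one'[OF sbr(2)])
      (use hne eh hc in auto)
  then have fh: "a f h \<noteq> 0" using vh by blast
  have "a g h \<noteq> 0 \<and> a v h = 0 \<or> a g h = 0 \<and> a v h \<noteq> 0"
    by (rule star_exactly_one'[OF star_rotate[OF star_rotate[OF sc]]]) (use hne eh hc in auto)
  then have gh: "a g h \<noteq> 0" using vh by blast
  obtain r where r: "star3 f b d r"
    by (rule star3_if_two_charged[of f b d]) (use charged nz be df nonzero_sym[of f b] nonzero_sym[of f d] fne dv in auto)
  have sf: "star f b d r" using r by (auto simp: star3_def)
  then have sf: "star f b d h" using star_row[OF sf, of h] fh hne hd by auto
  obtain r' where r': "star3 g c d r'"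
    by (rule star3_if_two_charged[of g c d]) (use hc charged nz cg dg nonzero_sym[of g c] nonzero_sym[of g d] gne dv in auto)
  have sg: "star g c d r'" using r' by (auto simp: star3_def)
  then have sg: "star g c d h" using star_row[OF sg, of h] gh hne hd by auto
  obtain r'' where r'': "star3 h e f r''"
    by (rule star3_if_two_charged[of h e f]) (use hc charged nz eh fh nonzero_sym[of h e] nonzero_sym[of h f] hne db in auto)
  have sh: "star h e f r''" using r'' by (auto simp: star3_def)
  then have sh: "star h e f g" using star_row[OF sh, of g] gh nonzero_sym[of h g] hne gf dc by auto
  have sd: "star d v f g" using sd gg' by simp
  have dist: "distinct [b, v, e, c, f, d, h, g]"
    using dv db dc dise hne hd gne gf ene fne cne dne by auto
  then have dist': "distinct [g, h, d, f, c, e, v, b]" by auto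
  have "{b, v, e, c, f, d, h, g} = {..<n}"
  proof (rule conn)
    show "{b, v, e, c, f, d, h, g} \<subseteq> {..<n}"
      using starD[OF sv] starD[OF sb] starD[OF sh] by auto
    show "j \<in> {b, v, e, c, f, d, h, g}" if "i \<in> {b, v, e, c, f, d, h, g}" "a i j \<noteq> 0" for i j
      using that star_row[OF sv, of j] star_row[OF sb, of j] star_row[OF sc, of j] star_row[OF sd, of j]
        star_row[OF se, of j] star_row[OF sf, of j] star_row[OF sg, of j] star_row[OF sh, of j] by blast
  qed simp
  then have V: "{..<n} = {b, v, e, c, f, d, h, g}" by simp
  have "listed n a"
    by (rule S_8_listed[OF V dist])
      (use dist dist' eps charged ch eh cg sv sb sc sd se sf sg sh in \<open>simp_all add: star_def\<close>)
  then show False using unlisted by blast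
qed

lemma no_star3_star3:
  assumes v: "star3 v b c d" and b: "star3 b v e f"
  shows False
proof -
  have sv: "star v b c d" and sb: "star b v e f" using v b by (auto simp: star3_def)
  have ch: "gnorm (a v v) = 1" "a c c = - a v v" "a e e = a v v" "a f f = a v v"
    using v b by (auto simp: star3_def)
  then have c: "c \<notin> {b, v, e, f}" using sv by (auto simp: star_def)
  have "a e c \<noteq> 0 \<and> a f c = 0 \<or> a e c = 0 \<and> a f c \<noteq> 0"
    by (rule star_exactly_one'[OF star_rotate[OF sb]]) (use c starD[OF sv] ch in auto)
  then have "a c e \<noteq> 0 \<or> a c f \<noteq> 0" using nonzero_sym by blast
  moreover have "star3 b v f e" using b star3_permute by blast
  ultimately show False using no_star3_star3_aux v b by blast
qed

end

context unlisted_graph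
begin

lemma no_star3_star4_aux:
  assumes v: "star3 v b c d" and b: "star4 b u u' v" and c: "gnorm (a c c) = 1" and uc: "a u c \<noteq> 0"
  shows False
proof -
  have sv: "star v b c d" and sb: "star b u u' v" using v b by (auto simp: star3_def star4_def)
  define \<epsilon> where "\<epsilon> = a v v"
  have eps: "gnorm \<epsilon> = 1" "\<epsilon> \<noteq> 0" using v by (auto simp: star3_def \<epsilon>_def)
  have ch: "a v v = \<epsilon>" "a b b = - \<epsilon>" "a c c = - \<epsilon>" "a d d = - \<epsilon>" "a u u = 0" "a u' u' = 0"
    using v b by (auto simp: star3_def star4_def \<epsilon>_def)
  have charged: "gnorm (a p p) = 1" if "p \<in> {v, b, c, d}" for p using that ch eps by auto
  have dv: "distinct [v, b, c, d]" and db: "distinct [b, u, u', v]" using sv sb by (auto simp: star_def)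
  have uncharged: "m \<notin> {v, b, c, d}" if "a m m = 0" for m using charged[of m] that by auto
  have une: "u \<notin> {v, b, c, d}" and u'ne: "u' \<notin> {v, b, c, d}" by (rule uncharged, rule ch)+
  have cne: "c \<notin> {b, u, u', v}" using dv une u'ne by auto
  have bu: "a b u \<noteq> 0" "a b u' \<noteq> 0" using starD[OF sb] by auto
  have svr: "star v c d b" using sv star_rotate by blast
  have "a c u \<noteq> 0 \<and> a d u = 0 \<or> a c u = 0 \<and> a d u \<noteq> 0"
    by (rule star_exactly_one'[OF svr]) (use une bu charged in auto)
  then have du: "a d u = 0" using uc nonzero_sym by blast
  have cv: "a v c \<noteq> 0" "a c v \<noteq> 0" "a d v \<noteq> 0" using starD[OF sv] by auto
  have "a u c \<noteq> 0 \<and> a u' c = 0 \<or> a u c = 0 \<and> a u' c \<noteq> 0"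
    by (rule star_exactly_one'[OF sb]) (use cne cv charged in auto)
  then have cu': "a c u' = 0" using uc nonzero_sym by blast
  have "a c u' \<noteq> 0 \<and> a d u' = 0 \<or> a c u' = 0 \<and> a d u' \<noteq> 0"
    by (rule star_exactly_one'[OF svr]) (use u'ne bu charged in auto)
  then have du': "a d u' \<noteq> 0" using cu' by blast
  have star4: "\<exists>q. star4 p m q v" if p: "p \<in> {c, d}" "a p m \<noteq> 0" "a m m = 0" for p m
  proof -
    have pv: "a p v \<noteq> 0" "p \<noteq> v" "gnorm (a p p) = 1" using p(1) cv charged dv by auto
    have mp: "m \<noteq> p" using uncharged[OF p(3)] p(1) by auto
    from pv(3) show ?thesis
    proof (cases rule: charged_cases)
      case (1 x y z)
      then have "m \<in> {x, y, z}" using 1 star_row[of p x y z m] p mp by (auto simp: star3_def)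
      then have "a m m = - a p p" using 1 by (auto simp: star3_def)
      then show ?thesis using p(3) pv(3) by auto
    next
      case (2 x y z)
      have "v = z" by (rule star4_charged[OF 2 pv(1)]) (use pv ch eps in auto)
      then show ?thesis using star4_exchange[OF 2 p(2) mp p(3)] by metis
    qed
  qed
  have cu: "a c u \<noteq> 0" using uc nonzero_sym by blast
  obtain w where w: "star4 c u w v" using star4[of c u] cu ch by auto
  obtain w' where w': "star4 d u' w' v" using star4[of d u'] du' ch by auto
  have sc: "star c u w v" and sd: "star d u' w' v" using w w' by (auto simp: star4_def)
  have cw: "a c w \<noteq> 0" "a w w = 0" using starD[OF sc] w by (auto simp: star4_def)
  have wne: "w \<notin> {v, b, c, d}" by (rule uncharged[OF cw(2)])
  have wu: "w \<noteq> u" "w \<noteq> u'" using sc cw cu' by (auto simp: star_def)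
  have bw: "a b w = 0" by (rule star_row[OF sb]) (use wne wu in auto)
  have "a d w \<noteq> 0 \<and> a b w = 0 \<or> a d w = 0 \<and> a b w \<noteq> 0"
    by (rule star_exactly_one'[OF star_rotate[OF star_rotate[OF sv]]]) (use wne cw charged in auto)
  then have dw: "a d w \<noteq> 0" using bw by blast
  then have "w' = w" using star_row[OF sd, of w] wne wu by auto
  then have w'': "star4 d u' w v" and sd: "star d u' w v" using w' sd by auto
  have du4: "distinct [b, c, u', w]" "distinct [b, d, u, w]" "distinct [c, d, u, u']"
    using dv db wne wu une u'ne by auto
  have g: "gnorm (a u b) = 1" "gnorm (a u c) = 1" "gnorm (a u u') = 1" "gnorm (a u w) = 1"
    "gnorm (a u' b) = 1" "gnorm (a u' d) = 1" "gnorm (a u' w) = 1"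
    "gnorm (a w c) = 1" "gnorm (a w d) = 1"
    using starD[OF sb] starD[OF sc] starD[OF sd] b w w'' by (auto simp: star4_def)
  have g': "gnorm (a u' u) = 1" "gnorm (a w u) = 1" "gnorm (a w u') = 1" using g gnorm_sym by metis+
  have n: "u < n" "u' < n" "w < n" using starD[OF sb] starD[OF sc] by auto
  have ru: "a u m = 0" if "m \<notin> {b, c, u', w}" for m
    by (rule row_supp[of "{b, c, u', w}"]) (use deg4[OF n(1)] g du4 that in auto)
  have ru': "a u' m = 0" if "m \<notin> {b, d, u, w}" for m
    by (rule row_supp[of "{b, d, u, w}"]) (use deg4[OF n(2)] g g' du4 that in auto)
  have rw: "a w m = 0" if "m \<notin> {c, d, u, u'}" for m
    by (rule row_supp[of "{c, d, u, u'}"]) (use deg4[OF n(3)] g g' du4 that in auto)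
  have dist: "distinct [b, u, u', v, c, d, w]" using dv db une u'ne wne wu by auto
  then have dist': "distinct [w, d, c, v, u', u, b]" by auto
  have "{b, u, u', v, c, d, w} = {..<n}"
  proof (rule conn)
    show "{b, u, u', v, c, d, w} \<subseteq> {..<n}" using n starD[OF sv] by auto
    show "j \<in> {b, u, u', v, c, d, w}" if "i \<in> {b, u, u', v, c, d, w}" "a i j \<noteq> 0" for i j
      using that star_row[OF sv, of j] star_row[OF sb, of j] star_row[OF sc, of j] star_row[OF sd, of j] ru[of j] ru'[of j] rw[of j]
      by blast
  qed simp
  then have V: "{..<n} = {b, u, u', v, c, d, w}" by simp
  have "listed n a"
    by (rule S_7_listed[OF V dist])
      (use dist dist' eps charged ch cw sv sb sc sd ru ru' in \<open>simp_all add: star_def\<close>)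
  then show False using unlisted by blast
qed

lemma no_star3:
  assumes v: "star3 v b c d"
  shows False
proof -
  have sv: "star v b c d" using v by (simp add: star3_def)
  have ch: "gnorm (a v v) = 1" "a b b = - a v v" "a c c = - a v v" using v by (auto simp: star3_def)
  have "gnorm (a b b) = 1" using ch by simp
  then show False
  proof (cases rule: charged_cases)
    case (1 x y z)
    then obtain e f where "star3 b v e f"
      using star3_exchange[OF 1, of v] starD[OF sv] sv by (auto simp: star_def)
    then show False using no_star3_star3 v by blast
  next
    case (2 x y z)
    have "v = z" by (rule star4_charged[OF 2]) (use starD[OF sv] sv ch in \<open>auto simp: star_def\<close>)
    then have b: "star4 b x y v" "star4 b y x v" using 2 star4_swap by auto
    have sb: "star b x y v" using b by (simp add: star4_def)
    have nz: "a c c \<noteq> 0" "gnorm (a c c) = 1" using ch by auto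
    have c: "c \<notin> {b, x, y, v}" using sv b nz by (auto simp: star_def star4_def)
    have "a x c \<noteq> 0 \<and> a y c = 0 \<or> a x c = 0 \<and> a y c \<noteq> 0"
      by (rule star_exactly_one'[OF sb]) (use c starD[OF sv] nz in auto)
    then show False using no_star3_star4_aux[OF v] b nz by blast
  qed
qed

lemma charged_star4:
  assumes "gnorm (a v v) = 1"
  obtains b c d where "star4 v b c d"
  using assms
proof (cases rule: charged_cases)
  case (1 b c d)
  then show thesis using no_star3 by blast
next
  case (2 b c d)
  then show thesis by (rule that)
qed

lemma no_star4_aux:
  assumes v: "star4 v b c d" and d: "star4 d e f v" and be: "gnorm (a b e) = 1" "a c e = 0"
  shows False
proof -
  have sv: "star v b c d" and sd: "star d e f v" using v d by (auto simp: star4_def)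
  have ch: "gnorm (a v v) = 1" "a d d = - a v v" "a b b = 0" "a c c = 0" "a e e = 0" "a f f = 0"
    using v d by (auto simp: star4_def)
  have dv: "distinct [v, b, c, d]" and dd: "distinct [d, e, f, v]" using sv sd by (auto simp: star_def)
  have z: "a c d = 0" "a d b = 0" "a f v = 0" "a v e = 0" "gnorm (a b c) = 1" "gnorm (a e f) = 1" "a b d = 0" "a d c = 0" "a v f = 0" "a e v = 0"
    using v d nonzero_sym by (auto simp: star4_def)
  have nz: "a d e \<noteq> 0" "a d f \<noteq> 0" "a v b \<noteq> 0" "a v c \<noteq> 0" using starD[OF sv] starD[OF sd] by auto
  have ne: "e \<notin> {v, b, c, d}" "f \<notin> {v, b, c, d}" "b \<notin> {d, e, f, v}" "c \<notin> {d, e, f, v}" using dv dd z nz by auto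
  have less: "v < n" "b < n" "c < n" "d < n" "e < n" "f < n" using starD[OF sv] starD[OF sd] by auto
  have rowsum: "(\<Sum>k\<in>S. gnorm (a i k)) \<le> 4" if "finite S" "i < n" for S i
    using deg_ge[OF that(1), of i] deg4[OF that(2)] by simp
  have gl: "gnorm (a b v) = 1" "gnorm (a c v) = 1" "gnorm (a d v) = 1" "gnorm (a e d) = 1" "gnorm (a f d) = 1" "gnorm (a v d) = 1"
    using starD[OF sv] starD[OF sd] sv by (auto simp: star_def)
  have gs: "gnorm (a c b) = 1" "gnorm (a f e) = 1" "gnorm (a e b) = 1" "a e c = 0" using z be gnorm_sym nonzero_sym by metis+
  have "gnorm (a e b) + gnorm (a f b) \<le> 2"
  proof -
    have "gnorm (a b v) + gnorm (a b c) + gnorm (a b e) + gnorm (a b f) \<le> 4"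
      using rowsum[of "{v, c, e, f}" b] less dv dd ne by (auto simp: insert_commute)
    then show ?thesis using gl z gnorm_sym[of e b] gnorm_sym[of f b] by simp
  qed
  then have fb: "a f b = 0" using star_exactly_one[OF sd ne(3)] sv gs by (auto simp: star_def)
  have "gnorm (a e c) + gnorm (a f c) \<le> 2"
  proof -
    have "gnorm (a c v) + gnorm (a c b) + gnorm (a c e) + gnorm (a c f) \<le> 4"
      using rowsum[of "{v, b, e, f}" c] less dv dd ne by (auto simp: insert_commute)
    then show ?thesis using gl gs gnorm_sym[of e c] gnorm_sym[of f c] by simp
  qed
  then have fc: "gnorm (a f c) = 1" using star_exactly_one[OF sd ne(4)] sv gs by (auto simp: star_def)
  have cf: "gnorm (a c f) = 1" "a b f = 0" using fc fb gnorm_sym nonzero_sym by metis+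
  have disb: "distinct [v, c, e]" "distinct [v, b, f]" "distinct [d, f, b]" "distinct [d, e, c]" "f \<noteq> b" using dv dd ne by auto
  obtain g where g: "g \<notin> {v, c, e}" "a b g \<noteq> 0" "g < n"
    using pick_nbr[of "{v, c, e}" b] deg4[OF less(2)] disb gl z be by auto
  have "gnorm (a b g) \<le> 1" using rowsum[of "{v, c, e, g}" b] less disb gl z be g by auto
  then have gbg: "gnorm (a b g) = 1" using gnorm_pos[OF g(2)] by simp
  have rb: "a b m = 0" if "m \<notin> {v, c, e, g}" for m
    by (rule row_supp[of "{v, c, e, g}"]) (use deg4[OF less(2)] disb gl z be g gbg that in auto)
  have gne: "g \<noteq> b" "g \<noteq> d" "g \<noteq> f" using g ch z cf by auto
  have "sq b c = a b v * a v c + a b c * a c c + a b e * a e c + a b g * a g c"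
    using sq_row4[of v c e g b c] rb disb g by auto
  then have "a b v * a v c + a b g * a g c = 0" using orth[of b c] dv ch gs by auto
  moreover have "a b v * a v c \<noteq> 0" using gl nz by auto
  ultimately have gc: "a c g \<noteq> 0" using nonzero_sym[of c g] by auto
  have "gnorm (a c g) \<le> 1" using rowsum[of "{v, b, f, g}" c] less disb gl gs cf g gne by auto
  then have gcg: "gnorm (a c g) = 1" using gnorm_pos[OF gc] by simp
  have rc: "a c m = 0" if "m \<notin> {v, b, f, g}" for m
    by (rule row_supp[of "{v, b, f, g}"]) (use deg4[OF less(3)] disb gl gs cf g gne gcg that in auto)
  have "finite {d, f, b}" "(\<Sum>k\<in>{d, f, b}. gnorm (a e k)) < deg e" using deg4[OF less(5)] disb gl z gs by simp_all
  then obtain h where h: "h \<notin> {d, f, b}" "a e h \<noteq> 0" "h < n" by (rule pick_nbr)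
  have "gnorm (a e h) \<le> 1" using rowsum[of "{d, f, b, h}" e] less disb gl z gs h by auto
  then have geh: "gnorm (a e h) = 1" using gnorm_pos[OF h(2)] by simp
  have re: "a e m = 0" if "m \<notin> {d, f, b, h}" for m
    by (rule row_supp[of "{d, f, b, h}"]) (use deg4[OF less(5)] disb gl z gs h geh that in auto)
  have hne: "h \<noteq> e" "h \<noteq> v" "h \<noteq> c" using h ch z gs by auto
  have "sq e f = a e d * a d f + a e f * a f f + a e b * a b f + a e h * a h f"
    using sq_row4[of d f b h e f] re disb h by auto
  then have "a e d * a d f + a e h * a h f = 0" using orth[of e f] dd ch cf by auto
  moreover have "a e d * a d f \<noteq> 0" using gl nz by auto
  ultimately have hf: "a f h \<noteq> 0" using nonzero_sym[of f h] by auto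
  have "gnorm (a f h) \<le> 1" using rowsum[of "{d, e, c, h}" f] less disb gl gs fc h hne by auto
  then have gfh: "gnorm (a f h) = 1" using gnorm_pos[OF hf] by simp
  have rf: "a f m = 0" if "m \<notin> {d, e, c, h}" for m
    by (rule row_supp[of "{d, e, c, h}"]) (use deg4[OF less(6)] disb gl gs fc h hne gfh that in auto)
  have "sq b e = a b v * a v e + a b c * a c e + a b e * a e e + a b g * a g e"
    using sq_row4[of v c e g b e] rb disb g by auto
  then have "a b g * a g e = 0" using orth[of b e] ne be z ch by auto
  then have ge: "a e g = 0" using g nonzero_sym[of e g] by auto
  then have gh: "h \<noteq> g" using h by auto
  have vg: "a v g = 0" by (rule star_row[OF sv]) (use g gne in auto)
  have vh: "a v h = 0" by (rule star_row[OF sv]) (use h hne in auto)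
  have ch0: "a c h = 0" by (rule rc) (use h hne gh in auto)
  have bh: "a b h = 0" by (rule rb) (use h hne gh in auto)
  have dh: "a d h = 0" by (rule star_row[OF sd]) (use h hne in auto)
  have dg: "a d g = 0" by (rule star_row[OF sd]) (use g gne in auto)
  have fg: "a f g = 0" by (rule rf) (use g gne gh in auto)
  have "sq b h = a b v * a v h + a b c * a c h + a b e * a e h + a b g * a g h"
    using sq_row4[of v c e g b h] rb disb g by auto
  then have "a b e * a e h + a b g * a g h = 0" using orth[of b h] h vh ch0 by auto
  moreover have "a b e * a e h \<noteq> 0" using be h by auto
  ultimately have gh0: "a g h \<noteq> 0" by auto
  have "sq b g = a b v * a v g + a b c * a c g + a b e * a e g + a b g * a g g"
    using sq_row4[of v c e g b g] rb disb g by auto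
  then have "a b c * a c g + a b g * a g g = 0" using orth[of b g] gne vg ge by auto
  moreover have "a b c * a c g \<noteq> 0" using z gc by auto
  ultimately have gg: "a g g \<noteq> 0" by auto
  have "sq e h = a e d * a d h + a e f * a f h + a e b * a b h + a e h * a h h"
    using sq_row4[of d f b h e h] re disb h by auto
  then have "a e f * a f h + a e h * a h h = 0" using orth[of e h] hne dh bh by auto
  moreover have "a e f * a f h \<noteq> 0" using z hf by auto
  ultimately have hh: "a h h \<noteq> 0" by auto
  have gG: "gnorm (a g b) = 1" "gnorm (a g c) = 1" "gnorm (a h e) = 1" "gnorm (a h f) = 1"
    using gbg gcg geh gfh gnorm_sym by metis+
  have dg4: "distinct [b, c, g, h]" "distinct [e, f, g, h]" using dv dd g gne h hne gh by auto
  have hg: "a h g \<noteq> 0" using gh0 nonzero_sym by blast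
  have rg: "a g m = 0" if "m \<notin> {b, c, g, h}" for m
    by (rule row_supp[of "{b, c, g, h}"])
      (use deg4[OF g(3)] dg4 gG gnorm_pos[OF gg] gnorm_pos[OF gh0] that in auto)
  have rh: "a h m = 0" if "m \<notin> {e, f, g, h}" for m
    by (rule row_supp[of "{e, f, g, h}"])
      (use deg4[OF h(3)] dg4 gG gnorm_pos[OF hh] gnorm_pos[OF hg] that in auto)
  have dist: "distinct [v, d, b, e, c, f, g, h]" using dv dd ne g gne h hne gh by auto
  have "{v, d, b, e, c, f, g, h} = {..<n}"
  proof (rule conn)
    show "{v, d, b, e, c, f, g, h} \<subseteq> {..<n}" using less g h by auto
    show "j \<in> {v, d, b, e, c, f, g, h}" if "i \<in> {v, d, b, e, c, f, g, h}" "a i j \<noteq> 0" for i j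
      using that star_row[OF sv, of j] star_row[OF sd, of j] rb[of j] rc[of j] re[of j] rf[of j] rg[of j] rh[of j] by blast
  qed simp
  then have V: "{..<n} = {v, d, b, e, c, f, g, h}" by simp
  have tree: "gnorm (a v b) = 1" "gnorm (a v c) = 1" "gnorm (a d e) = 1" "gnorm (a d f) = 1"
    using sv sd by (auto simp: star_def)
  have "listed n a"
    by (rule S_8_prime_listed[OF V dist]; fact)
  then show False using unlisted by blast
qed

lemma no_unit_charge: "gnorm (a v v) \<noteq> 1"
proof
  assume vc: "gnorm (a v v) = 1"
  then obtain b c d where v: "star4 v b c d" by (rule charged_star4)
  have sv: "star v b c d" using v by (simp add: star4_def)
  have dc: "a d d = - a v v" "gnorm (a d d) = 1" using v by (auto simp: star4_def)
  obtain e f z where d0: "star4 d e f z" using charged_star4[OF dc(2)] .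
  have "v = z" by (rule star4_charged[OF d0]) (use starD[OF sv] sv vc in \<open>auto simp: star_def\<close>)
  then have d: "star4 d e f v" using d0 by simp
  have sd: "star d e f v" using d by (simp add: star4_def)
  have nz: "a d e \<noteq> 0" "a d v \<noteq> 0" using starD[OF sd] by auto
  have z: "a d b = 0" "a d c = 0" "a e e = 0" "gnorm (a e f) = 1" using v d nonzero_sym by (auto simp: star4_def)
  have vv: "a v v \<noteq> 0" using vc by auto
  have e: "e \<notin> {v, b, c, d}" using z nz vv dc sd by (auto simp: star_def)
  have ge: "gnorm (a e d) = 1" "gnorm (a d e) = 1" using starD[OF sd] sd by (auto simp: star_def)
  have "distinct [d, f, b, c]" using sv sd z starD[OF sd] by (auto simp: star_def)
  then have "gnorm (a e d) + gnorm (a e f) + gnorm (a e b) + gnorm (a e c) \<le> 4"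
    using deg_ge[of "{d, f, b, c}" e] deg4[OF starD(2)[OF sd]] by simp
  then have "gnorm (a b e) + gnorm (a c e) \<le> 2" using ge z gnorm_sym[of b e] gnorm_sym[of c e] by simp
  then have "gnorm (a b e) = 1 \<and> a c e = 0 \<or> a b e = 0 \<and> gnorm (a c e) = 1"
    using star_exactly_one[OF sv e] ge by blast
  then show False using no_star4_aux[OF v d] no_star4_aux[OF star4_swap[OF v] d] by blast
qed

end

lemma distinct_ladder_vertices: "distinct (ladder_vertices k)"
proof (induction k)
  case (Suc k)
  have "ladder_vertices (Suc k) = ladder_vertices k @ [Top (Suc k), Bot (Suc k)]" by (simp add: ladder_vertices_def)
  then show ?case using Suc by (simp add: set_ladder_vertices rungs_def)
qed (simp add: ladder_vertices_def)

lemma equivalent_if_listed: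
  assumes A: "A \<in> gauss_mats n" and l: "listed n (entries A)"
  shows "(\<exists>k \<ge> 2. equivalent_mats A (adjacency_mat (C_pp k))) \<or>
         (\<exists>k \<ge> 2. equivalent_mats A (adjacency_mat (C_pm k))) \<or>
         (\<exists>k \<ge> 1. equivalent_mats A (adjacency_mat (C_odd k))) \<or>
         equivalent_mats A (adjacency_mat S_1) \<or>
         equivalent_mats A (adjacency_mat S_4) \<or>
         equivalent_mats A (adjacency_mat S_4_dagger) \<or>
         equivalent_mats A (adjacency_mat S_7) \<or>
         equivalent_mats A (adjacency_mat S_8) \<or>
         equivalent_mats A (adjacency_mat S_8')"
proof -
  have "distinct (fst (C_pp k))" "distinct (fst (C_pm k))" "distinct (fst (C_odd k))" for k
    using distinct_ladder_vertices[of k] by (simp_all add: C_pp_def C_pm_def C_odd_def set_ladder_vertices rungs_def)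
  moreover have "distinct (fst S_1)" "distinct (fst S_4)" "distinct (fst S_4_dagger)" "distinct (fst S_7)"
    "distinct (fst S_8)" "distinct (fst S_8')"
    by (simp_all add: S_1_def S_4_def S_4_dagger_def S_7_def S_8_def S_8'_def)
  ultimately show ?thesis
    using l equivalent_if_realizes[OF A, where 'a = ladder_vertex] equivalent_if_realizes[OF A, where 'a = letter]
    unfolding listed_def by meson
qed

theorem theorem3p3:
  fixes A :: "complex mat"
  assumes "maximal_indecomposable_cyclotomic A"
    and "\<exists>i < dim_row A. A $$ (i, i) \<noteq> 0"
  shows "(\<exists>k \<ge> 2. equivalent_mats A (adjacency_mat (C_pp k))) \<or>
         (\<exists>k \<ge> 2. equivalent_mats A (adjacency_mat (C_pm k))) \<or>
         (\<exists>k \<ge> 1. equivalent_mats A (adjacency_mat (C_odd k))) \<or>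
         equivalent_mats A (adjacency_mat S_1) \<or>
         equivalent_mats A (adjacency_mat S_4) \<or>
         equivalent_mats A (adjacency_mat S_4_dagger) \<or>
         equivalent_mats A (adjacency_mat S_7) \<or>
         equivalent_mats A (adjacency_mat S_8) \<or>
         equivalent_mats A (adjacency_mat S_8')"
proof -
  define n where "n = dim_row A"
  interpret m: maximal_graph n "entries A" unfolding n_def by (rule maximal_graph_entries[OF assms(1)])
  obtain i where i: "i < n" "entries A i i \<noteq> 0" using assms(2) by (auto simp: n_def entries_def)
  interpret regular_graph n "entries A" by (rule m.regular_if_charged[OF i])
  have "listed n (entries A)"
  proof (cases "gnorm (entries A i i) = 1")
    case True
    show ?thesis
    proof (rule ccontr)
      assume "\<not> ?thesis"
      then interpret unlisted_graph n "entries A" by unfold_locales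
      show False using no_unit_charge True by blast
    qed
  next
    case False
    then show ?thesis by (rule listed_if_charge_2[OF i])
  qed
  moreover have "A \<in> gauss_mats n"
    using assms(1) by (simp add: maximal_indecomposable_cyclotomic_def cyclotomic_def n_def)
  ultimately show ?thesis by (intro equivalent_if_listed)
qed

end
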